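(* Let $\alpha>0$ and let $v(z)=\exp\left(-\frac{\alpha}{1-|z|}\right)$ for $z\in\mathbb{D}$. For $1<p<\infty$, the dual of $A^p_{v^{p/2}}$ is $A^q_{v^{q/2}}$ under the pairing $$\langle f,g\rangle=\int_{\mathbb{D}}f\,\overline{g}\,v\,dm,$$ where $1/p+1/q=1$. Moreover, the dual of $A^1_{v^{1/2}}$ is $A^\infty_{v^{1/2}}$ under the same pairing.
   Context: $\mathbb{D}$ is the open unit disc in $\mathbb{C}$ and $dm(z)=\frac{dx\,dy}{\pi}$ is normalized area measure. For a weight $w:\mathbb{D}\to(0,\infty)$ and $0<p<\infty$, $A^p_w$ is the space of analytic functions $f$ on $\mathbb{D}$ with $\|f\|_{A^p_w}^p=\int_{\mathbb{D}}|f(z)|^pw(z)\,dm(z)<\infty$; $A^\infty_w$ is the space of analytic functions $f$ on $\mathbb{D}$ with $\|f\|_{A^\infty_w}=\sup_{z\in\mathbb{D}}|f(z)|w(z)<\infty$. "The dual of $X$ is $Y$ under the pairing $\langle\cdot,\cdot\rangle$" means that $g\mapsto\langle\cdot,g\rangle$ is a (conjugate-linear) bijection of $Y$ onto the space of bounded linear functionals on $X$, with the functional norm equivalent to the norm of $g$ in $Y$. *)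

theory Defs
  imports "HOL-Analysis.Analysis"
begin

abbreviation unit_disc :: "complex set" where
  "unit_disc \<equiv> ball 0 1"

text \<open>The normalized area measure \<open>dx dy / \<pi>\<close>, as a measure whose space is the disc.\<close>

definition disc_area :: "complex measure" where
  "disc_area = density (restrict_space lborel unit_disc) (\<lambda>_. ennreal (1 / pi))"

text \<open>
  An analytic function on the disc is represented by the total function that extends it by zero,
  so that equality of functions on the disc is equality in HOL.
\<close>

definition disc_analytic :: "(complex \<Rightarrow> complex) set" where
  "disc_analytic = {f. f holomorphic_on unit_disc \<and> (\<forall>z. z \<notin> unit_disc \<longrightarrow> f z = 0)}"

definition bergman :: "real \<Rightarrow> (complex \<Rightarrow> real) \<Rightarrow> (complex \<Rightarrow> complex) set" where
  "bergman p w = {f \<in> disc_analytic. integrable disc_area (\<lambda>z. norm (f z) powr p * w z)}"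

definition bergman_norm :: "real \<Rightarrow> (complex \<Rightarrow> real) \<Rightarrow> (complex \<Rightarrow> complex) \<Rightarrow> real" where
  "bergman_norm p w f = (\<integral>z. norm (f z) powr p * w z \<partial>disc_area) powr (1 / p)"

definition bergman_inf :: "(complex \<Rightarrow> real) \<Rightarrow> (complex \<Rightarrow> complex) set" where
  "bergman_inf w = {f \<in> disc_analytic. bdd_above ((\<lambda>z. norm (f z) * w z) ` unit_disc)}"

definition bergman_inf_norm :: "(complex \<Rightarrow> real) \<Rightarrow> (complex \<Rightarrow> complex) \<Rightarrow> real" where
  "bergman_inf_norm w f = (SUP z\<in>unit_disc. norm (f z) * w z)"

definition exp_weight :: "real \<Rightarrow> complex \<Rightarrow> real" where
  "exp_weight \<alpha> z = exp (- (\<alpha> / (1 - norm z)))"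

definition weighted_pairing ::
    "(complex \<Rightarrow> real) \<Rightarrow> (complex \<Rightarrow> complex) \<Rightarrow> (complex \<Rightarrow> complex) \<Rightarrow> complex" where
  "weighted_pairing w f g = (\<integral>z. f z * cnj (g z) * of_real (w z) \<partial>disc_area)"

text \<open>
  Bounded linear functionals on a space \<open>X\<close> of functions, with norm \<open>N\<close>; they are
  \<^const>\<open>extensional\<close>, so that two functionals that agree on \<open>X\<close> are equal.
\<close>

definition dual_space ::
    "('a \<Rightarrow> complex) set \<Rightarrow> (('a \<Rightarrow> complex) \<Rightarrow> real) \<Rightarrow> (('a \<Rightarrow> complex) \<Rightarrow> complex) set" where
  "dual_space X N = {\<phi> \<in> extensional X.
     (\<forall>f\<in>X. \<forall>g\<in>X. \<phi> (\<lambda>z. f z + g z) = \<phi> f + \<phi> g) \<and>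
     (\<forall>c. \<forall>f\<in>X. \<phi> (\<lambda>z. c * f z) = c * \<phi> f) \<and>
     (\<exists>C. \<forall>f\<in>X. norm (\<phi> f) \<le> C * N f)}"

definition dual_norm ::
    "('a \<Rightarrow> complex) set \<Rightarrow> (('a \<Rightarrow> complex) \<Rightarrow> real) \<Rightarrow> (('a \<Rightarrow> complex) \<Rightarrow> complex) \<Rightarrow> real" where
  "dual_norm X N \<phi> = (SUP f\<in>{f \<in> X. N f \<le> 1}. norm (\<phi> f))"

definition is_dual_under ::
    "('a \<Rightarrow> complex) set \<Rightarrow> (('a \<Rightarrow> complex) \<Rightarrow> real) \<Rightarrow>
     ('b \<Rightarrow> complex) set \<Rightarrow> (('b \<Rightarrow> complex) \<Rightarrow> real) \<Rightarrow>
     (('a \<Rightarrow> complex) \<Rightarrow> ('b \<Rightarrow> complex) \<Rightarrow> complex) \<Rightarrow> bool" where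
  "is_dual_under X NX Y NY B \<longleftrightarrow>
     (\<forall>f\<in>X. \<forall>g\<in>Y. \<forall>h\<in>Y. B f (\<lambda>z. g z + h z) = B f g + B f h) \<and>
     (\<forall>c. \<forall>f\<in>X. \<forall>g\<in>Y. B f (\<lambda>z. c * g z) = cnj c * B f g) \<and>
     bij_betw (\<lambda>g. restrict (\<lambda>f. B f g) X) Y (dual_space X NX) \<and>
     (\<exists>c>0. \<exists>C>0. \<forall>g\<in>Y.
        c * NY g \<le> dual_norm X NX (restrict (\<lambda>f. B f g) X) \<and>
        dual_norm X NX (restrict (\<lambda>f. B f g) X) \<le> C * NY g)"

text \<open>
  The Bochner integral of a non-integrable function is \<open>0\<close>; this predicate says that every
  integral defining the pairing on \<open>X \<times> Y\<close> converges absolutely.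
\<close>

definition pairing_defined ::
    "(complex \<Rightarrow> real) \<Rightarrow> (complex \<Rightarrow> complex) set \<Rightarrow> (complex \<Rightarrow> complex) set \<Rightarrow> bool" where
  "pairing_defined w X Y \<longleftrightarrow>
     (\<forall>f\<in>X. \<forall>g\<in>Y. integrable disc_area (\<lambda>z. f z * cnj (g z) * of_real (w z)))"

end

theory Submission
  imports Defs "HOL-Complex_Analysis.Complex_Analysis"
begin

text \<open>
  Write \<open>v\<close> for the weight, \<open>s\<close> for its square root and \<open>\<omega>\<^sub>n\<close> for the moment of \<open>|z|\<^sup>2\<^sup>n\<close>. Everything follows
  from the estimate \<open>\<integral> |K(\<zeta>, z)| s(\<zeta>) dm(\<zeta>) \<le> C / s(z)\<close> for the reproducing kernel
  \<open>K(z, \<zeta>) = \<Sum> (z cnj \<zeta>)\<^sup>n / \<omega>\<^sub>n\<close>, which makes the Bergman projection bounded on all the spaces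
  \<open>L\<^sup>p(s\<^sup>p)\<close>, \<open>p \<ge> 1\<close>.

  Put \<open>a = 1 - |z|\<close>. By the Cauchy-Schwarz inequality with the weight \<open>(1 + |\<zeta> - z|\<^sup>2 / a\<^sup>3)\<^sup>2\<close>, the
  estimate reduces to bounds for the \<open>L\<^sup>2(v)\<close> norms of \<open>K(\<cdot>, z)\<close> and \<open>(\<zeta> - z)\<^sup>2 K(\<zeta>, z)\<close>. The first
  norm is bounded by the submean value property, since on a disc of radius about \<open>a\<close> to the power
  \<open>3/2\<close> the weight is comparable to the modulus of \<open>exp (- \<alpha> / (1 - \<zeta>))\<close>. The second one is a series
  in the ratios \<open>q\<^sub>n = \<omega>\<^sub>n / \<omega>\<^sub>n\<^sub>-\<^sub>1\<close>: in terms of the measure \<open>p\<^sub>n = |z|\<^sup>2\<^sup>n / \<omega>\<^sub>n\<close> on the integers it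
  amounts to the fourth moment of \<open>q\<^sub>n - |z|\<^sup>2\<close>, and the identity \<open>p\<^sub>n\<^sub>+\<^sub>1 q\<^sub>n\<^sub>+\<^sub>1 = |z|\<^sup>2 p\<^sub>n\<close> (a discrete
  integration by parts) reduces that to the increments of \<open>q\<close>, that is, to variances of the radial
  weights, which integration by parts controls.

  A functional \<open>\<phi>\<close> on \<open>A\<^sup>p\<close> is then represented by \<open>g(z) = cnj (\<phi> (K(\<cdot>, z)))\<close>. No extension of \<open>\<phi>\<close> to
  \<open>L\<^sup>p\<close> is needed: testing \<open>\<phi>\<close> on projections of bounded compactly supported functions already gives
  the norm of \<open>g\<close>.
\<close>

subsection \<open>Area measure on the disc\<close>

text \<open>The exponents in the overview come from a balance. Put \<open>d = a^3\<close> and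
  \<open>E = exp (\<alpha> / a)\<close>, which is \<open>1 / s(z)^2\<close>. The two squared kernel
  norms are bounded by multiples of \<open>E / d\<close> and \<open>d * E\<close>, and the
  reciprocal of the auxiliary weight integrates to at most \<open>d\<close>; Cauchy-Schwarz then
  gives a multiple of \<open>sqrt ((E / d + d * E / d^2) * d)\<close>, that is of
  \<open>1 / s(z)\<close>, with no power of \<open>a\<close> left over. No closed form of K enters.
  What is known of the ratios is that they increase, that \<open>1 - q_n\<close> is at least of
  order \<open>n^(-1/2)\<close>, and that their increments are at most of order
  \<open>n^(-3/2)\<close>. The measure \<open>p_n\<close> is concentrated where \<open>q_n\<close>
  is close to \<open>|z|^2\<close>, at \<open>n\<close> of order \<open>a^(-2)\<close>; increments
  there are of order \<open>a^3\<close>, so \<open>q_n - |z|^2\<close> has size about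
  \<open>a^(3/2)\<close> and its fourth moment has relative size \<open>a^6\<close>. Since
  \<open>v = s * s\<close>, the spaces with weights \<open>s^p\<close> and \<open>s^q\<close> pair
  by Hoelder's inequality, and the symmetric kernel \<open>|K| * s * s\<close> has bounded integrals
  in either variable, so Schur's test works with constant test functions for all exponents from
  \<open>1\<close> on.\<close>

lemma space_disc_area [simp]: "space disc_area = unit_disc"
  by (simp add: disc_area_def space_restrict_space)

lemma sets_disc_area: "sets disc_area = sets (restrict_space borel unit_disc)"
  by (simp add: disc_area_def sets_restrict_space)

lemma measurable_disc_area_cong: "measurable disc_area N = measurable (restrict_space borel unit_disc) N"
  by (rule measurable_cong_sets) (simp_all add: sets_disc_area)

lemma measurable_disc_areaI [measurable (raw)]:
  "f \<in> measurable borel N \<Longrightarrow> f \<in> measurable disc_area N"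
  by (simp add: measurable_disc_area_cong measurable_restrict_space1)

lemma continuous_on_measurable_disc_area:
  "continuous_on unit_disc f \<Longrightarrow> f \<in> borel_measurable disc_area"
  by (simp add: measurable_disc_area_cong borel_measurable_continuous_on_restrict)

lemma nn_integral_disc_area:
  assumes "f \<in> borel_measurable disc_area"
  shows "(\<integral>\<^sup>+z. f z \<partial>disc_area) = ennreal (1/pi) * (\<integral>\<^sup>+z. f z * indicator unit_disc z \<partial>lborel)"
proof -
  have [measurable]: "f \<in> borel_measurable (restrict_space lborel unit_disc)"
    using assms by (simp add: disc_area_def)
  have [measurable]: "(\<lambda>z. f z * indicator unit_disc z) \<in> borel_measurable lborel"
    by (subst borel_measurable_restrict_space_iff_ennreal[symmetric])
       (use \<open>f \<in> borel_measurable (restrict_space lborel unit_disc)\<close> in auto)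
  have "(\<integral>\<^sup>+z. f z \<partial>disc_area) = (\<integral>\<^sup>+z. ennreal (1/pi) * f z \<partial>restrict_space lborel unit_disc)"
    unfolding disc_area_def by (subst nn_integral_density) auto
  also have "\<dots> = (\<integral>\<^sup>+z. ennreal (1/pi) * (f z * indicator unit_disc z) \<partial>lborel)"
    by (subst nn_integral_restrict_space) (auto simp: mult.assoc)
  also have "\<dots> = ennreal (1/pi) * (\<integral>\<^sup>+z. f z * indicator unit_disc z \<partial>lborel)"
    by (rule nn_integral_cmult) measurable
  finally show ?thesis .
qed

lemma emeasure_complex_ball: "r \<ge> 0 \<Longrightarrow> emeasure lborel (ball (c::complex) r) = ennreal (pi * r^2)"
  by (simp add: emeasure_ball unit_ball_vol_2)

lemma emeasure_disc_area_space: "emeasure disc_area (space disc_area) = 1"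
proof -
  have "emeasure disc_area (space disc_area) = (\<integral>\<^sup>+z. 1 \<partial>disc_area)" by simp
  also have "\<dots> = ennreal (1/pi) * emeasure lborel (unit_disc :: complex set)"
    by (subst nn_integral_disc_area) auto
  also have "\<dots> = 1" by (simp add: emeasure_complex_ball ennreal_mult[symmetric])
  finally show ?thesis .
qed

interpretation disc_area: finite_measure disc_area
  by standard (simp add: emeasure_disc_area_space del: space_disc_area)

lemma measure_disc_area_space: "measure disc_area unit_disc = 1"
  using emeasure_disc_area_space by (simp add: measure_def)

section \<open>Integration of radial functions\<close>

text \<open>Polar coordinates with the angle integrated out: both measures give the half line above
  \<open>x\<close> the area of an annulus, with \<open>x\<close> clamped to the interval from
  \<open>0\<close> to \<open>R\<close> so that one formula serves all \<open>x\<close>.\<close>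

lemma distr_norm_ball:
  assumes "R > 0"
  shows "distr (restrict_space lborel (ball (0::complex) R)) borel norm =
    density lborel (\<lambda>t. ennreal (2 * pi * t) * indicator {0<..<R} t)" (is "?M = ?N")
proof (rule measure_eqI_lessThan)
  have M: "emeasure ?M {x<..} = ennreal (pi * R^2 - pi * (max 0 (min R x))^2)" if "True" for x
  proof (cases "x < 0")
    case True
    then have "emeasure ?M {x<..} = emeasure lborel (ball (0::complex) R)"
      by (subst emeasure_distr)
         (auto simp: measurable_restrict_space1 space_restrict_space emeasure_restrict_space intro!: arg_cong[where f="emeasure lborel"]
            intro: less_le_trans[OF _ norm_ge_zero])
    with True assms show ?thesis by (simp add: emeasure_complex_ball)
  next
    case False
    have "emeasure ?M {x<..} = emeasure lborel (ball (0::complex) R - cball 0 (min R x))"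
      by (subst emeasure_distr)
         (auto simp: measurable_restrict_space1 space_restrict_space emeasure_restrict_space dist_norm intro!: arg_cong[where f="emeasure lborel"])
    \<comment> \<open>The closed ball is traded for the open one, whose area is known, at the cost
      of a null circle.\<close>
    also have "ball (0::complex) R - cball 0 (min R x) = ball 0 R - ball 0 (min R x) - sphere 0 (min R x)" by auto
    also have "emeasure lborel \<dots> = emeasure lborel (ball (0::complex) R - ball 0 (min R x))"
      by (rule emeasure_Diff_null_set) (use negligible_sphere[of 0 "min R x"] in \<open>auto simp: negligible_iff_null_sets null_sets_completion_iff\<close>)
    also have "\<dots> = emeasure lborel (ball (0::complex) R) - emeasure lborel (ball (0::complex) (min R x))"
      by (rule emeasure_Diff) (use False assms in \<open>auto simp: emeasure_complex_ball\<close>)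
    also have "\<dots> = ennreal (pi * R^2 - pi * (max 0 (min R x))^2)"
      using False assms by (simp add: emeasure_complex_ball max_def ennreal_minus)
    finally show ?thesis .
  qed
  have N: "emeasure ?N {x<..} = ennreal (pi * R^2 - pi * (max 0 (min R x))^2)" for x
  proof -
    define a where "a = max 0 (min R x)"
    have a: "0 \<le> a" "a \<le> R" using assms by (auto simp: a_def)
    have "emeasure ?N {x<..} = (\<integral>\<^sup>+t. ennreal (2 * pi * t) * indicator {0<..<R} t * indicator {x<..} t \<partial>lborel)"
      by (subst emeasure_density) auto
    also have "\<dots> = (\<integral>\<^sup>+t. ennreal (2 * pi * t) * indicator {a..R} t \<partial>lborel)"
    proof (rule nn_integral_cong_AE)
      have "AE t in lborel. t \<noteq> a" "AE t in lborel. t \<noteq> R" by (rule AE_lborel_singleton)+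
      then show "AE t in lborel. ennreal (2 * pi * t) * indicator {0<..<R} t * indicator {x<..} t = ennreal (2 * pi * t) * indicator {a..R} t"
        by eventually_elim (use assms in \<open>auto simp: a_def indicator_def max_def min_def split: if_splits\<close>)
    qed
    also have "\<dots> = ennreal (pi * R^2 - pi * a^2)"
      by (rule nn_integral_FTC_Icc) (use a in \<open>auto intro!: derivative_eq_intros\<close>)
    finally show ?thesis by (simp add: a_def)
  qed
  show "emeasure ?M {x<..} = emeasure ?N {x<..}" for x using M N by simp
  show "emeasure ?M {x<..} < \<infinity>" for x using M by simp
qed auto

lemma nn_integral_norm_ball:
  assumes "R > 0" and [measurable]: "g \<in> borel_measurable borel"
  shows "(\<integral>\<^sup>+z. g (norm z) * indicator (ball (0::complex) R) z \<partial>lborel) =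
     (\<integral>\<^sup>+t. ennreal (2 * pi * t) * g t * indicator {0<..<R} t \<partial>lborel)"
proof -
  have "(\<integral>\<^sup>+z. g (norm z) * indicator (ball (0::complex) R) z \<partial>lborel) =
     (\<integral>\<^sup>+z. g (norm z) \<partial>restrict_space lborel (ball (0::complex) R))"
    by (subst nn_integral_restrict_space) auto
  also have "\<dots> = (\<integral>\<^sup>+t. g t \<partial>distr (restrict_space lborel (ball (0::complex) R)) borel norm)"
    by (subst nn_integral_distr) (auto simp: measurable_restrict_space1)
  also have "\<dots> = (\<integral>\<^sup>+t. ennreal (2 * pi * t) * indicator {0<..<R} t * g t \<partial>lborel)"
    unfolding distr_norm_ball[OF assms(1)] by (subst nn_integral_density) auto
  finally show ?thesis by (simp add: mult_ac)
qed

lemma nn_integral_norm_disc_area: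
  assumes [measurable]: "g \<in> borel_measurable borel"
  shows "(\<integral>\<^sup>+z. g (norm z) \<partial>disc_area) = (\<integral>\<^sup>+t. ennreal (2 * t) * g t * indicator {0<..<1} t \<partial>lborel)"
proof -
  have "(\<integral>\<^sup>+z. g (norm z) \<partial>disc_area) =
     ennreal (1/pi) * (\<integral>\<^sup>+t. ennreal (2 * pi * t) * g t * indicator {0<..<1} t \<partial>lborel)"
    by (subst nn_integral_disc_area) (auto simp: nn_integral_norm_ball)
  also have "\<dots> = (\<integral>\<^sup>+t. ennreal (1/pi) * (ennreal (2 * pi * t) * g t * indicator {0<..<1} t) \<partial>lborel)"
    by (rule nn_integral_cmult[symmetric]) measurable
  also have "\<dots> = (\<integral>\<^sup>+t. ennreal (2 * t) * g t * indicator {0<..<1} t \<partial>lborel)"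
    by (intro nn_integral_cong) (auto simp: mult.assoc[symmetric] ennreal_mult'[symmetric] split: split_indicator)
  finally show ?thesis .
qed

lemma integral_norm_disc_area:
  fixes g :: "real \<Rightarrow> real"
  assumes [measurable]: "g \<in> borel_measurable borel" and nn: "\<And>t. 0 \<le> t \<Longrightarrow> t < 1 \<Longrightarrow> g t \<ge> 0"
  shows "(\<integral>z. g (norm z) \<partial>disc_area) = (LBINT t:{0<..<1}. 2 * t * g t)"
proof -
  have "(\<integral>z. g (norm z) \<partial>disc_area) = enn2real (\<integral>\<^sup>+z. ennreal (g (norm z)) \<partial>disc_area)"
    by (rule integral_eq_nn_integral) (auto intro!: AE_I2 nn)
  also have "(\<integral>\<^sup>+z. ennreal (g (norm z)) \<partial>disc_area) = (\<integral>\<^sup>+t. ennreal (2 * t) * ennreal (g t) * indicator {0<..<1} t \<partial>lborel)"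
    by (rule nn_integral_norm_disc_area) measurable
  also have "\<dots> = (\<integral>\<^sup>+t. ennreal (indicator {0<..<1} t *\<^sub>R (2 * t * g t)) \<partial>lborel)"
    by (intro nn_integral_cong) (auto simp: nn ennreal_mult split: split_indicator)
  also have "enn2real \<dots> = (LBINT t:{0<..<1}. 2 * t * g t)"
    unfolding set_lebesgue_integral_def
    by (rule integral_eq_nn_integral[symmetric]) (auto intro!: AE_I2 mult_nonneg_nonneg nn split: split_indicator)
  finally show ?thesis .
qed

section \<open>Rotation invariance and orthogonality of monomials\<close>

text \<open>Carries Lebesgue measure from \<open>real^2\<close>, where invariance under orthogonal
  maps is available, to \<open>complex\<close>; boxes correspond to boxes with the same sides, and
  these determine the measure.\<close>

lemma distr_lborel_vec2_complex: "distr lborel borel (\<lambda>v::real^2. Complex (v$1) (v$2)) = lborel"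
proof (rule lborel_eqI[symmetric])
  fix l u :: complex
  assume le: "\<And>b. b \<in> Basis \<Longrightarrow> l \<bullet> b \<le> u \<bullet> b"
  have [measurable]: "(\<lambda>v::real^2. Complex (v$1) (v$2)) \<in> borel_measurable borel"
    by (intro borel_measurable_continuous_onI) (auto simp: Complex_eq intro!: continuous_intros)
  have "(\<lambda>v::real^2. Complex (v$1) (v$2)) -` box l u = box (vector [Re l, Im l]) (vector [Re u, Im u])"
    by (auto simp: set_eq_iff interval_cbox_cart mem_box_cart in_box_complex_iff forall_2)
  moreover have "emeasure lborel (box (vector [Re l, Im l]) (vector [Re u, Im u]) :: (real^2) set)
     = (\<Prod>b\<in>Basis. (vector [Re u, Im u] - vector [Re l, Im l] :: real^2) \<bullet> b)"
    using le[of 1] le[of \<i>] by (intro emeasure_lborel_box)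
      (auto simp: Basis_vec_def inner_axis Basis_complex_def cart_eq_inner_axis[symmetric] UNIV_2 algebra_simps)
  moreover have "(\<Prod>b\<in>Basis. (vector [Re u, Im u] - vector [Re l, Im l] :: real^2) \<bullet> b) = (\<Prod>b\<in>Basis. (u - l) \<bullet> b)"
  proof -
    have "axis (1::2) (1::real) \<noteq> axis 2 1" by (simp add: axis_eq_axis)
    then show ?thesis
    by (simp add: Basis_vec_def Basis_complex_def UNIV_2 cart_eq_inner_axis[symmetric] inner_axis)
  qed
  ultimately show "emeasure (distr lborel borel (\<lambda>v::real^2. Complex (v$1) (v$2))) (box l u) = (\<Prod>b\<in>Basis. (u - l) \<bullet> b)"
    by (subst emeasure_distr) auto
qed auto

text \<open>
  The library knows the invariance of Lebesgue measure under orthogonal maps only for \<open>real ^ 'n\<close>.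
\<close>

lemma distr_lborel_complex_mult:
  assumes c: "norm (c::complex) = 1"
  shows "distr lborel borel (\<lambda>z. c * z) = lborel"
proof (rule lborel_eqI[symmetric])
  fix l u :: complex
  assume le: "\<And>b. b \<in> Basis \<Longrightarrow> l \<bullet> b \<le> u \<bullet> b"
  define V where "V = (\<lambda>v::real^2. Complex (v$1) (v$2))"
  \<comment> \<open>The rotation by \<open>cnj c\<close>, not by \<open>c\<close>: the preimage of a
    box under multiplication by \<open>c\<close> is its image under the inverse rotation.\<close>
  define f :: "real^2 \<Rightarrow> real^2" where "f v = vector [Re (cnj c * V v), Im (cnj c * V v)]" for v
  have Vm [measurable]: "V \<in> borel_measurable borel" unfolding V_def
    by (intro borel_measurable_continuous_onI) (auto simp: Complex_eq intro!: continuous_intros)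
  have Vf: "V (f v) = cnj c * V v" for v by (simp add: V_def f_def complex_eq_iff)
  have inj: "V x = V y \<Longrightarrow> x = y" for x y by (simp add: V_def vec_eq_iff forall_2)
  have cc: "c * cnj c = 1" using c by (simp add: complex_norm_square[symmetric])
  have normV: "norm (V v) = norm v" for v
    by (simp add: V_def cmod_def norm_vec_def L2_set_def UNIV_2)
  have lin: "linear f"
    by (rule linearI) (simp_all add: f_def V_def vec_eq_iff forall_2 algebra_simps)
  have orth: "orthogonal_transformation f"
    unfolding orthogonal_transformation using lin normV[of "f v" for v] normV c
    by (auto simp: Vf norm_mult)
  have *: "emeasure lborel (V -` S) = emeasure lborel S" if "S \<in> sets borel" for S
    using that by (subst distr_lborel_vec2_complex[symmetric]) (simp add: emeasure_distr V_def[symmetric])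
  have eq: "V -` ((\<lambda>z. c * z) -` box l u) = f ` (V -` box l u)"
  proof (intro equalityI subsetI)
    fix v assume "v \<in> f ` (V -` box l u)"
    then show "v \<in> V -` ((\<lambda>z. c * z) -` box l u)"
      by (auto simp: Vf mult.assoc[symmetric] cc)
  next
    fix v assume v: "v \<in> V -` ((\<lambda>z. c * z) -` box l u)"
    define w :: "real^2" where "w = vector [Re (c * V v), Im (c * V v)]"
    have w: "V w = c * V v" by (simp add: V_def w_def complex_eq_iff)
    have "f w = v" by (rule inj) (simp add: Vf w mult.assoc[symmetric] cc mult.commute[of "cnj c"])
    then show "v \<in> f ` (V -` box l u)" using v w by (intro image_eqI[of _ _ w]) auto
  qed
  have bx: "V -` box l u = box (vector [Re l, Im l]) (vector [Re u, Im u])"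
    by (auto simp: V_def mem_box_cart in_box_complex_iff forall_2)
  have lm: "V -` box l u \<in> lmeasurable" by (simp add: bx)
  have Sm: "(\<lambda>z. c * z) -` box l u \<in> sets borel"
    using measurable_sets[of "\<lambda>z. c * z" borel borel "box l u"] by simp
  have Sm2: "V -` ((\<lambda>z. c * z) -` box l u) \<in> sets borel"
    using measurable_sets[OF Vm Sm] by simp
  have "emeasure (distr lborel borel (\<lambda>z. c * z)) (box l u) = emeasure lborel ((\<lambda>z. c * z) -` box l u)"
    by (subst emeasure_distr) auto
  also have "\<dots> = emeasure lborel (V -` ((\<lambda>z. c * z) -` box l u))"
    by (rule *[OF Sm, symmetric])
  \<comment> \<open>The rotated box is no longer a box; its measure is compared through
    \<open>measure_orthogonal_image\<close>, which speaks of Lebesgue measurable sets.\<close>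
  also have "\<dots> = emeasure lebesgue (V -` ((\<lambda>z. c * z) -` box l u))"
    using Sm2 by simp
  also have "\<dots> = emeasure lebesgue (f ` (V -` box l u))" by (simp only: eq)
  also have "\<dots> = ennreal (measure lebesgue (f ` (V -` box l u)))"
    by (rule emeasure_eq_measure2) (use measurable_linear_image[OF lin lm] in \<open>auto simp: fmeasurable_def\<close>)
  also have "\<dots> = ennreal (measure lebesgue (V -` box l u))"
    by (simp add: measure_orthogonal_image[OF orth lm])
  also have "\<dots> = emeasure lebesgue (V -` box l u)"
    by (rule emeasure_eq_measure2[symmetric]) (use lm in \<open>auto simp: fmeasurable_def\<close>)
  also have "\<dots> = emeasure lborel (V -` box l u)"
    by (simp add: bx)
  also have "\<dots> = emeasure lborel (box l u)" by (rule *) simp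
  also have "\<dots> = (\<Prod>b\<in>Basis. (u - l) \<bullet> b)" using le by (rule emeasure_lborel_box)
  finally show "emeasure (distr lborel borel (\<lambda>z. c * z)) (box l u) = (\<Prod>b\<in>Basis. (u - l) \<bullet> b)" .
qed auto

lemma distr_disc_area_mult:
  assumes c: "norm (c::complex) = 1"
  shows "distr disc_area disc_area (\<lambda>z. c * z) = disc_area"
proof (rule measure_eqI)
  fix A assume "A \<in> sets (distr disc_area disc_area (\<lambda>z. c * z))"
  then have A: "A \<in> sets disc_area" by simp
  have A': "A \<in> sets borel" "A \<subseteq> unit_disc"
    using A by (auto simp: sets_disc_area sets_restrict_space)
  have [measurable]: "(indicator A :: complex \<Rightarrow> ennreal) \<in> borel_measurable borel"
    using A' by (intro borel_measurable_indicator)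
  have m2: "(\<lambda>z. indicator A z * indicator unit_disc z :: ennreal) \<in> borel_measurable borel"
    using A' by (intro borel_measurable_times_ennreal borel_measurable_indicator) auto
  have m [measurable]: "(\<lambda>z. c * z) \<in> measurable disc_area disc_area"
    unfolding disc_area_def by (auto intro!: measurable_restrict_space3 simp: norm_mult c)
  have "emeasure (distr disc_area disc_area (\<lambda>z. c * z)) A = (\<integral>\<^sup>+z. indicator A (c * z) \<partial>disc_area)"
    using A by (simp add: nn_integral_distr[OF m, symmetric])
  also have "\<dots> = ennreal (1/pi) * (\<integral>\<^sup>+z. indicator A (c * z) * indicator unit_disc (c * z) \<partial>lborel)"
    by (subst nn_integral_disc_area) (auto simp: norm_mult c split: split_indicator intro!: nn_integral_cong arg_cong[where f="(*) (ennreal (1/pi))"])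
  also have "(\<integral>\<^sup>+z. indicator A (c * z) * indicator unit_disc (c * z) \<partial>lborel) =
     (\<integral>\<^sup>+z. indicator A z * indicator unit_disc z \<partial>distr lborel borel (\<lambda>z. c * z))"
    by (subst nn_integral_distr) (auto simp: m2)
  also have "\<dots> = (\<integral>\<^sup>+z. indicator A z * indicator unit_disc z \<partial>lborel)"
    by (simp only: distr_lborel_complex_mult[OF c])
  also have "ennreal (1/pi) * \<dots> = (\<integral>\<^sup>+z. indicator A z \<partial>disc_area)"
    by (subst nn_integral_disc_area) auto
  finally show "emeasure (distr disc_area disc_area (\<lambda>z. c * z)) A = emeasure disc_area A" using A by simp
qed simp

lemma integral_disc_area_mult:
  fixes f :: "complex \<Rightarrow> complex"
  assumes c: "norm (c::complex) = 1" and f: "f \<in> borel_measurable disc_area"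
  shows "(\<integral>z. f (c * z) \<partial>disc_area) = (\<integral>z. f z \<partial>disc_area)"
proof -
  have m: "(\<lambda>z. c * z) \<in> measurable disc_area disc_area"
    unfolding disc_area_def by (auto intro!: measurable_restrict_space3 simp: norm_mult c)
  have "(\<integral>z. f (c * z) \<partial>disc_area) = (\<integral>z. f z \<partial>distr disc_area disc_area (\<lambda>z. c * z))"
    by (rule integral_distr[OF m f, symmetric])
  then show ?thesis by (simp add: distr_disc_area_mult[OF c])
qed

text \<open>A rotation by \<open>c\<close> with \<open>c^m * cnj c^n = -1\<close> preserves the
  measure and changes the sign of the integrand, so the integral equals its own negative.\<close>

lemma integral_monomials_radial_eq_0:
  assumes "m \<noteq> n" and [measurable]: "h \<in> borel_measurable borel"
  shows "(\<integral>z. z^m * cnj z^n * of_real (h (norm z)) \<partial>disc_area) = 0"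
proof -
  have [measurable]: "cnj \<in> borel_measurable borel"
    by (intro borel_measurable_continuous_onI continuous_intros)
  \<comment> \<open>A real difference, so that one angle \<open>pi / d\<close> covers both
    \<open>m < n\<close> and \<open>n < m\<close>.\<close>
  define d where "d = real m - real n"
  have d: "d \<noteq> 0" using assms by (simp add: d_def)
  define c where "c = cis (pi / d)"
  have c: "norm c = 1" by (simp add: c_def)
  let ?f = "\<lambda>z. z^m * cnj z^n * complex_of_real (h (norm z))"
  have "c^m * cnj c^n = cis (real m * (pi/d) - real n * (pi/d))"
    by (simp add: c_def cis_cnj Complex.DeMoivre cis_mult)
  also have "real m * (pi/d) - real n * (pi/d) = d * (pi/d)"
    unfolding d_def by (rule left_diff_distrib[symmetric])
  also have "\<dots> = pi" using d by simp
  finally have c2: "c^m * cnj c^n = -1" by simp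
  have "?f (c * z) = - ?f z" for z
  proof -
    have "?f (c * z) = (c^m * cnj c^n) * ?f z"
      by (simp add: norm_mult c power_mult_distrib mult_ac)
    then show ?thesis by (simp add: c2)
  qed
  moreover have "(\<integral>z. ?f (c * z) \<partial>disc_area) = (\<integral>z. ?f z \<partial>disc_area)"
    by (rule integral_disc_area_mult[OF c], rule measurable_disc_areaI) measurable
  ultimately show ?thesis by simp
qed

subsection \<open>Moments of the exponential weight\<close>

abbreviation unit_lborel :: "real measure" where "unit_lborel \<equiv> restrict_space lborel {0<..<1}"

lemma unit_lborel_integrable_bounded:
  fixes f :: "real \<Rightarrow> real"
  assumes "f \<in> borel_measurable borel" "\<And>t. 0 < t \<Longrightarrow> t < 1 \<Longrightarrow> \<bar>f t\<bar> \<le> B"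
  shows "integrable unit_lborel f"
proof -
  interpret finite_measure unit_lborel
    by standard (simp add: emeasure_restrict_space space_restrict_space)
  show ?thesis
    by (rule integrable_const_bound[where B=B])
       (use assms in \<open>auto intro!: AE_I2 simp: space_restrict_space measurable_restrict_space1\<close>)
qed

text \<open>Endpoint values enter as limits, because the antiderivatives in use contain
  \<open>1 / (1 - t)\<close> and are differentiated only inside the interval.\<close>

lemma integral_unit_lborel_FTC:
  fixes f F :: "real \<Rightarrow> real"
  assumes D: "\<And>t. 0 < t \<Longrightarrow> t < 1 \<Longrightarrow> (F has_real_derivative f t) (at t)"
    and c: "\<And>t. 0 < t \<Longrightarrow> t < 1 \<Longrightarrow> isCont f t"
    and i: "integrable unit_lborel f"
    and l: "(F \<longlongrightarrow> a) (at_right 0)" "(F \<longlongrightarrow> b) (at_left 1)"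
  shows "(\<integral>t. f t \<partial>unit_lborel) = b - a"
proof -
  have s: "set_integrable lborel {0<..<1} f"
    using i unfolding set_integrable_def
    by (subst (asm) integrable_restrict_space) auto
  have "(LBINT x=0..1. f x) = b - a"
  proof (rule interval_integral_FTC_integrable[where F=F])
    show "((F \<circ> real_of_ereal) \<longlongrightarrow> a) (at_right 0)" "((F \<circ> real_of_ereal) \<longlongrightarrow> b) (at_left 1)"
      using l by (simp_all add: zero_ereal_def one_ereal_def ereal_tendsto_simps1)
    show "set_integrable lborel (einterval 0 1) f"
      using s by (simp add: zero_ereal_def one_ereal_def)
  qed (use D c in \<open>auto simp: has_real_derivative_iff_has_vector_derivative\<close>)
  also have "(LBINT x=0..1. f x) = (\<integral>t. f t \<partial>unit_lborel)"
    by (simp add: interval_lebesgue_integral_def zero_ereal_def one_ereal_def set_lebesgue_integral_def integral_restrict_space)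
  finally show ?thesis .
qed

locale exp_disc =
  fixes \<alpha> :: real assumes \<alpha>: "\<alpha> > 0"
begin

text \<open>For \<open>i = 2 * n + 1\<close> this is, up to a factor \<open>2\<close>, the radial
  density of \<open>norm z ^ (2 * n)\<close> against the weight; the extra power of \<open>t\<close>
  comes from polar coordinates.\<close>

definition ew :: "nat \<Rightarrow> real \<Rightarrow> real" where
  "ew i t = t ^ i * exp (- (\<alpha> / (1 - t)))"

lemma ew_measurable [measurable]: "ew i \<in> borel_measurable borel"
  unfolding ew_def by measurable

lemma ew_pos: "0 < t \<Longrightarrow> t < 1 \<Longrightarrow> 0 < ew i t"
  by (simp add: ew_def)

lemma ew_le_1: "0 < t \<Longrightarrow> t < 1 \<Longrightarrow> ew i t \<le> 1"
  using \<alpha> by (auto simp: ew_def intro!: mult_le_one power_le_one)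

lemma integrable_ew:
  assumes "f \<in> borel_measurable borel" "\<And>t. 0 < t \<Longrightarrow> t < 1 \<Longrightarrow> \<bar>f t\<bar> \<le> B"
  shows "integrable unit_lborel (\<lambda>t. ew i t * f t)"
proof (rule unit_lborel_integrable_bounded[where B=B])
  fix t :: real assume t: "0 < t" "t < 1"
  have "\<bar>ew i t * f t\<bar> \<le> 1 * \<bar>f t\<bar>"
    unfolding abs_mult using ew_le_1[OF t, of i] ew_pos[OF t, of i] by (intro mult_right_mono) auto
  then show "\<bar>ew i t * f t\<bar> \<le> B" using assms(2)[OF t] by simp
qed (use assms in measurable)

lemma integrable_ew_power: "integrable unit_lborel (\<lambda>t. ew i t * (1 - t) ^ j)"
  by (rule integrable_ew[where B=1]) (auto simp: power_le_one)

text \<open>The weight absorbs the pole at \<open>1\<close>, since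
  \<open>x * exp (- x) \<le> 1\<close> for \<open>x = \<alpha> / (1 - t)\<close>.\<close>

lemma integrable_ew_inverse: "integrable unit_lborel (\<lambda>t. ew i t * (1 / (1 - t)))"
proof (rule unit_lborel_integrable_bounded[where B="1/\<alpha>"])
  fix t :: real assume t: "0 < t" "t < 1"
  have "\<alpha> / (1 - t) \<le> exp (\<alpha> / (1 - t))" using exp_ge_add_one_self[of "\<alpha> / (1 - t)"] by linarith
  then have "\<alpha> / (1 - t) * exp (- (\<alpha> / (1 - t))) \<le> exp (\<alpha> / (1 - t)) * exp (- (\<alpha> / (1 - t)))"
    by (rule mult_right_mono) simp
  then have "\<alpha> / (1 - t) * exp (- (\<alpha> / (1 - t))) \<le> 1"
    by (simp add: exp_minus)
  then have "exp (- (\<alpha> / (1 - t))) * (1 / (1 - t)) \<le> 1 / \<alpha>" using \<alpha> t by (simp add: field_simps)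
  moreover have "t ^ i \<le> 1" using t by (simp add: power_le_one)
  ultimately have "t ^ i * (exp (- (\<alpha> / (1 - t))) * (1 / (1 - t))) \<le> 1 * (1/\<alpha>)"
    using t by (intro mult_mono) auto
  then show "\<bar>ew i t * (1 / (1 - t))\<bar> \<le> 1/\<alpha>" using t by (simp add: ew_def abs_mult)
qed measurable

lemma DERIV_exp_weight:
  "t \<noteq> 1 \<Longrightarrow> ((\<lambda>t. exp (- (\<alpha> / (1 - t)))) has_real_derivative - (\<alpha> / (1 - t)\<^sup>2) * exp (- (\<alpha> / (1 - t)))) (at t)"
  by (auto intro!: derivative_eq_intros simp: power2_eq_square)

text \<open>The quotient by \<open>(1 - t)\<^sup>2\<close> is left unreduced so that one formula
  covers \<open>j = 0\<close>, where it is \<open>1 / (1 - t)\<close>, and \<open>j > 0\<close>,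
  where it is a power.\<close>

lemma DERIV_ew:
  assumes "t \<noteq> 1"
  shows "((\<lambda>t. t ^ Suc i * (1 - t) ^ Suc j * exp (- (\<alpha> / (1 - t)))) has_real_derivative
    ((real i + 1) * (1 - t) ^ Suc j - (real j + 1) * t * (1 - t) ^ j - \<alpha> * t * ((1 - t) ^ Suc j / (1 - t)\<^sup>2)) * ew i t) (at t)"
  using assms unfolding ew_def
  by (auto intro!: derivative_eq_intros DERIV_exp_weight simp del: power_Suc) (simp add: algebra_simps; simp add: power2_eq_square algebra_simps)

section \<open>Recurrence and concentration for the moments of \<open>1 - t\<close>\<close>

definition mom :: "nat \<Rightarrow> nat \<Rightarrow> real" where
  "mom i j = (\<integral>t. ew i t * (1 - t) ^ j \<partial>unit_lborel)"

lemma tendsto_ew_at_left_1: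
  assumes "j > 0"
  shows "((\<lambda>t. t ^ i * (1 - t) ^ j * exp (- (\<alpha> / (1 - t)))) \<longlongrightarrow> 0) (at_left 1)"
proof (rule tendsto_0_le[where K=1])
  show "((\<lambda>t::real. (1 - t) ^ j) \<longlongrightarrow> 0) (at_left 1)"
    using assms by (auto intro!: tendsto_eq_intros)
  have "eventually (\<lambda>t::real. t \<in> {0<..<1}) (at_left 1)"
    using eventually_at_left_real[of 0 "1::real"] by simp
  then show "\<forall>\<^sub>F x in at_left 1. norm (x ^ i * (1 - x) ^ j * exp (- (\<alpha> / (1 - x)))) \<le> norm ((1 - x) ^ j) * 1"
  proof eventually_elim
    case (elim x)
    have "x ^ i * ((1 - x) ^ j * exp (- (\<alpha> / (1 - x)))) \<le> 1 * ((1 - x) ^ j * 1)"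
      using elim \<alpha> by (intro mult_mono) (auto simp: power_le_one)
    then show ?case using elim by (simp add: abs_mult mult.assoc)
  qed
qed

lemma tendsto_ew_at_right_0:
  "((\<lambda>t. t ^ Suc i * (1 - t) ^ j * exp (- (\<alpha> / (1 - t)))) \<longlongrightarrow> 0) (at_right 0)"
  by (auto intro!: tendsto_eq_intros)

text \<open>The derivative of \<open>t ^ (i + 1) * (1 - t) ^ (j + 2) * exp (- (\<alpha> / (1 -
  t)))\<close> integrates to zero, as the function tends to zero at both ends; writing
  \<open>t = 1 - (1 - t)\<close> leaves only moments of \<open>1 - t\<close>.\<close>

lemma mom_recurrence:
  "(real i + real j + 3) * mom i (j + 2) + (\<alpha> - real j - 2) * mom i (j + 1) - \<alpha> * mom i j = 0"
proof -
  let ?f = "\<lambda>t. (real i + real j + 3) * (ew i t * (1 - t) ^ (j + 2)) + (\<alpha> - real j - 2) * (ew i t * (1 - t) ^ (j + 1)) - \<alpha> * (ew i t * (1 - t) ^ j)"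
  have "(\<integral>t. ?f t \<partial>unit_lborel) = 0 - 0"
  proof (rule integral_unit_lborel_FTC)
    show "integrable unit_lborel ?f"
      by (intro Bochner_Integration.integrable_add Bochner_Integration.integrable_diff integrable_mult_right integrable_ew_power)
    show "((\<lambda>t. t ^ Suc i * (1 - t) ^ (j + 2) * exp (- (\<alpha> / (1 - t)))) has_real_derivative ?f t) (at t)"
      if "0 < t" "t < 1" for t
    proof -
      define T where "T = 1 - t"
      have T: "t = 1 - T" "T \<noteq> 0" using that by (auto simp: T_def)
      have "((real i + 1) * T ^ Suc (Suc j) - (real (Suc j) + 1) * (1 - T) * T ^ Suc j - \<alpha> * (1 - T) * (T ^ Suc (Suc j) / T\<^sup>2)) * ew i t
        = (real i + real j + 3) * (ew i t * T ^ (j + 2)) + (\<alpha> - real j - 2) * (ew i t * T ^ (j + 1)) - \<alpha> * (ew i t * T ^ j)"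
      proof -
        have "T ^ Suc (Suc j) / T\<^sup>2 = T ^ j" using T(2) by (simp add: power2_eq_square)
        then show ?thesis by (simp only:) (simp add: algebra_simps)
      qed
      with DERIV_ew[of t i "Suc j"] show ?thesis using that T by (simp add: numeral_2_eq_2 del: power_Suc)
    qed
  qed (auto simp: ew_def intro!: tendsto_ew_at_left_1 tendsto_ew_at_right_0 continuous_intros simp del: power_Suc)
  also have "(\<integral>t. ?f t \<partial>unit_lborel) = (real i + real j + 3) * mom i (j + 2) + (\<alpha> - real j - 2) * mom i (j + 1) - \<alpha> * mom i j"
    unfolding mom_def
    using integrable_ew_power[of i "j + 2"] integrable_ew_power[of i "j + 1"] integrable_ew_power[of i j] by simp
  finally show ?thesis by simp
qed

text \<open>The recurrence continued to \<open>j = -1\<close>: one factor \<open>1 - t\<close> less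
  in the test function brings in the inverse moment.\<close>

lemma mom_inverse:
  "(real i + 2) * mom i 1 + (\<alpha> - 1) * mom i 0 - \<alpha> * (\<integral>t. ew i t * (1 / (1 - t)) \<partial>unit_lborel) = 0"
proof -
  let ?f = "\<lambda>t. (real i + 2) * (ew i t * (1 - t) ^ 1) + (\<alpha> - 1) * (ew i t * (1 - t) ^ 0) - \<alpha> * (ew i t * (1 / (1 - t)))"
  have "(\<integral>t. ?f t \<partial>unit_lborel) = 0 - 0"
  proof (rule integral_unit_lborel_FTC)
    show "integrable unit_lborel ?f"
      by (intro Bochner_Integration.integrable_add Bochner_Integration.integrable_diff integrable_mult_right integrable_ew_power integrable_ew_inverse)
    show "((\<lambda>t. t ^ Suc i * (1 - t) ^ 1 * exp (- (\<alpha> / (1 - t)))) has_real_derivative ?f t) (at t)"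
      if "0 < t" "t < 1" for t
    proof -
      define T where "T = 1 - t"
      have T: "t = 1 - T" "T \<noteq> 0" using that by (auto simp: T_def)
      have "((real i + 1) * T ^ Suc 0 - (real 0 + 1) * (1 - T) * T ^ 0 - \<alpha> * (1 - T) * (T ^ Suc 0 / T\<^sup>2)) * ew i t
        = (real i + 2) * (ew i t * T ^ 1) + (\<alpha> - 1) * (ew i t * T ^ 0) - \<alpha> * (ew i t * (1 / T))"
        using T(2) by (simp add: power2_eq_square field_simps)
      with DERIV_ew[of t i 0] show ?thesis using that T by (simp del: power_Suc)
    qed
  qed (auto simp: ew_def intro!: tendsto_ew_at_left_1[of 1, unfolded power_one_right] tendsto_ew_at_right_0[of _ 1, unfolded power_one_right] continuous_intros simp del: power_Suc)
  also have "(\<integral>t. ?f t \<partial>unit_lborel) = (real i + 2) * mom i 1 + (\<alpha> - 1) * mom i 0 - \<alpha> * (\<integral>t. ew i t * (1 / (1 - t)) \<partial>unit_lborel)"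
    unfolding mom_def
  proof -
    have *: "(\<integral>t. (real i + 2) * f t + (\<alpha> - 1) * g t - \<alpha> * h t \<partial>unit_lborel) = (real i + 2) * (\<integral>t. f t \<partial>unit_lborel) + (\<alpha> - 1) * (\<integral>t. g t \<partial>unit_lborel) - \<alpha> * (\<integral>t. h t \<partial>unit_lborel)"
      if "integrable unit_lborel f" "integrable unit_lborel g" "integrable unit_lborel h" for f g h :: "real \<Rightarrow> real"
      using that by simp
    show "(\<integral>t. ?f t \<partial>unit_lborel) = (real i + 2) * (\<integral>t. ew i t * (1 - t) ^ 1 \<partial>unit_lborel) + (\<alpha> - 1) * (\<integral>t. ew i t * (1 - t) ^ 0 \<partial>unit_lborel) - \<alpha> * (\<integral>t. ew i t * (1 / (1 - t)) \<partial>unit_lborel)"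
      by (rule *) (rule integrable_ew_power integrable_ew_inverse)+
  qed
  finally show ?thesis by simp
qed

lemma integral_ew_nonneg:
  assumes "\<And>t. 0 < t \<Longrightarrow> t < 1 \<Longrightarrow> f t \<ge> 0"
  shows "(\<integral>t. ew i t * f t \<partial>unit_lborel) \<ge> 0"
  by (rule integral_nonneg_AE) (auto intro!: AE_I2 simp: space_restrict_space assms ew_pos less_imp_le)

lemma integral_ew_mono:
  assumes "\<And>t. 0 < t \<Longrightarrow> t < 1 \<Longrightarrow> f t \<le> g t"
    "integrable unit_lborel (\<lambda>t. ew i t * f t)" "integrable unit_lborel (\<lambda>t. ew i t * g t)"
  shows "(\<integral>t. ew i t * f t \<partial>unit_lborel) \<le> (\<integral>t. ew i t * g t \<partial>unit_lborel)"
  by (rule integral_mono) (auto intro!: mult_left_mono simp: space_restrict_space assms ew_pos less_imp_le)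

lemma integral_ew_pos:
  assumes "\<And>t. 0 < t \<Longrightarrow> t < 1 \<Longrightarrow> f t > 0" and i: "integrable unit_lborel (\<lambda>t. ew i t * f t)"
  shows "(\<integral>t. ew i t * f t \<partial>unit_lborel) > 0"
proof -
  have ge: "(\<integral>t. ew i t * f t \<partial>unit_lborel) \<ge> 0"
    by (rule integral_ew_nonneg) (use assms in \<open>auto intro: less_imp_le\<close>)
  moreover have "(\<integral>t. ew i t * f t \<partial>unit_lborel) \<noteq> 0"
  proof
    assume "(\<integral>t. ew i t * f t \<partial>unit_lborel) = 0"
    then have "AE t in unit_lborel. ew i t * f t = 0"
      by (subst (asm) integral_nonneg_eq_0_iff_AE[OF i])
         (auto intro!: AE_I2 mult_nonneg_nonneg less_imp_le simp: space_restrict_space assms ew_pos)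
    moreover have "AE t in unit_lborel. ew i t * f t \<noteq> 0"
    proof (rule AE_I2)
      fix t assume "t \<in> space unit_lborel"
      then have "0 < t" "t < 1" by (auto simp: space_restrict_space)
      then show "ew i t * f t \<noteq> 0" using ew_pos[of t i] assms(1)[of t] by simp
    qed
    ultimately have "AE t in unit_lborel. False" by eventually_elim auto
    then have "emeasure unit_lborel (space unit_lborel) = 0"
      by (simp add: eventually_False ae_filter_eq_bot_iff)
    then show False by (simp add: space_restrict_space emeasure_restrict_space)
  qed
  ultimately show ?thesis by simp
qed

lemma mom_pos: "mom i j > 0"
  unfolding mom_def by (rule integral_ew_pos) (auto simp: integrable_ew_power)

lemma mom_antimono: "mom i (Suc j) \<le> mom i j"
  unfolding mom_def by (rule integral_ew_mono) (auto simp: integrable_ew_power simp del: power_Suc intro!: power_decreasing)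

text \<open>The recurrence at \<open>j = 0\<close>, with \<open>mom i 1 \<le> mom i 0\<close> for
  the middle term. Under the normalized density \<open>1 - t\<close> thus has size at most of order
  \<open>i\<close> to the power \<open>-1/2\<close>.\<close>

lemma mom_2_le: "(real i + 3) * mom i 2 \<le> (\<alpha> + 2) * mom i 0"
proof -
  have "(real i + 3) * mom i 2 + (\<alpha> - 2) * mom i 1 - \<alpha> * mom i 0 = 0"
    using mom_recurrence[of i 0] by (simp add: numeral_2_eq_2)
  moreover have "(2 - \<alpha>) * mom i 1 \<le> 2 * mom i 0"
  proof -
    have "0 < \<alpha> * mom i 1" using \<alpha> mom_pos[of i 1] by simp
    moreover have "(2 - \<alpha>) * mom i 1 = 2 * mom i 1 - \<alpha> * mom i 1" by (simp add: algebra_simps)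
    moreover have "mom i 1 \<le> mom i 0" using mom_antimono[of i 0] by simp
    ultimately show ?thesis using mom_pos[of i 1] by linarith
  qed
  ultimately show ?thesis by (simp add: algebra_simps)
qed

definition mom_center :: "nat \<Rightarrow> real" where "mom_center i = sqrt (\<alpha> / (real i + 3))"

text \<open>Integrating \<open>2 * \<theta> * x \<le> x\<^sup>2 + \<theta>\<^sup>2\<close> with
  \<open>x = 1 - t\<close> reduces the first moment to the second.\<close>

lemma mom_1_le: "mom_center i * mom i 1 \<le> (\<alpha> + 1) * mom i 0 / (real i + 3)"
proof -
  let ?\<theta> = "mom_center i"
  have "0 \<le> (\<integral>t. ew i t * ((1 - t) - ?\<theta>)\<^sup>2 \<partial>unit_lborel)"
    by (rule integral_ew_nonneg) auto
  also have "\<dots> = (\<integral>t. ew i t * (1 - t) ^ 2 - 2 * ?\<theta> * (ew i t * (1 - t) ^ 1) + ?\<theta>\<^sup>2 * (ew i t * (1 - t) ^ 0) \<partial>unit_lborel)"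
    by (rule Bochner_Integration.integral_cong) (simp_all add: power2_eq_square algebra_simps)
  also have "\<dots> = mom i 2 - 2 * ?\<theta> * mom i 1 + ?\<theta>\<^sup>2 * mom i 0"
    unfolding mom_def using integrable_ew_power[of i 2] integrable_ew_power[of i 1] integrable_ew_power[of i 0] by simp
  finally have "2 * ?\<theta> * mom i 1 \<le> mom i 2 + \<alpha> / (real i + 3) * mom i 0"
    using \<alpha> by (simp add: mom_center_def)
  also have "\<dots> \<le> (\<alpha> + 2) * mom i 0 / (real i + 3) + \<alpha> / (real i + 3) * mom i 0"
    using mom_2_le[of i] by (intro add_right_mono) (simp add: pos_le_divide_eq mult.commute)
  also have "\<dots> = 2 * ((\<alpha> + 1) * mom i 0 / (real i + 3))"
    by (simp only: add_divide_distrib[symmetric] times_divide_eq_left times_divide_eq_right) (simp add: algebra_simps)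
  finally show ?thesis by simp
qed

text \<open>
  Integration by parts with the test function \<open>(1 - t) - \<theta>\<close>. The centre \<open>\<theta>\<close> has \<open>\<theta>\<^sup>2 = \<alpha> / (i + 3)\<close>
  because, up to lower order, \<open>t\<^sup>i exp (- \<alpha> / (1 - t))\<close> has its maximum at \<open>1 - \<theta>\<close>.
\<close>

lemma mom_variance:
  "(\<integral>t. ew i t * ((1 - t) - mom_center i)\<^sup>2 \<partial>unit_lborel) * ((real i + 3) * mom_center i) \<le>
   (3 * (\<alpha> + 2) + \<bar>\<alpha> - 2\<bar> * (\<alpha> + 1)) * mom i 0 / (real i + 3)"
proof -
  let ?\<theta> = "mom_center i" let ?M = "real i + 3"
  have \<theta>: "?\<theta> > 0" "?M * ?\<theta>\<^sup>2 = \<alpha>" using \<alpha> by (auto simp: mom_center_def)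
  have I: "integrable unit_lborel (\<lambda>t. ew i t * (?M * ((1 - t) - ?\<theta>)\<^sup>2 * ((1 - t) + ?\<theta>)))"
  proof (rule integrable_ew[where B="?M * (1 + ?\<theta>)^2 * (1 + ?\<theta>)"])
    fix t :: real assume "0 < t" "t < 1"
    then have "\<bar>(1 - t) - ?\<theta>\<bar>^2 \<le> (1 + ?\<theta>)^2" using \<theta> by (intro power_mono) auto
    then show "\<bar>?M * ((1 - t) - ?\<theta>)\<^sup>2 * ((1 - t) + ?\<theta>)\<bar> \<le> ?M * (1 + ?\<theta>)^2 * (1 + ?\<theta>)"
      unfolding abs_mult using \<theta> \<open>0 < t\<close> \<open>t < 1\<close> by (intro mult_mono) auto
  qed measurable
  have I2: "integrable unit_lborel (\<lambda>t. ew i t * ((1 - t) - ?\<theta>)\<^sup>2)"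
  proof (rule integrable_ew[where B="(1 + ?\<theta>)^2"])
    fix t :: real assume "0 < t" "t < 1"
    then have "\<bar>(1 - t) - ?\<theta>\<bar>^2 \<le> (1 + ?\<theta>)^2" using \<theta> by (intro power_mono) auto
    then show "\<bar>((1 - t) - ?\<theta>)\<^sup>2\<bar> \<le> (1 + ?\<theta>)^2" by simp
  qed measurable
  have "(\<integral>t. ew i t * ((1 - t) - ?\<theta>)\<^sup>2 \<partial>unit_lborel) * (?M * ?\<theta>) = (\<integral>t. ew i t * (((1 - t) - ?\<theta>)\<^sup>2 * (?M * ?\<theta>)) \<partial>unit_lborel)"
    by (simp only: mult.assoc[symmetric] integral_mult_left_zero)
  \<comment> \<open>With \<open>x = 1 - t\<close> and
    \<open>?M * \<theta>\<^sup>2 = \<alpha>\<close> the new integrand is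
    \<open>(x - \<theta>) * (?M * x\<^sup>2 - \<alpha>)\<close>: the test function times the leading
    part of the recurrence.\<close>
  also have "\<dots> \<le> (\<integral>t. ew i t * (?M * ((1 - t) - ?\<theta>)\<^sup>2 * ((1 - t) + ?\<theta>)) \<partial>unit_lborel)"
  proof (rule integral_ew_mono)
    fix t :: real assume "0 < t" "t < 1"
    have "((1 - t) - ?\<theta>)\<^sup>2 * (?M * ?\<theta>) = ?M * ((1 - t) - ?\<theta>)\<^sup>2 * ?\<theta>" by (simp only: mult_ac)
    also have "\<dots> \<le> ?M * ((1 - t) - ?\<theta>)\<^sup>2 * ((1 - t) + ?\<theta>)"
      using \<open>t < 1\<close> by (intro mult_left_mono) auto
    finally show "((1 - t) - ?\<theta>)\<^sup>2 * (?M * ?\<theta>) \<le> ?M * ((1 - t) - ?\<theta>)\<^sup>2 * ((1 - t) + ?\<theta>)" .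
  next
    show "integrable unit_lborel (\<lambda>t. ew i t * (((1 - t) - ?\<theta>)\<^sup>2 * (?M * ?\<theta>)))"
      using integrable_mult_left[OF I2, of "?M * ?\<theta>"] by (simp only: mult.assoc)
  qed (rule I)
  also have "\<dots> = (\<integral>t. ?M * (ew i t * (1 - t) ^ 3) - ?M * ?\<theta> * (ew i t * (1 - t) ^ 2) - \<alpha> * (ew i t * (1 - t) ^ 1) + \<alpha> * ?\<theta> * (ew i t * (1 - t) ^ 0) \<partial>unit_lborel)"
  proof (rule Bochner_Integration.integral_cong[OF refl])
    fix t
    have *: "w * (M * (T - \<theta>)\<^sup>2 * (T + \<theta>)) = M * (w * T ^ 3) - M * \<theta> * (w * T ^ 2) - b * (w * T ^ 1) + b * \<theta> * (w * T ^ 0)"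
      if "M * \<theta>\<^sup>2 = b" for w T M \<theta> b :: real
      unfolding that[symmetric] by (simp add: power2_eq_square power3_eq_cube algebra_simps)
    show "ew i t * (?M * ((1 - t) - ?\<theta>)\<^sup>2 * ((1 - t) + ?\<theta>)) = ?M * (ew i t * (1 - t) ^ 3) - ?M * ?\<theta> * (ew i t * (1 - t) ^ 2) - \<alpha> * (ew i t * (1 - t) ^ 1) + \<alpha> * ?\<theta> * (ew i t * (1 - t) ^ 0)"
      by (rule *[OF \<theta>(2)])
  qed
  also have "\<dots> = ?M * mom i 3 - ?M * ?\<theta> * mom i 2 - \<alpha> * mom i 1 + \<alpha> * ?\<theta> * mom i 0"
    unfolding mom_def using integrable_ew_power[of i 3] integrable_ew_power[of i 2] integrable_ew_power[of i 1] integrable_ew_power[of i 0] by simp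
  \<comment> \<open>Subtracting the recurrence at \<open>j = 1\<close> and adding
    \<open>\<theta>\<close> times the one at \<open>j = 0\<close> cancels the leading terms; what
    remains is bounded by a multiple of \<open>mom i 0 / ?M\<close>.\<close>
  also have "\<dots> = - mom i 3 - (\<alpha> - 3) * mom i 2 + (\<alpha> - 2) * (?\<theta> * mom i 1)"
  proof -
    have r0: "?M * mom i 2 + (\<alpha> - 2) * mom i 1 - \<alpha> * mom i 0 = 0"
      using mom_recurrence[of i 0] by (simp add: numeral_2_eq_2)
    have r1: "(?M + 1) * mom i 3 + (\<alpha> - 3) * mom i 2 - \<alpha> * mom i 1 = 0"
      using mom_recurrence[of i 1] by (simp add: numeral_2_eq_2 numeral_3_eq_3 algebra_simps)
    have "?M * mom i 3 - ?M * ?\<theta> * mom i 2 - \<alpha> * mom i 1 + \<alpha> * ?\<theta> * mom i 0 -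
      (- mom i 3 - (\<alpha> - 3) * mom i 2 + (\<alpha> - 2) * (?\<theta> * mom i 1)) =
      ((?M + 1) * mom i 3 + (\<alpha> - 3) * mom i 2 - \<alpha> * mom i 1) - ?\<theta> * (?M * mom i 2 + (\<alpha> - 2) * mom i 1 - \<alpha> * mom i 0)"
      by (simp add: algebra_simps)
    then show ?thesis using r0 r1 by simp
  qed
  also have "\<dots> \<le> 3 * mom i 2 + \<bar>\<alpha> - 2\<bar> * (?\<theta> * mom i 1)"
  proof -
    have "(\<alpha> - 2) * (?\<theta> * mom i 1) \<le> \<bar>\<alpha> - 2\<bar> * (?\<theta> * mom i 1)"
      using \<theta>(1) mom_pos[of i 1] by (intro mult_right_mono) auto
    moreover have "0 < \<alpha> * mom i 2" using \<alpha> mom_pos[of i 2] by simp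
    moreover have "(\<alpha> - 3) * mom i 2 = \<alpha> * mom i 2 - 3 * mom i 2" by (rule left_diff_distrib)
    ultimately show ?thesis using mom_pos[of i 3] by linarith
  qed
  also have "\<dots> \<le> 3 * ((\<alpha> + 2) * mom i 0 / ?M) + \<bar>\<alpha> - 2\<bar> * ((\<alpha> + 1) * mom i 0 / ?M)"
    using mom_2_le[of i] mom_1_le[of i] by (intro add_mono mult_left_mono) (auto simp: field_simps)
  also have "\<dots> = (3 * (\<alpha> + 2) + \<bar>\<alpha> - 2\<bar> * (\<alpha> + 1)) * mom i 0 / ?M"
    by (simp only: times_divide_eq_right add_divide_distrib[symmetric] distrib_right mult.assoc)
  finally show ?thesis .
qed

text \<open>The test function is now \<open>1 / (1 - t)\<close>, and \<open>E(1/X) \<ge> 1 / E(X)\<close>.\<close>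

lemma mom_1_ge: "mom i 1 / mom i 0 \<ge> min (1/2) (sqrt (\<alpha> / (2 * (real i + 3))))"
proof -
  define e where "e = mom i 1 / mom i 0"
  have e: "e > 0" using mom_pos by (simp add: e_def)
  have m1: "mom i 1 = e * mom i 0" using mom_pos[of i 0] by (simp add: e_def)
  \<comment> \<open>\<open>2 / e - x / e^2\<close> is the tangent to \<open>1 / x\<close> at the
    mean \<open>e\<close>. It lies below \<open>1 / x\<close> by convexity, and its integral is
    exactly \<open>1 / e * mom i 0\<close>.\<close>
  have "1 / e * mom i 0 = 2 / e * mom i 0 - 1 / e^2 * mom i 1"
    unfolding m1 using e by (simp add: field_simps power2_eq_square)
  also have "\<dots> = (\<integral>t. 2 / e * (ew i t * (1 - t) ^ 0) - 1 / e^2 * (ew i t * (1 - t) ^ 1) \<partial>unit_lborel)"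
    unfolding mom_def using integrable_ew_power[of i 1] integrable_ew_power[of i 0] by simp
  also have "\<dots> = (\<integral>t. ew i t * (2 / e - 1 / e^2 * (1 - t)) \<partial>unit_lborel)"
    by (rule Bochner_Integration.integral_cong) (simp_all add: right_diff_distrib mult_ac)
  also have "\<dots> \<le> (\<integral>t. ew i t * (1 / (1 - t)) \<partial>unit_lborel)"
  proof (rule integral_ew_mono)
    fix t :: real assume t: "0 < t" "t < 1"
    have "0 \<le> (1 - (1 - t) / e)\<^sup>2" by simp
    also have "\<dots> = 1 - (2 / e - 1 / e^2 * (1 - t)) * (1 - t)" by (simp add: power2_eq_square algebra_simps)
    finally have "(2 / e - 1 / e^2 * (1 - t)) * (1 - t) \<le> 1" by simp
    then show "2 / e - 1 / e^2 * (1 - t) \<le> 1 / (1 - t)" using t by (simp add: pos_le_divide_eq)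
  next
    show "integrable unit_lborel (\<lambda>t. ew i t * (2 / e - 1 / e^2 * (1 - t)))"
    proof (rule integrable_ew[where B="2/e + 1/e^2"])
      fix t :: real assume t: "0 < t" "t < 1"
      have "1 / e^2 * (1 - t) \<le> 1 / e^2 * 1" using t e by (intro mult_left_mono) auto
      moreover have "0 \<le> 1 / e^2 * (1 - t)" "0 \<le> 2 / e" using t e by auto
      ultimately show "\<bar>2 / e - 1 / e^2 * (1 - t)\<bar> \<le> 2/e + 1/e^2" by linarith
    qed measurable
  qed (rule integrable_ew_inverse)
  finally have "\<alpha> * (1 / e * mom i 0) \<le> \<alpha> * (\<integral>t. ew i t * (1 / (1 - t)) \<partial>unit_lborel)"
    using \<alpha> by (intro mult_left_mono) auto
  also have "\<dots> = (real i + 2) * mom i 1 + (\<alpha> - 1) * mom i 0" using mom_inverse[of i] by simp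
  also have "\<dots> \<le> (real i + 3) * mom i 1 + \<alpha> * mom i 0" using mom_pos[of i 1] mom_pos[of i 0] by (simp add: algebra_simps)
  also have "\<dots> = ((real i + 3) * e + \<alpha>) * mom i 0" unfolding m1 by (simp add: algebra_simps)
  finally have "\<alpha> / e * mom i 0 \<le> ((real i + 3) * e + \<alpha>) * mom i 0" by simp
  then have "\<alpha> / e \<le> (real i + 3) * e + \<alpha>" by (rule mult_right_le_imp_le) (rule mom_pos)
  \<comment> \<open>If \<open>e < 1/2\<close>, half of \<open>\<alpha>\<close> absorbs the term
    \<open>\<alpha> * e\<close>; hence the minimum with \<open>1/2\<close> in the statement.\<close>
  then have *: "\<alpha> \<le> (real i + 3) * e^2 + \<alpha> * e" using e by (simp add: field_simps power2_eq_square)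
  show ?thesis
  proof (cases "e \<ge> 1/2")
    case False
    then have "\<alpha> * e \<le> \<alpha> * (1/2)" using \<alpha> by (intro mult_left_mono) auto
    with * have "\<alpha> / 2 \<le> (real i + 3) * e^2" by simp
    then have "\<alpha> / (2 * (real i + 3)) \<le> e^2" by (simp add: field_simps)
    then have "sqrt (\<alpha> / (2 * (real i + 3))) \<le> e" using e by (intro real_le_lsqrt) auto
    then show ?thesis by (simp add: e_def)
  next
    case True
    then show ?thesis unfolding e_def by (rule min.coboundedI1)
  qed
qed

section \<open>Moments of the weight on the disc\<close>

definition omega :: "nat \<Rightarrow> real" where
  "omega n = (\<integral>z. norm z ^ (2 * n) * exp_weight \<alpha> z \<partial>disc_area)"

text \<open>Keeping the density \<open>ew (2 * n + 1)\<close> fixed while \<open>k\<close> varies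
  makes \<open>omega (n + k) / omega n\<close> the \<open>k\<close>-th moment of
  \<open>t\<^sup>2\<close> under one probability measure.\<close>

lemma omega_eq: "omega (n + k) = 2 * (\<integral>t. ew (2 * n + 1) t * (t^2)^k \<partial>unit_lborel)"
proof -
  have "omega (n + k) = (\<integral>z. (\<lambda>t. t ^ (2 * (n + k)) * exp (- (\<alpha> / (1 - t)))) (norm z) \<partial>disc_area)"
    by (simp add: omega_def exp_weight_def)
  also have "\<dots> = (LBINT t:{0<..<1}. 2 * t * (t ^ (2 * (n + k)) * exp (- (\<alpha> / (1 - t)))))"
    by (rule integral_norm_disc_area) auto
  also have "\<dots> = (\<integral>t. 2 * t * (t ^ (2 * (n + k)) * exp (- (\<alpha> / (1 - t)))) \<partial>unit_lborel)"
    by (simp add: set_lebesgue_integral_def integral_restrict_space)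
  also have "\<dots> = (\<integral>t. 2 * (ew (2 * n + 1) t * (t^2)^k) \<partial>unit_lborel)"
    by (rule Bochner_Integration.integral_cong)
       (simp_all add: ew_def power_mult[symmetric] power_add[symmetric] algebra_simps)
  finally show ?thesis by simp
qed

lemma integrable_ew_square_power: "integrable unit_lborel (\<lambda>t. ew i t * (t^2)^k)"
  by (rule integrable_ew[where B=1]) (auto simp: power_le_one)

lemma omega_pos: "omega n > 0"
  using omega_eq[of n 0] mom_pos[of "2 * n + 1" 0] by (simp add: mom_def)

lemma omega_0_mom: "omega n = 2 * mom (2 * n + 1) 0"
  using omega_eq[of n 0] by (simp add: mom_def)

lemma omega_diff_ge: "omega n - omega (n + 1) \<ge> 2 * mom (2 * n + 1) 1"
proof -
  have "mom (2 * n + 1) 1 \<le> (\<integral>t. ew (2 * n + 1) t * (1 - t^2) \<partial>unit_lborel)"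
    unfolding mom_def
  proof (rule integral_ew_mono)
    fix t :: real assume t: "0 < t" "t < 1"
    have "t * t \<le> t * 1" using t by (intro mult_left_mono) auto
    then show "(1 - t) ^ 1 \<le> 1 - t^2" by (simp add: power2_eq_square)
  next
    show "integrable unit_lborel (\<lambda>t. ew (2 * n + 1) t * (1 - t\<^sup>2))"
      by (rule integrable_ew[where B=1]) (auto simp: power_le_one)
  qed (rule integrable_ew_power)
  also have "\<dots> = (\<integral>t. ew (2 * n + 1) t * (t^2)^0 - ew (2 * n + 1) t * (t^2)^1 \<partial>unit_lborel)"
    by (rule Bochner_Integration.integral_cong) (simp_all add: algebra_simps)
  also have "\<dots> = (\<integral>t. ew (2 * n + 1) t * (t^2)^0 \<partial>unit_lborel) - (\<integral>t. ew (2 * n + 1) t * (t^2)^1 \<partial>unit_lborel)"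
    by (rule Bochner_Integration.integral_diff) (rule integrable_ew_square_power)+
  finally show ?thesis using omega_eq[of n 0] omega_eq[of n 1] by simp
qed

lemma omega_antimono: "omega (Suc n) < omega n"
  using omega_diff_ge[of n] mom_pos[of "2 * n + 1" 1] by simp

text \<open>The centre \<open>c\<close> is free: the mean of \<open>t\<^sup>2\<close> gives
  log-convexity, a centre tied to \<open>mom_center\<close> gives an upper bound for the
  variance.\<close>

lemma omega_square: "omega (n + 2) - 2 * c * omega (n + 1) + c\<^sup>2 * omega n = 2 * (\<integral>t. ew (2 * n + 1) t * (t^2 - c)\<^sup>2 \<partial>unit_lborel)"
proof -
  have "(\<integral>t. ew (2 * n + 1) t * (t^2 - c)\<^sup>2 \<partial>unit_lborel) = (\<integral>t. ew (2 * n + 1) t * (t^2)^2 - 2 * c * (ew (2 * n + 1) t * (t^2)^1) + c\<^sup>2 * (ew (2 * n + 1) t * (t^2)^0) \<partial>unit_lborel)"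
    by (rule Bochner_Integration.integral_cong) (simp_all add: power2_eq_square algebra_simps)
  also have "\<dots> = (\<integral>t. ew (2 * n + 1) t * (t^2)^2 \<partial>unit_lborel) - 2 * c * (\<integral>t. ew (2 * n + 1) t * (t^2)^1 \<partial>unit_lborel) + c\<^sup>2 * (\<integral>t. ew (2 * n + 1) t * (t^2)^0 \<partial>unit_lborel)"
    using integrable_ew_square_power[of "2 * n + 1" 2] integrable_ew_square_power[of "2 * n + 1" 1] integrable_ew_square_power[of "2 * n + 1" 0]
    by simp
  finally show ?thesis using omega_eq[of n 2] omega_eq[of n 1] omega_eq[of n 0] by simp
qed

text \<open>Cauchy-Schwarz for moments, as nonnegativity of a quadratic at its minimizer. It makes
  the ratios of consecutive moments monotone.\<close>

lemma omega_log_convex: "omega (n + 1) ^ 2 \<le> omega (n + 2) * omega n"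
proof -
  define c where "c = omega (n + 1) / omega n"
  have "0 \<le> 2 * (\<integral>t. ew (2 * n + 1) t * (t^2 - c)\<^sup>2 \<partial>unit_lborel)"
    using integral_ew_nonneg[of "\<lambda>t. (t^2 - c)\<^sup>2"] by simp
  then have "0 \<le> (omega (n + 2) - 2 * c * omega (n + 1) + c\<^sup>2 * omega n) * omega n"
    unfolding omega_square[symmetric] using omega_pos[of n] by simp
  also have "\<dots> = omega (n + 2) * omega n - omega (n + 1) ^ 2"
    using omega_pos[of n] by (simp add: c_def field_simps power2_eq_square)
  finally show ?thesis by simp
qed

lemma omega_ratio_gap: "\<exists>c>0. \<forall>n. c / sqrt (real n + 1) \<le> 1 - omega (n + 1) / omega n"
proof (intro exI conjI allI)
  \<comment> \<open>For \<open>?i = 2 * n + 1\<close> one has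
    \<open>2 * (?i + 3) = 4 * n + 8 \<le> 8 * (n + 1)\<close>, whence the \<open>8\<close>.\<close>
  let ?c = "min (1/2) (sqrt (\<alpha> / 8))"
  show "?c > 0" using \<alpha> by simp
  fix n :: nat
  let ?i = "2 * n + 1"
  have "?c / sqrt (real n + 1) \<le> min (1/2) (sqrt (\<alpha> / (2 * (real ?i + 3))))"
  proof -
    have "?c / sqrt (real n + 1) \<le> ?c / 1" using \<alpha> by (intro divide_left_mono) auto
    moreover have "?c / sqrt (real n + 1) \<le> sqrt (\<alpha> / 8) / sqrt (real n + 1)"
      by (intro divide_right_mono) auto
    moreover have "sqrt (\<alpha> / 8) / sqrt (real n + 1) = sqrt (\<alpha> / (8 * (real n + 1)))"
      by (simp add: real_sqrt_divide[symmetric] divide_divide_eq_left)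
    moreover have "sqrt (\<alpha> / (8 * (real n + 1))) \<le> sqrt (\<alpha> / (2 * (real ?i + 3)))"
      using \<alpha> by (intro real_sqrt_le_mono divide_left_mono) auto
    ultimately show ?thesis by (simp only: min_le_iff_disj min.bounded_iff) linarith
  qed
  also have "\<dots> \<le> mom ?i 1 / mom ?i 0" by (rule mom_1_ge)
  also have "\<dots> \<le> (omega n - omega (n + 1)) / omega n"
    using omega_diff_ge[of n] omega_0_mom[of n] mom_pos[of ?i 0]
    by (simp add: field_simps)
  also have "\<dots> = 1 - omega (n + 1) / omega n" using omega_pos[of n] by (simp add: field_simps)
  finally show "?c / sqrt (real n + 1) \<le> 1 - omega (n + 1) / omega n" .
qed

text \<open>The left side is the variance of \<open>t\<^sup>2\<close>, hence at most its mean square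
  distance to any \<open>c\<close>. For \<open>c = (1 - \<theta>)\<^sup>2\<close> the factorization
  \<open>t\<^sup>2 - c = (t - (1 - \<theta>)) * (t + 1 - \<theta>)\<close> reduces the claim to
  \<open>mom_variance\<close>.\<close>

lemma omega_variance:
  "\<exists>C>0. \<forall>n. omega (n + 2) / omega n - (omega (n + 1) / omega n)\<^sup>2 \<le> C / sqrt (real n + 1) ^ 3"
proof (intro exI conjI allI)
  let ?D = "3 * (\<alpha> + 2) + \<bar>\<alpha> - 2\<bar> * (\<alpha> + 1)"
  let ?C = "(2 + sqrt \<alpha>)\<^sup>2 * (?D / sqrt \<alpha>)"
  have D: "?D > 0" using \<alpha> by (intro add_pos_nonneg) auto
  have "0 < sqrt \<alpha>" "0 < 2 + sqrt \<alpha>" using \<alpha> by (auto intro: add_pos_pos)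
  then show "?C > 0" using D by (intro mult_pos_pos divide_pos_pos zero_less_power)
  fix n :: nat
  let ?i = "2 * n + 1"
  let ?M = "real ?i + 3"
  define \<theta> where "\<theta> = mom_center ?i"
  define c where "c = (1 - \<theta>)\<^sup>2"
  define V where "V = (\<integral>t. ew ?i t * ((1 - t) - \<theta>)\<^sup>2 \<partial>unit_lborel)"
  have \<theta>: "0 < \<theta>" "\<theta> \<le> sqrt \<alpha>" using \<alpha> by (auto simp: \<theta>_def mom_center_def field_simps)
  have "(omega (n + 2) / omega n - (omega (n + 1) / omega n)\<^sup>2) \<le> (omega (n + 2) - 2 * c * omega (n + 1) + c\<^sup>2 * omega n) / omega n"
  proof -
    have "(omega (n + 2) - 2 * c * omega (n + 1) + c\<^sup>2 * omega n) / omega n - (omega (n + 2) / omega n - (omega (n + 1) / omega n)\<^sup>2) = (omega (n + 1) / omega n - c)\<^sup>2"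
      using omega_pos[of n] by (simp add: field_simps power2_eq_square)
    then show ?thesis using zero_le_power2[of "omega (n + 1) / omega n - c"] by linarith
  qed
  also have "\<dots> = 2 * (\<integral>t. ew ?i t * (t^2 - c)\<^sup>2 \<partial>unit_lborel) / omega n" by (simp only: omega_square)
  also have "\<dots> \<le> 2 * ((2 + sqrt \<alpha>)\<^sup>2 * V) / omega n"
  proof -
    have "(\<integral>t. ew ?i t * (t^2 - c)\<^sup>2 \<partial>unit_lborel) \<le> (\<integral>t. ew ?i t * ((2 + sqrt \<alpha>)\<^sup>2 * ((1 - t) - \<theta>)\<^sup>2) \<partial>unit_lborel)"
    proof (rule integral_ew_mono)
      fix t :: real assume t: "0 < t" "t < 1"
      have "(t^2 - c)\<^sup>2 = \<bar>t + 1 - \<theta>\<bar>\<^sup>2 * ((1 - t) - \<theta>)\<^sup>2" unfolding c_def power2_abs by algebra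
      also have "\<dots> \<le> (2 + sqrt \<alpha>)\<^sup>2 * ((1 - t) - \<theta>)\<^sup>2"
        using t \<theta> by (intro mult_right_mono power_mono) auto
      finally show "(t^2 - c)\<^sup>2 \<le> (2 + sqrt \<alpha>)\<^sup>2 * ((1 - t) - \<theta>)\<^sup>2" .
    next
      have c: "0 \<le> c" by (simp add: c_def)
      show "integrable unit_lborel (\<lambda>t. ew ?i t * (t\<^sup>2 - c)\<^sup>2)"
      proof (rule integrable_ew[where B="(1 + c)\<^sup>2"])
        fix t :: real assume t: "0 < t" "t < 1"
        have "t\<^sup>2 \<le> 1" using t by (simp add: power_le_one)
        then have "\<bar>t\<^sup>2 - c\<bar>\<^sup>2 \<le> (1 + c)\<^sup>2" using c by (intro power_mono) (auto simp: abs_le_iff intro: add_increasing add_increasing2 order_trans[of _ 0])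
        then show "\<bar>(t\<^sup>2 - c)\<^sup>2\<bar> \<le> (1 + c)\<^sup>2" by simp
      qed measurable
      show "integrable unit_lborel (\<lambda>t. ew ?i t * ((2 + sqrt \<alpha>)\<^sup>2 * ((1 - t) - \<theta>)\<^sup>2))"
      proof (rule integrable_ew[where B="(2 + sqrt \<alpha>)\<^sup>2 * (1 + \<theta>)\<^sup>2"])
        fix t :: real assume t: "0 < t" "t < 1"
        have "\<bar>(1 - t) - \<theta>\<bar>\<^sup>2 \<le> (1 + \<theta>)\<^sup>2" using t \<theta> by (intro power_mono) auto
        then show "\<bar>(2 + sqrt \<alpha>)\<^sup>2 * ((1 - t) - \<theta>)\<^sup>2\<bar> \<le> (2 + sqrt \<alpha>)\<^sup>2 * (1 + \<theta>)\<^sup>2"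
          by (simp add: abs_mult mult_left_mono)
      qed measurable
    qed
    also have "\<dots> = (2 + sqrt \<alpha>)\<^sup>2 * V"
      unfolding V_def by (subst integral_mult_right_zero[symmetric]) (simp add: mult_ac)
    finally show ?thesis using omega_pos[of n] by (intro divide_right_mono) auto
  qed
  also have "\<dots> \<le> (2 + sqrt \<alpha>)\<^sup>2 * (?D / (?M * (?M * \<theta>)))"
  proof -
    have "V * (?M * \<theta>) \<le> ?D * mom ?i 0 / ?M"
      unfolding V_def \<theta>_def by (rule mom_variance)
    then have "V \<le> ?D * mom ?i 0 / ?M / (?M * \<theta>)" using \<theta> by (subst pos_le_divide_eq) auto
    then have "V / mom ?i 0 \<le> ?D / (?M * (?M * \<theta>))" using mom_pos[of ?i 0]
      by (subst pos_divide_le_eq) (auto simp: mult_ac)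
    then have "(2 + sqrt \<alpha>)\<^sup>2 * (V / mom ?i 0) \<le> (2 + sqrt \<alpha>)\<^sup>2 * (?D / (?M * (?M * \<theta>)))"
      by (rule mult_left_mono) simp
    then show ?thesis by (simp add: omega_0_mom)
  qed
  \<comment> \<open>As \<open>\<theta> = sqrt (\<alpha> / ?M)\<close>, the denominator is
    \<open>sqrt \<alpha>\<close> times \<open>?M\<close> to the power \<open>3/2\<close>, and
    \<open>?M = 2 * n + 4\<close> exceeds \<open>n + 1\<close>.\<close>
  also have "\<dots> \<le> (2 + sqrt \<alpha>)\<^sup>2 * (?D / (sqrt \<alpha> * sqrt (real n + 1) ^ 3))"
  proof -
    define x where "x = sqrt ?M"
    have x: "x > 0" "?M = x * x" by (simp_all add: x_def)
    have "\<theta> = sqrt \<alpha> / x" by (simp add: \<theta>_def mom_center_def real_sqrt_divide x_def)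
    then have "?M * (?M * \<theta>) = sqrt \<alpha> * x ^ 3" using x(1) unfolding x(2) by (simp add: power3_eq_cube)
    then have eq: "?M * (?M * \<theta>) = sqrt \<alpha> * sqrt ?M ^ 3" unfolding x_def .
    have "sqrt \<alpha> * sqrt (real n + 1) ^ 3 \<le> ?M * (?M * \<theta>)"
      unfolding eq using \<alpha> by (intro mult_left_mono power_mono) auto
    then show ?thesis using D \<alpha> by (intro mult_left_mono divide_left_mono mult_pos_pos) (auto simp: \<theta>)
  qed
  finally show "omega (n + 2) / omega n - (omega (n + 1) / omega n)\<^sup>2 \<le> ?C / sqrt (real n + 1) ^ 3"
    by (simp add: divide_divide_eq_left)
qed

end

subsection \<open>A fourth moment estimate\<close>

text \<open>The discrete counterpart of integration by parts (Stein's identity) for the weights \<open>p\<close>.\<close>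

lemma stein_shift:
  fixes p q g :: "nat \<Rightarrow> real"
  assumes q0: "q 0 = 0" and rec: "\<And>n. p (Suc n) * q (Suc n) = c * p n"
    and s: "summable (\<lambda>n. p n * g (Suc n))"
  shows "summable (\<lambda>n. p n * q n * g n)" "(\<Sum>n. p n * q n * g n) = c * (\<Sum>n. p n * g (Suc n))"
proof -
  have eq: "(\<lambda>n. p (Suc n) * q (Suc n) * g (Suc n)) = (\<lambda>n. c * (p n * g (Suc n)))"
    by (simp add: rec fun_eq_iff mult_ac)
  have "summable (\<lambda>n. p (Suc n) * q (Suc n) * g (Suc n))"
    unfolding eq using s by (rule summable_mult)
  then show sm: "summable (\<lambda>n. p n * q n * g n)" by (subst (asm) summable_Suc_iff)
  show "(\<Sum>n. p n * q n * g n) = c * (\<Sum>n. p n * g (Suc n))"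
    using suminf_split_head[OF sm] suminf_mult[OF s, of c] unfolding eq by (simp add: q0)
qed

lemma summable_bounded_mult:
  fixes p g :: "nat \<Rightarrow> real"
  assumes "summable p" "\<And>n. p n \<ge> 0" "\<And>n. \<bar>g n\<bar> \<le> B"
  shows "summable (\<lambda>n. p n * g n)"
proof (rule summable_comparison_test)
  show "\<exists>N. \<forall>n\<ge>N. norm (p n * g n) \<le> B * p n"
  proof (intro exI[of _ 0] allI impI)
    fix n show "norm (p n * g n) \<le> B * p n"
      using mult_right_mono[OF assms(3)[of n] assms(2)[of n]] assms(2)[of n] by (simp add: abs_mult mult.commute)
  qed
  show "summable (\<lambda>n. B * p n)" using assms(1) by (rule summable_mult)
qed

text \<open>The input of the moment estimate, detached from the integrals: \<open>p r n\<close>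
  stands for \<open>r ^ (2 * n) / omega n\<close> and \<open>q n\<close> for
  \<open>omega n / omega (n - 1)\<close>. The bound \<open>P\<close>, uniform in \<open>r\<close>,
  controls the finitely many indices for which the asymptotics give nothing.\<close>

locale weight_ratios =
  fixes q :: "nat \<Rightarrow> real" and p :: "real \<Rightarrow> nat \<Rightarrow> real" and P :: "nat \<Rightarrow> real" and \<kappa> C\<^sub>1 :: real
  assumes q0: "q 0 = 0" and q_mono: "q n \<le> q (Suc n)" and q_le: "q n \<le> 1"
    and kappa: "\<kappa> > 0" and gap: "\<kappa> / sqrt (real n + 1) \<le> 1 - q n"
    and C1: "C\<^sub>1 > 0" and step: "q (Suc n) - q n \<le> C\<^sub>1 / sqrt (real n + 1) ^ 3"
    and p_pos: "0 < r \<Longrightarrow> r < 1 \<Longrightarrow> p r n > 0"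
    and p_rec: "0 < r \<Longrightarrow> r < 1 \<Longrightarrow> p r (Suc n) * q (Suc n) = r\<^sup>2 * p r n"
    and p_summable: "0 < r \<Longrightarrow> r < 1 \<Longrightarrow> summable (p r)"
    and p_le: "0 < r \<Longrightarrow> r < 1 \<Longrightarrow> p r n \<le> P n"
begin

text \<open>The natural scale: two of the assumptions read
  \<open>\<kappa> * e n \<le> 1 - q n\<close> and
  \<open>q (Suc n) - q n \<le> C\<^sub>1 * e n ^ 3\<close>.\<close>

definition e :: "nat \<Rightarrow> real" where "e n = 1 / sqrt (real n + 1)"

lemma e_pos: "e n > 0" and e_le_1: "e n \<le> 1"
  by (simp_all add: e_def)

lemma e_power_le_1: "e n ^ k \<le> 1" using e_pos[of n] e_le_1[of n] by (simp add: power_le_one less_imp_le)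

lemma e_antimono: "e (Suc n) \<le> e n"
  by (simp add: e_def frac_le)

lemma e_sq: "(e n)\<^sup>2 = 1 / (real n + 1)" by (simp add: e_def power_divide)

text \<open>A discrete derivative of a power of \<open>n + 1\<close> gains two factors
  \<open>e n\<close>. The bound \<open>x \<le> sqrt x\<close> for \<open>x \<le> 1\<close> removes
  the root, so that Bernoulli's inequality applies with exponent \<open>k\<close>.\<close>

lemma e_power_diff: "e n ^ k - e (Suc n) ^ k \<le> real k * e n ^ (k + 2)"
proof -
  define x where "x = (real n + 1) / (real n + 2)"
  have x: "0 < x" "x \<le> 1" by (auto simp: x_def)
  have "e (Suc n) = e n * sqrt x" by (simp add: e_def x_def real_sqrt_divide)
  also have "e n * sqrt x \<ge> e n * x"
  proof (rule mult_left_mono)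
    have "x * x \<le> x * 1" using x by (intro mult_left_mono) auto
    then show "x \<le> sqrt x" using x by (intro real_le_rsqrt) (simp add: power2_eq_square)
  qed (use e_pos[of n] in simp)
  finally have "(e n * x) ^ k \<le> e (Suc n) ^ k" using e_pos[of n] x by (intro power_mono) auto
  moreover have "1 + real k * (x - 1) \<le> x ^ k"
    using Bernoulli_inequality[of "x - 1" k] x by simp
  then have "e n ^ k * (1 + real k * (x - 1)) \<le> (e n * x) ^ k"
    unfolding power_mult_distrib using e_pos[of n] by (intro mult_left_mono) auto
  ultimately have "e n ^ k - e (Suc n) ^ k \<le> e n ^ k * (real k * (1 - x))" by (simp add: algebra_simps)
  also have "1 - x \<le> (e n)\<^sup>2" by (simp add: e_sq x_def field_simps)
  then have "e n ^ k * (real k * (1 - x)) \<le> e n ^ k * (real k * (e n)\<^sup>2)"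
    using e_pos[of n] by (intro mult_left_mono) auto
  finally show ?thesis by (simp add: power_add power2_eq_square mult_ac)
qed

lemma e_small:
  assumes \<epsilon>: "\<epsilon> > 0"
  shows "\<exists>N. \<forall>n\<ge>N. e n \<le> \<epsilon>"
proof -
  obtain N where N: "1 / \<epsilon>\<^sup>2 \<le> real N" using real_arch_simple by blast
  have "e n \<le> \<epsilon>" if "n \<ge> N" for n
  proof -
    have "1 / \<epsilon>\<^sup>2 \<le> real n + 1" using N that by linarith
    then have "1 / (real n + 1) \<le> \<epsilon>\<^sup>2" using \<epsilon> by (simp add: field_simps)
    then show ?thesis using \<epsilon> by (intro power2_le_imp_le[of "e n" \<epsilon>]) (auto simp: e_sq)
  qed
  then show ?thesis by blast
qed

lemma p_nonneg: "0 < r \<Longrightarrow> r < 1 \<Longrightarrow> 0 \<le> p r n" using p_pos[of r n] by simp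

lemma summable_p_mult: "0 < r \<Longrightarrow> r < 1 \<Longrightarrow> (\<And>n. \<bar>g n\<bar> \<le> B) \<Longrightarrow> summable (\<lambda>n. p r n * g n)"
  by (rule summable_bounded_mult[OF p_summable p_nonneg])

lemma summable_p_e: "0 < r \<Longrightarrow> r < 1 \<Longrightarrow> summable (\<lambda>n. p r n * e n ^ k)"
  by (rule summable_p_mult[where B=1]) (use e_pos e_power_le_1 in \<open>auto simp: less_imp_le\<close>)

text \<open>
  By the gap condition \<open>e n\<close> is at most a multiple of \<open>1 - q n\<close>, and the identity above trades a
  factor \<open>1 - q n\<close> for \<open>1 - r\<^sup>2\<close>, up to a term that is of lower order for large \<open>n\<close>.
\<close>

lemma sum_e_step:
  "\<exists>A>0. \<forall>r. 0 < r \<and> r < 1 \<longrightarrow> (\<Sum>n. p r n * e n ^ Suc k) \<le> A * ((1 - r) * (\<Sum>n. p r n * e n ^ k) + 1)"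
proof -
  \<comment> \<open>From \<open>N\<close> on, \<open>k * e n \<le> \<kappa> / 2\<close>, so the
    increments of \<open>e n ^ k\<close> are absorbed by half of the left side; the indices below
    \<open>N\<close> contribute at most \<open>A0\<close>, whatever \<open>r\<close> is.\<close>
  obtain N where N: "\<And>n. n \<ge> N \<Longrightarrow> e n \<le> \<kappa> / (2 * (real k + 1))"
    using e_small[of "\<kappa> / (2 * (real k + 1))"] kappa by (auto)
  define A0 where "A0 = real k * (\<Sum>n<N. P n)"
  define A where "A = (2 / \<kappa>) * (2 + \<bar>A0\<bar>)"
  have "(\<Sum>n. p r n * e n ^ Suc k) \<le> A * ((1 - r) * (\<Sum>n. p r n * e n ^ k) + 1)" if r: "0 < r" "r < 1" for r
  proof -
    let ?S = "\<lambda>k. \<Sum>n. p r n * e n ^ k"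
    note se = summable_p_e[OF r]
    have sSuc: "summable (\<lambda>n. p r n * e (Suc n) ^ k)"
      by (rule summable_p_mult[OF r, where B=1]) (use e_pos e_power_le_1 in \<open>auto simp: less_imp_le\<close>)
    note stein = stein_shift[of q "p r" "r\<^sup>2" "\<lambda>n. e n ^ k", OF q0 p_rec[OF r] sSuc]
    have "\<kappa> * ?S (Suc k) = (\<Sum>n. \<kappa> * (p r n * e n ^ Suc k))" using se by (rule suminf_mult[symmetric])
    also have "\<dots> \<le> (\<Sum>n. p r n * e n ^ k - p r n * q n * e n ^ k)"
    proof (rule suminf_le)
      fix n
      have "\<kappa> * e n \<le> 1 - q n" using gap[of n] by (simp add: e_def)
      then have "p r n * e n ^ k * (\<kappa> * e n) \<le> p r n * e n ^ k * (1 - q n)"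
        using p_nonneg[OF r] e_pos[of n] by (intro mult_left_mono) auto
      then show "\<kappa> * (p r n * e n ^ Suc k) \<le> p r n * e n ^ k - p r n * q n * e n ^ k"
        by (simp add: algebra_simps)
    qed (intro summable_mult summable_diff se stein(1))+
    also have "\<dots> = ?S k - r\<^sup>2 * (\<Sum>n. p r n * e (Suc n) ^ k)"
      by (simp only: suminf_diff[OF se stein(1), symmetric] stein(2))
    also have "\<dots> = (1 - r\<^sup>2) * ?S k + r\<^sup>2 * (?S k - (\<Sum>n. p r n * e (Suc n) ^ k))"
      by (simp add: algebra_simps)
    also have "?S k - (\<Sum>n. p r n * e (Suc n) ^ k) = (\<Sum>n. p r n * e n ^ k - p r n * e (Suc n) ^ k)"
      by (rule suminf_diff[OF se sSuc])
    also have "(1 - r\<^sup>2) * ?S k + r\<^sup>2 * \<dots> \<le> (2 * (1 - r)) * ?S k + 1 * (A0 + \<kappa> / 2 * ?S (Suc k))"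
    proof (intro add_mono mult_right_mono mult_mono)
      show "1 - r\<^sup>2 \<le> 2 * (1 - r)" using zero_le_power2[of "1 - r"] by (simp add: power2_eq_square algebra_simps)
      show "r\<^sup>2 \<le> 1" using r by (simp add: power_le_one)
      show "0 \<le> ?S k" using p_nonneg[OF r] e_pos by (intro suminf_nonneg se) (simp add: less_imp_le)
      show "0 \<le> (\<Sum>n. p r n * e n ^ k - p r n * e (Suc n) ^ k)"
        using p_nonneg[OF r] e_antimono e_pos
        by (intro suminf_nonneg summable_diff se sSuc) (auto intro!: mult_left_mono power_mono simp: less_imp_le)
      have "(\<Sum>n. p r n * e n ^ k - p r n * e (Suc n) ^ k) \<le>
         (\<Sum>n. (if n \<in> {..<N} then real k * P n else 0) + \<kappa> / 2 * (p r n * e n ^ Suc k))"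
      proof (rule suminf_le)
        fix n
        have ek: "e n ^ (k + 2) = e n * e n ^ Suc k" "0 < e n ^ (k+2)" "e n ^ (k + 2) \<le> 1"
          using e_pos[of n] e_power_le_1[of n "k + 2"] by simp_all
        have "p r n * e n ^ k - p r n * e (Suc n) ^ k = p r n * (e n ^ k - e (Suc n) ^ k)" by (simp add: algebra_simps)
        also have "\<dots> \<le> p r n * (real k * e n ^ (k + 2))"
          using p_nonneg[OF r] by (intro mult_left_mono e_power_diff)
        also have "\<dots> \<le> (if n \<in> {..<N} then real k * P n else 0) + \<kappa> / 2 * (p r n * e n ^ Suc k)"
        proof (cases "n < N")
          case True
          have "p r n * (real k * e n ^ (k + 2)) \<le> P n * (real k * 1)"
            using p_le[OF r, of n] p_nonneg[OF r, of n] ek by (intro mult_mono mult_left_mono) auto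
          moreover have "0 \<le> \<kappa> / 2 * (p r n * e n ^ Suc k)" using kappa p_nonneg[OF r, of n] e_pos[of n] by simp
          ultimately show ?thesis using True by (simp add: mult.commute)
        next
          case False
          have "real k * e n \<le> (real k + 1) * (\<kappa> / (2 * (real k + 1)))"
            using N[of n] False e_pos[of n] by (intro mult_mono) auto
          also have "\<dots> = \<kappa> / 2" by (simp add: field_simps)
          finally have "p r n * e n ^ Suc k * (real k * e n) \<le> p r n * e n ^ Suc k * (\<kappa> / 2)"
            using p_nonneg[OF r, of n] e_pos[of n] by (intro mult_left_mono) auto
          with False show ?thesis unfolding ek(1) by (simp add: mult_ac)
        qed
        finally show "p r n * e n ^ k - p r n * e (Suc n) ^ k \<le> (if n \<in> {..<N} then real k * P n else 0) + \<kappa> / 2 * (p r n * e n ^ Suc k)" .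
      qed (intro summable_diff se sSuc summable_add summable_mult summable_If_finite_set finite_lessThan)+
      also have "\<dots> = A0 + \<kappa> / 2 * ?S (Suc k)"
      proof -
        have "(\<lambda>n. if n \<in> {..<N} then real k * P n else 0) sums (\<Sum>n\<in>{..<N}. real k * P n)"
          by (rule sums_If_finite_set) simp
        moreover have "(\<lambda>n. \<kappa> / 2 * (p r n * e n ^ Suc k)) sums (\<kappa> / 2 * ?S (Suc k))"
          by (intro sums_mult summable_sums se)
        ultimately have "(\<lambda>n. (if n \<in> {..<N} then real k * P n else 0) + \<kappa> / 2 * (p r n * e n ^ Suc k)) sums (A0 + \<kappa> / 2 * ?S (Suc k))"
          unfolding A0_def sum_distrib_left[symmetric] by (rule sums_add)
        then show ?thesis by (rule sums_unique[symmetric])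
      qed
      finally show "(\<Sum>n. p r n * e n ^ k - p r n * e (Suc n) ^ k) \<le> A0 + \<kappa> / 2 * ?S (Suc k)" .
    qed auto
    finally have "\<kappa> / 2 * ?S (Suc k) \<le> 2 * (1 - r) * ?S k + A0" by simp
    also have "\<dots> \<le> (2 + \<bar>A0\<bar>) * ((1 - r) * ?S k + 1)"
    proof -
      have "0 \<le> \<bar>A0\<bar> * ((1 - r) * ?S k)"
        using r p_nonneg[OF r] e_pos by (intro mult_nonneg_nonneg suminf_nonneg se) (auto simp: less_imp_le)
      then show ?thesis by (simp add: algebra_simps)
    qed
    finally have "2 * (\<kappa> / 2 * ?S (Suc k)) \<le> 2 * ((2 + \<bar>A0\<bar>) * ((1 - r) * ?S k + 1))" by (rule mult_left_mono) simp
    then have "?S (Suc k) * \<kappa> \<le> 2 * (2 + \<bar>A0\<bar>) * ((1 - r) * ?S k + 1)"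
    proof -
      have "?S (Suc k) * \<kappa> = 2 * (\<kappa> / 2 * ?S (Suc k))" by (simp del: power_Suc)
      then show ?thesis using \<open>2 * (\<kappa> / 2 * ?S (Suc k)) \<le> _\<close> by (simp only: mult.assoc)
    qed
    then have "?S (Suc k) \<le> 2 * (2 + \<bar>A0\<bar>) * ((1 - r) * ?S k + 1) / \<kappa>" using kappa by (simp only: pos_le_divide_eq)
    then show ?thesis by (simp add: A_def)
  qed
  moreover have "A > 0" using kappa by (simp add: A_def)
  ultimately show ?thesis by blast
qed

text \<open>Each round of \<open>sum_e_step\<close> gains one factor \<open>1 - r\<close>, and the
  additive constants stay bounded because \<open>1 - r < 1\<close>.\<close>

lemma sum_e_power:
  "\<exists>A>0. \<forall>r. 0 < r \<and> r < 1 \<longrightarrow> (\<Sum>n. p r n * e n ^ k) \<le> A * ((1 - r) ^ k * (\<Sum>n. p r n) + 1)"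
proof (induction k)
  case 0
  show ?case by (intro exI[of _ 1]) simp
next
  case (Suc k)
  then obtain A where A: "A > 0" "\<And>r. 0 < r \<Longrightarrow> r < 1 \<Longrightarrow> (\<Sum>n. p r n * e n ^ k) \<le> A * ((1 - r) ^ k * (\<Sum>n. p r n) + 1)" by blast
  obtain B where B: "B > 0" "\<And>r. 0 < r \<Longrightarrow> r < 1 \<Longrightarrow> (\<Sum>n. p r n * e n ^ Suc k) \<le> B * ((1 - r) * (\<Sum>n. p r n * e n ^ k) + 1)"
    using sum_e_step by blast
  have "(\<Sum>n. p r n * e n ^ Suc k) \<le> (B * (A + 1)) * ((1 - r) ^ Suc k * (\<Sum>n. p r n) + 1)" if r: "0 < r" "r < 1" for r
  proof -
    define X where "X = (1 - r) ^ Suc k * (\<Sum>n. p r n)"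
    have X: "X \<ge> 0" unfolding X_def using r p_nonneg[OF r] by (intro mult_nonneg_nonneg suminf_nonneg p_summable) auto
    have "(1 - r) * (\<Sum>n. p r n * e n ^ k) \<le> (1 - r) * (A * ((1 - r) ^ k * (\<Sum>n. p r n) + 1))"
      using A(2)[OF r] r by (intro mult_left_mono) auto
    also have "\<dots> = A * X + (1 - r) * A" by (simp add: X_def algebra_simps)
    also have "\<dots> \<le> A * X + A" using A(1) r by simp
    finally have "B * ((1 - r) * (\<Sum>n. p r n * e n ^ k) + 1) \<le> B * (A * X + A + 1)"
      using B(1) by (intro mult_left_mono) auto
    also have "\<dots> \<le> B * ((A + 1) * (X + 1))" using B(1) X by (intro mult_left_mono) (auto simp: algebra_simps)
    finally show ?thesis using B(2)[OF r] by (simp add: X_def mult.assoc)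
  qed
  then show ?case using A(1) B(1) by (intro exI[of _ "B * (A + 1)"]) auto
qed

lemma q_nonneg: "0 \<le> q n"
  using lift_Suc_mono_le[of q 0 n] q_mono q0 by simp

lemma abs_q_diff_le:
  assumes r: "0 < r" "r < 1"
  shows "\<bar>q n - r\<^sup>2\<bar> \<le> 1"
proof -
  have "r\<^sup>2 \<le> 1" "0 \<le> r\<^sup>2" using r by (auto simp: power_le_one)
  then show ?thesis using q_le[of n] q_nonneg[of n] by linarith
qed

text \<open>
  With \<open>D = q n - r\<^sup>2\<close>, the identity turns the sum of \<open>p D\<^sup>4\<close> into one of \<open>p\<close> times an increment of \<open>D\<^sup>3\<close>,
  which is absorbed up to squares of increments of \<open>q\<close>.
\<close>

theorem fourth_moment:
  "\<exists>A>0. \<forall>r. 0 < r \<and> r < 1 \<longrightarrow> summable (\<lambda>n. p r n * ((q n - r\<^sup>2) ^ 4 + e n ^ 6)) \<and>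
     (\<Sum>n. p r n * ((q n - r\<^sup>2) ^ 4 + e n ^ 6)) \<le> A * ((1 - r) ^ 6 * (\<Sum>n. p r n) + 1)"
proof -
  obtain A where A: "A > 0" "\<And>r. 0 < r \<Longrightarrow> r < 1 \<Longrightarrow> (\<Sum>n. p r n * e n ^ 6) \<le> A * ((1 - r) ^ 6 * (\<Sum>n. p r n) + 1)"
    using sum_e_power by blast
  have main: "summable (\<lambda>n. p r n * (q n - r\<^sup>2) ^ 4)"
    "(\<Sum>n. p r n * (q n - r\<^sup>2) ^ 4) \<le> 18 * (C\<^sub>1\<^sup>2 * (\<Sum>n. p r n * e n ^ 6))" if r: "0 < r" "r < 1" for r
  proof -
    define D where "D n = q n - r\<^sup>2" for n
    define d where "d n = q (Suc n) - q n" for n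
    have D1: "\<bar>D n\<bar> \<le> 1" for n using abs_q_diff_le[OF r] by (simp add: D_def)
    have Dk: "\<bar>D n ^ k\<bar> \<le> 1" for n k unfolding power_abs using D1[of n] by (simp add: power_le_one)
    have d: "0 \<le> d n" "d n \<le> 1" for n
      using q_mono[of n] q_le[of "Suc n"] q_nonneg[of n] by (simp_all add: d_def)
    have DS: "D (Suc n) = D n + d n" for n by (simp add: D_def d_def)
    have sD: "summable (\<lambda>n. p r n * D n ^ k)" for k
      by (rule summable_p_mult[OF r, where B=1]) (rule Dk)
    have sDS: "summable (\<lambda>n. p r n * D (Suc n) ^ k)" for k
      by (rule summable_p_mult[OF r, where B=1]) (rule Dk)
    have sd: "summable (\<lambda>n. p r n * (d n)\<^sup>2)"
      by (rule summable_p_mult[OF r, where B=1]) (use d in \<open>auto simp: power_le_one\<close>)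
    show "summable (\<lambda>n. p r n * (q n - r\<^sup>2) ^ 4)" using sD[of 4] by (simp add: D_def)
    note stein = stein_shift[of q "p r" "r\<^sup>2" "\<lambda>n. D n ^ 3", OF q0 p_rec[OF r] sDS]
    \<comment> \<open>One of the four factors \<open>D n\<close> is written out as
      \<open>q n - r\<^sup>2\<close>; the shift identity for \<open>D n ^ 3\<close> then applies to
      the part with \<open>q n\<close>.\<close>
    have "(\<Sum>n. p r n * D n ^ 4) = (\<Sum>n. p r n * q n * D n ^ 3 - r\<^sup>2 * (p r n * D n ^ 3))"
      by (rule suminf_cong) (simp add: D_def power4_eq_xxxx power3_eq_cube algebra_simps)
    also have "\<dots> = r\<^sup>2 * (\<Sum>n. p r n * D (Suc n) ^ 3) - r\<^sup>2 * (\<Sum>n. p r n * D n ^ 3)"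
      by (subst suminf_diff[OF stein(1) summable_mult[OF sD], symmetric]) (simp add: stein(2) suminf_mult[OF sD])
    also have "\<dots> = r\<^sup>2 * (\<Sum>n. p r n * D (Suc n) ^ 3 - p r n * D n ^ 3)"
      by (simp add: suminf_diff[OF sDS sD, symmetric] algebra_simps)
    also have "\<dots> \<le> 1 * (\<Sum>n. p r n * D (Suc n) ^ 3 - p r n * D n ^ 3)"
    proof (intro mult_right_mono suminf_nonneg summable_diff sDS sD)
      show "r\<^sup>2 \<le> 1" using r by (simp add: power_le_one)
      fix n
      have "D n ^ 3 \<le> D (Suc n) ^ 3" using d[of n] by (simp add: DS power_mono_odd)
      then show "0 \<le> p r n * D (Suc n) ^ 3 - p r n * D n ^ 3"
        using p_nonneg[OF r, of n] by (simp add: mult_left_mono)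
    qed
    also have "\<dots> \<le> 1 * (\<Sum>n. 1/2 * (p r n * D n ^ 4) + 9 * (p r n * (d n)\<^sup>2))"
    proof (intro mult_left_mono suminf_le summable_diff sDS sD summable_add summable_mult sd)
      fix n
      have "D (Suc n) ^ 3 - D n ^ 3 = 3 * ((D n)\<^sup>2 * d n) + 3 * (D n * (d n)\<^sup>2) + (d n)\<^sup>2 * d n"
        by (simp add: DS power2_eq_square power3_eq_cube algebra_simps)
      \<comment> \<open>\<open>3 * D\<^sup>2 * d \<le> D^4 / 2 + 9/2 * d\<^sup>2\<close>, and the
        other two terms are at most \<open>4 * d\<^sup>2\<close>, as \<open>\<bar>D\<bar>\<close>
        and \<open>d\<close> are at most \<open>1\<close>. Moving the half of \<open>D^4\<close> to
        the left later doubles the \<open>9\<close> to \<open>18\<close>.\<close>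
      also have "\<dots> \<le> (1/2 * D n ^ 4 + 9/2 * (d n)\<^sup>2) + 3 * (1 * (d n)\<^sup>2) + (d n)\<^sup>2 * 1"
      proof (intro add_mono mult_left_mono mult_right_mono)
        have "0 \<le> ((D n)\<^sup>2 - 3 * d n)\<^sup>2" by simp
        then show "3 * ((D n)\<^sup>2 * d n) \<le> 1/2 * D n ^ 4 + 9/2 * (d n)\<^sup>2"
          by (simp add: power2_eq_square power4_eq_xxxx algebra_simps)
      qed (use D1[of n] d[of n] in auto)
      also have "\<dots> \<le> 1/2 * D n ^ 4 + 9 * (d n)\<^sup>2" by simp
      finally have "p r n * (D (Suc n) ^ 3 - D n ^ 3) \<le> p r n * (1/2 * D n ^ 4 + 9 * (d n)\<^sup>2)"
        using p_nonneg[OF r, of n] by (rule mult_left_mono)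
      then show "p r n * D (Suc n) ^ 3 - p r n * D n ^ 3 \<le> 1/2 * (p r n * D n ^ 4) + 9 * (p r n * (d n)\<^sup>2)"
        by (simp add: algebra_simps)
    qed simp
    also have "\<dots> = 1/2 * (\<Sum>n. p r n * D n ^ 4) + 9 * (\<Sum>n. p r n * (d n)\<^sup>2)"
      by (simp only: suminf_add[OF summable_mult summable_mult, OF sD sd, symmetric] suminf_mult[OF sD] suminf_mult[OF sd] mult_1)
    finally have "(\<Sum>n. p r n * D n ^ 4) \<le> 18 * (\<Sum>n. p r n * (d n)\<^sup>2)" by simp
    also have "(\<Sum>n. p r n * (d n)\<^sup>2) \<le> (\<Sum>n. C\<^sub>1\<^sup>2 * (p r n * e n ^ 6))"
    proof (intro suminf_le summable_mult sd summable_p_e[OF r])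
      fix n
      have "d n \<le> C\<^sub>1 * e n ^ 3" using step[of n] by (simp add: d_def e_def power_divide)
      then have "(d n)\<^sup>2 \<le> (C\<^sub>1 * e n ^ 3)\<^sup>2" using d by (intro power_mono)
      also have "\<dots> = C\<^sub>1\<^sup>2 * e n ^ 6" by (simp add: power_mult_distrib power_mult[symmetric])
      finally have "p r n * (d n)\<^sup>2 \<le> p r n * (C\<^sub>1\<^sup>2 * e n ^ 6)" using p_nonneg[OF r, of n] by (rule mult_left_mono)
      then show "p r n * (d n)\<^sup>2 \<le> C\<^sub>1\<^sup>2 * (p r n * e n ^ 6)" by (simp add: mult_ac)
    qed
    also have "\<dots> = C\<^sub>1\<^sup>2 * (\<Sum>n. p r n * e n ^ 6)" by (rule suminf_mult[OF summable_p_e[OF r]])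
    finally show "(\<Sum>n. p r n * (q n - r\<^sup>2) ^ 4) \<le> 18 * (C\<^sub>1\<^sup>2 * (\<Sum>n. p r n * e n ^ 6))" by (simp add: D_def)
  qed
  have "summable (\<lambda>n. p r n * ((q n - r\<^sup>2) ^ 4 + e n ^ 6)) \<and>
     (\<Sum>n. p r n * ((q n - r\<^sup>2) ^ 4 + e n ^ 6)) \<le> ((18 * C\<^sub>1\<^sup>2 + 1) * A) * ((1 - r) ^ 6 * (\<Sum>n. p r n) + 1)"
    if r: "0 < r" "r < 1" for r
  proof
    show "summable (\<lambda>n. p r n * ((q n - r\<^sup>2) ^ 4 + e n ^ 6))"
      unfolding distrib_left by (intro summable_add main r summable_p_e)
    have "(\<Sum>n. p r n * ((q n - r\<^sup>2) ^ 4 + e n ^ 6)) = (\<Sum>n. p r n * (q n - r\<^sup>2) ^ 4) + (\<Sum>n. p r n * e n ^ 6)"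
      unfolding distrib_left by (rule suminf_add[OF main(1)[OF r] summable_p_e[OF r], symmetric])
    also have "\<dots> \<le> (18 * C\<^sub>1\<^sup>2 + 1) * (\<Sum>n. p r n * e n ^ 6)" using main(2)[OF r] by (simp add: algebra_simps)
    also have "\<dots> \<le> (18 * C\<^sub>1\<^sup>2 + 1) * (A * ((1 - r) ^ 6 * (\<Sum>n. p r n) + 1))" using A(2)[OF r] by (intro mult_left_mono) auto
    finally show "(\<Sum>n. p r n * ((q n - r\<^sup>2) ^ 4 + e n ^ 6)) \<le> ((18 * C\<^sub>1\<^sup>2 + 1) * A) * ((1 - r) ^ 6 * (\<Sum>n. p r n) + 1)"
      by (simp add: mult.assoc)
  qed
  moreover have "(18 * C\<^sub>1\<^sup>2 + 1) * A > 0" using A(1) by (intro mult_pos_pos) (auto intro: add_nonneg_pos)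
  ultimately show ?thesis by blast
qed

end

subsection \<open>Mean values of holomorphic functions\<close>

text \<open>Termwise integration in the form used from here on: the integrable factor
  \<open>h\<close> carries the weight or the given function, and the terms \<open>u n\<close> have a
  summable bound uniform on the disc.\<close>

lemma integral_disc_sums:
  fixes h :: "complex \<Rightarrow> complex"
  assumes h: "integrable disc_area h"
    and u: "\<And>n. u n \<in> borel_measurable disc_area"
    and le: "\<And>n z. norm z < 1 \<Longrightarrow> norm (u n z) \<le> c n" and c: "summable c"
  shows "(\<lambda>n. \<integral>z. h z * u n z \<partial>disc_area) sums (\<integral>z. h z * (\<Sum>n. u n z) \<partial>disc_area)"
    and "integrable disc_area (\<lambda>z. h z * (\<Sum>n. u n z))"
proof -
  have [measurable]: "h \<in> borel_measurable disc_area" using h by simp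
  note [measurable] = u
  have hc: "integrable disc_area (\<lambda>z. norm (h z) * c n)" for n using h by simp
  have le': "norm (h z * u n z) \<le> norm (h z) * c n" if "norm z < 1" for z n
    using le[OF that, of n] by (simp add: norm_mult mult_left_mono)
  have i: "integrable disc_area (\<lambda>z. h z * u n z)" for n
    by (rule Bochner_Integration.integrable_bound[OF hc[of n]]) (auto intro!: AE_I2 le' order_trans[OF le'] simp del: norm_mult)
  have s1: "AE z in disc_area. summable (\<lambda>n. norm (h z * u n z))"
    by (auto intro!: AE_I2 summable_comparison_test'[OF summable_mult[OF c], of 0] le' simp del: norm_mult)
  have s2: "summable (\<lambda>n. \<integral>z. norm (h z * u n z) \<partial>disc_area)"
  proof (rule summable_comparison_test'[of "\<lambda>n. (\<integral>z. norm (h z) \<partial>disc_area) * c n" 0])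
    fix n
    have "(\<integral>z. norm (h z * u n z) \<partial>disc_area) \<le> (\<integral>z. norm (h z) * c n \<partial>disc_area)"
      by (rule integral_mono) (use i[of n] hc[of n] le' in auto)
    then show "norm (\<integral>z. norm (h z * u n z) \<partial>disc_area) \<le> (\<integral>z. norm (h z) \<partial>disc_area) * c n"
      by simp
  qed (use c in \<open>simp add: summable_mult\<close>)
  have eq: "(\<Sum>n. h z * u n z) = h z * (\<Sum>n. u n z)" if "norm z < 1" for z
    by (rule suminf_mult) (rule summable_norm_cancel, rule summable_comparison_test'[OF c, of 0], use le[OF that] in simp)
  have e2: "(\<integral>z. (\<Sum>n. h z * u n z) \<partial>disc_area) = (\<integral>z. h z * (\<Sum>n. u n z) \<partial>disc_area)"
    by (rule Bochner_Integration.integral_cong) (simp_all add: eq)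
  show "(\<lambda>n. \<integral>z. h z * u n z \<partial>disc_area) sums (\<integral>z. h z * (\<Sum>n. u n z) \<partial>disc_area)"
    using sums_integral[OF i s1 s2] unfolding e2 .
  have "integrable disc_area (\<lambda>z. \<Sum>n. h z * u n z)" by (rule integrable_suminf[OF i s1 s2])
  moreover have "integrable disc_area (\<lambda>z. \<Sum>n. h z * u n z) = integrable disc_area (\<lambda>z. h z * (\<Sum>n. u n z))"
    by (rule Bochner_Integration.integrable_cong) (simp_all add: eq)
  ultimately show "integrable disc_area (\<lambda>z. h z * (\<Sum>n. u n z))" by simp
qed

lemma holomorphic_disc_series:
  assumes "f holomorphic_on ball 0 R"
  obtains a where "\<And>z. norm z < R \<Longrightarrow> (\<lambda>n. a n * z ^ n) sums f z"
    "\<And>\<rho>. 0 \<le> \<rho> \<Longrightarrow> \<rho> < R \<Longrightarrow> summable (\<lambda>n. norm (a n) * \<rho> ^ n)" "a 0 = f 0"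
proof
  let ?a = "\<lambda>n. (deriv ^^ n) f 0 / fact n"
  show *: "(\<lambda>n. ?a n * z ^ n) sums f z" if "norm z < R" for z
    using holomorphic_power_series[OF assms, of z] that by simp
  show "summable (\<lambda>n. norm (?a n) * \<rho> ^ n)" if \<rho>: "0 \<le> \<rho>" "\<rho> < R" for \<rho>
  proof -
    \<comment> \<open>Convergence at the midpoint of \<open>\<rho>\<close> and \<open>R\<close>
      gives absolute convergence at \<open>\<rho>\<close>.\<close>
    have n: "norm (of_real ((\<rho> + R) / 2) :: complex) = (\<rho> + R) / 2" unfolding norm_of_real using \<rho> by simp
    have "summable (\<lambda>n. ?a n * of_real ((\<rho> + R) / 2) ^ n)"
      by (rule sums_summable[OF *]) (unfold n, use \<rho> in simp)
    then have "summable (\<lambda>n. norm (?a n * of_real \<rho> ^ n))"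
      by (rule powser_insidea) (unfold n, use \<rho> in simp)
    then show ?thesis using \<rho> by (simp only: norm_mult norm_power norm_of_real abs_of_nonneg)
  qed
qed simp

text \<open>Every monomial except the constant integrates to zero by rotation. Holomorphy on a
  larger disc makes the Taylor coefficients absolutely summable, so that integration is termwise up
  to the circle.\<close>

lemma disc_mean_value:
  assumes f: "f holomorphic_on ball 0 R" and R: "R > 1"
  shows "(\<integral>z. f z \<partial>disc_area) = f 0"
proof -
  obtain a where a: "\<And>z. norm z < R \<Longrightarrow> (\<lambda>n. a n * z ^ n) sums f z"
    "\<And>\<rho>. 0 \<le> \<rho> \<Longrightarrow> \<rho> < R \<Longrightarrow> summable (\<lambda>n. norm (a n) * \<rho> ^ n)" "a 0 = f 0"
    using holomorphic_disc_series[OF f] by blast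
  have "(\<lambda>n. \<integral>z. 1 * (a n * z ^ n) \<partial>disc_area) sums (\<integral>z. 1 * (\<Sum>n. a n * z ^ n) \<partial>disc_area)"
  proof (rule integral_disc_sums)
    show "summable (\<lambda>n. norm (a n) * 1 ^ n)" by (rule a(2)) (use R in auto)
    show "norm (a n * z ^ n) \<le> norm (a n) * 1 ^ n" if "norm z < 1" for n z
      unfolding norm_mult norm_power using that by (intro mult_left_mono power_mono) auto
  qed (auto intro!: measurable_disc_areaI)
  also have "(\<integral>z. 1 * (\<Sum>n. a n * z ^ n) \<partial>disc_area) = (\<integral>z. f z \<partial>disc_area)"
    by (rule Bochner_Integration.integral_cong) (use R a(1) in \<open>auto simp: sums_iff\<close>)
  finally have 1: "(\<lambda>n. \<integral>z. a n * z ^ n \<partial>disc_area) sums (\<integral>z. f z \<partial>disc_area)" by simp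
  have 2: "(\<integral>z. a n * z ^ n \<partial>disc_area) = (if n = 0 then f 0 else 0)" for n
  proof (cases "n = 0")
    case True then show ?thesis by (simp add: a(3) measure_disc_area_space)
  next
    case False
    have "(\<integral>z. z ^ n * cnj z ^ 0 * of_real ((\<lambda>_. 1) (norm z)) \<partial>disc_area) = 0"
      using False by (intro integral_monomials_radial_eq_0) auto
    then show ?thesis using False by simp
  qed
  have "(\<lambda>n. if n = 0 then f 0 else 0) sums f 0"
    using sums_single[of 0 "\<lambda>_. f 0"] by simp
  with 1 show ?thesis unfolding 2 by (rule sums_unique2[symmetric, rotated])
qed

section \<open>The area submean value inequality\<close>

lemma nn_integral_lborel_affine:
  fixes c :: complex
  assumes [measurable]: "H \<in> borel_measurable borel" and \<delta>: "\<delta> > 0"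
  shows "(\<integral>\<^sup>+w. H w \<partial>lborel) = ennreal (\<delta>\<^sup>2) * (\<integral>\<^sup>+w. H (c + \<delta> *\<^sub>R w) \<partial>lborel)"
proof -
  have "(\<integral>\<^sup>+w. H w \<partial>lborel) = (\<integral>\<^sup>+w. H w \<partial>density (distr lborel borel (\<lambda>x. c + \<delta> *\<^sub>R x)) (\<lambda>_. \<bar>\<delta>\<bar> ^ DIM(complex)))"
    using \<delta> by (subst lborel_affine[of \<delta> c, symmetric]) simp_all
  also have "\<dots> = (\<integral>\<^sup>+w. ennreal (\<delta>\<^sup>2) * H (c + \<delta> *\<^sub>R w) \<partial>lborel)"
    by (subst nn_integral_density) (auto simp: nn_integral_distr)
  also have "\<dots> = ennreal (\<delta>\<^sup>2) * (\<integral>\<^sup>+w. H (c + \<delta> *\<^sub>R w) \<partial>lborel)"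
    by (rule nn_integral_cmult) measurable
  finally show ?thesis .
qed

text \<open>The mean value property of the holomorphic function \<open>F\<^sup>2\<close>, rescaled
  to the unit disc, gives the inequality for the square of the modulus. In normalized area the disc
  of radius \<open>\<delta>\<close> has measure \<open>\<delta>\<^sup>2\<close>.\<close>

lemma submean_value_disc:
  assumes F: "F holomorphic_on ball c R" and \<delta>: "0 < \<delta>" "\<delta> < R"
    and sub: "ball c \<delta> \<subseteq> unit_disc"
  shows "ennreal ((norm (F c))\<^sup>2 * \<delta>\<^sup>2) \<le> (\<integral>\<^sup>+z. ennreal ((norm (F z))\<^sup>2) * indicator (ball c \<delta>) z \<partial>disc_area)"
proof -
  define G where "G w = (F (c + \<delta> *\<^sub>R w))\<^sup>2" for w
  have contF: "continuous_on (ball c R) F" using F by (rule holomorphic_on_imp_continuous_on)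
  have "G holomorphic_on ball 0 (R / \<delta>)"
    unfolding G_def
  proof (intro holomorphic_on_power)
    have "F \<circ> (\<lambda>w. c + of_real \<delta> * w) holomorphic_on ball 0 (R / \<delta>)"
      by (rule holomorphic_on_compose_gen[OF _ F])
         (use \<delta> in \<open>auto intro!: holomorphic_intros simp: norm_mult dist_norm field_simps\<close>)
    then show "(\<lambda>w. F (c + \<delta> *\<^sub>R w)) holomorphic_on ball 0 (R / \<delta>)" by (simp add: o_def scaleR_conv_of_real)
  qed
  moreover have "R / \<delta> > 1" using \<delta> by simp
  ultimately have mv: "(\<integral>w. G w \<partial>disc_area) = G 0" and contG: "continuous_on (ball 0 1) G"
    using disc_mean_value[of G "R/\<delta>"] holomorphic_on_imp_continuous_on[of G "ball 0 (R/\<delta>)"]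
    by (auto elim!: continuous_on_subset)
  have Gm: "G \<in> borel_measurable disc_area" using contG by (rule continuous_on_measurable_disc_area)
  let ?H = "\<lambda>z. ennreal ((norm (F z))\<^sup>2) * indicator (ball c \<delta>) z"
  \<comment> \<open>Continuity of \<open>F\<close> is known only on \<open>ball c R\<close>, so
    measurability on the plane is obtained after multiplying by the indicator.\<close>
  have Hm: "?H \<in> borel_measurable borel"
  proof -
    have "(\<lambda>z. indicator (ball c \<delta>) z *\<^sub>R F z) \<in> borel_measurable borel"
      by (rule borel_measurable_continuous_on_indicator) (use contF \<delta> in \<open>auto elim!: continuous_on_subset\<close>)
    then have "(\<lambda>z. ennreal ((norm (indicator (ball c \<delta>) z *\<^sub>R F z))\<^sup>2)) \<in> borel_measurable borel" by measurable
    also have "(\<lambda>z. ennreal ((norm (indicator (ball c \<delta>) z *\<^sub>R F z))\<^sup>2)) = ?H"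
      by (auto simp: fun_eq_iff split: split_indicator)
    finally show ?thesis .
  qed
  have "ennreal ((norm (F c))\<^sup>2) = ennreal (norm (\<integral>w. G w \<partial>disc_area))"
    by (simp add: mv) (simp add: G_def norm_power)
  also have "\<dots> \<le> (\<integral>\<^sup>+w. ennreal (norm (G w)) \<partial>disc_area)"
  proof (cases "integrable disc_area G")
    case True then show ?thesis by (rule integral_norm_bound_ennreal)
  qed (simp add: not_integrable_integral_eq)
  also have "\<dots> = ennreal (1/pi) * (\<integral>\<^sup>+w. ennreal (norm (G w)) * indicator unit_disc w \<partial>lborel)"
    by (rule nn_integral_disc_area) (use Gm in measurable)
  also have "(\<integral>\<^sup>+w. ennreal (norm (G w)) * indicator unit_disc w \<partial>lborel) = (\<integral>\<^sup>+w. ?H (c + \<delta> *\<^sub>R w) \<partial>lborel)"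
    by (rule nn_integral_cong) (use \<delta> in \<open>auto simp: G_def norm_power dist_norm split: split_indicator\<close>)
  finally have *: "ennreal ((norm (F c))\<^sup>2) \<le> ennreal (1/pi) * (\<integral>\<^sup>+w. ?H (c + \<delta> *\<^sub>R w) \<partial>lborel)" .
  have "ennreal ((norm (F c))\<^sup>2 * \<delta>\<^sup>2) = ennreal (\<delta>\<^sup>2) * ennreal ((norm (F c))\<^sup>2)"
    by (simp add: ennreal_mult' mult.commute)
  also have "\<dots> \<le> ennreal (\<delta>\<^sup>2) * (ennreal (1/pi) * (\<integral>\<^sup>+w. ?H (c + \<delta> *\<^sub>R w) \<partial>lborel))"
    by (rule mult_left_mono[OF *]) simp
  also have "\<dots> = ennreal (1/pi) * (\<integral>\<^sup>+w. ?H w \<partial>lborel)"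
    by (subst nn_integral_lborel_affine[OF Hm \<delta>(1), of c]) (simp add: mult_ac)
  also have "\<dots> = ennreal (1/pi) * (\<integral>\<^sup>+w. ?H w * indicator unit_disc w \<partial>lborel)"
  proof -
    have "?H w = ?H w * indicator unit_disc w" for w using sub by (auto split: split_indicator)
    then show ?thesis by simp
  qed
  also have "\<dots> = (\<integral>\<^sup>+w. ?H w \<partial>disc_area)"
    by (rule nn_integral_disc_area[symmetric]) (use Hm in \<open>rule measurable_disc_areaI\<close>)
  finally show ?thesis .
qed

lemma cnj_borel_measurable [measurable]: "cnj \<in> borel_measurable borel"
  by (intro borel_measurable_continuous_onI continuous_intros)

text \<open>
  Near \<open>r\<close>, at the scale \<open>(1 - r)\<close> to the power \<open>3/2\<close>, the weight is comparable to the modulus of an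
  analytic function.
\<close>

lemma inverse_one_minus_diff_le:
  fixes \<zeta> :: complex
  assumes r: "1/2 \<le> r" "r < 1" and z: "dist (of_real r) \<zeta> < (1 - r) * sqrt (1 - r) / 2"
  shows "1 / (1 - norm \<zeta>) \<le> Re (1 / (1 - \<zeta>)) + 8" "norm \<zeta> < 1"
proof -
  define a where "a = 1 - r"
  define \<delta> where "\<delta> = a * sqrt a / 2"
  have a: "0 < a" "a \<le> 1/2" using r by (auto simp: a_def)
  have \<delta>2: "\<delta>\<^sup>2 = a ^ 3 / 4" using a by (simp add: \<delta>_def power_mult_distrib power2_eq_square power3_eq_cube)
  have "a * sqrt a \<le> a * 1" using a by (intro mult_left_mono) auto
  then have \<delta>: "\<delta> \<le> a / 2" by (simp add: \<delta>_def)
  have d: "norm (\<zeta> - of_real r) < \<delta>" using z by (simp add: \<delta>_def a_def dist_norm norm_minus_commute)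
  define \<rho> x y where "\<rho> = norm \<zeta>" and "x = Re \<zeta>" and "y = Im \<zeta>"
  have "\<bar>x - r\<bar> \<le> norm (\<zeta> - of_real r)" using abs_Re_le_cmod[of "\<zeta> - of_real r"] by (simp add: x_def)
  then have x: "x \<ge> 1/4" using d \<delta> a r by (simp add: a_def)
  have "\<bar>y\<bar> \<le> \<delta>" using abs_Im_le_cmod[of "\<zeta> - of_real r"] d by (simp add: y_def)
  then have "\<bar>y\<bar>\<^sup>2 \<le> \<delta>\<^sup>2" by (intro power_mono) auto
  then have y2: "y\<^sup>2 \<le> a ^ 3 / 4" using \<delta>2 by simp
  have "\<rho> \<le> norm (\<zeta> - of_real r) + norm (of_real r :: complex)" unfolding \<rho>_def using norm_triangle_ineq[of "\<zeta> - of_real r" "of_real r"] by simp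
  then have b: "1 - \<rho> \<ge> a / 2" using d \<delta> r by (simp add: a_def)
  then show "norm \<zeta> < 1" using a by (simp add: \<rho>_def)
  have \<rho>2: "\<rho>\<^sup>2 = x\<^sup>2 + y\<^sup>2" by (simp add: \<rho>_def x_def y_def cmod_power2)
  have x\<rho>: "x \<le> \<rho>" using complex_Re_le_cmod[of \<zeta>] by (simp add: x_def \<rho>_def)
  have \<rho>1: "0 \<le> \<rho>" "\<rho> \<le> 1" using b a by (auto simp: \<rho>_def)
  define m where "m = (norm (1 - \<zeta>))\<^sup>2"
  have m: "m = (1 - x)\<^sup>2 + y\<^sup>2" by (simp add: m_def cmod_power2 x_def y_def)
  have Re: "Re (1 / (1 - \<zeta>)) = (1 - x) / m" by (simp add: m Re_divide x_def y_def)
  have "1 - \<rho> \<le> norm (1 - \<zeta>)" using norm_triangle_ineq2[of 1 \<zeta>] by (simp add: \<rho>_def)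
  then have "(1 - \<rho>)\<^sup>2 \<le> m" unfolding m_def using b a by (intro power_mono) auto
  moreover have "(a / 2)\<^sup>2 \<le> (1 - \<rho>)\<^sup>2" using b a by (intro power_mono) auto
  ultimately have m2: "(a / 2)\<^sup>2 \<le> m" by linarith
  \<comment> \<open>\<open>\<rho>\<^sup>2 - x\<^sup>2 = y\<^sup>2\<close> and
    \<open>\<rho> + x \<ge> 1/2\<close> make the gap between modulus and real part quadratic in
    \<open>y\<close>.\<close>
  have "(\<rho> - x) * (1/2) \<le> (\<rho> - x) * (\<rho> + x)" using x x\<rho> by (intro mult_left_mono) auto
  also have "\<dots> = y\<^sup>2" using \<rho>2 by (simp add: power2_eq_square algebra_simps)
  finally have rx: "\<rho> - x \<le> a ^ 3 / 2" using y2 by simp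
  have m0: "m > 0" using m2 a zero_less_power[of "a/2" 2] by linarith
  have b0: "1 - \<rho> > 0" using b a by linarith
  have "1 / (1 - \<rho>) - (1 - x) / m = (1 + \<rho>) * (\<rho> - x) / ((1 - \<rho>) * m)"
  proof -
    have "1 / (1 - \<rho>) - (1 - x) / m = (m - (1 - x) * (1 - \<rho>)) / ((1 - \<rho>) * m)"
      using m0 b0 by (simp add: diff_frac_eq)
    also have "m - (1 - x) * (1 - \<rho>) = (1 + \<rho>) * (\<rho> - x)"
      using \<rho>2 by (simp add: m power2_eq_square algebra_simps)
    finally show ?thesis .
  qed
  \<comment> \<open>The numerator is at most \<open>a^3\<close> and the denominator at least
    \<open>a^3 / 8\<close>, so the quotient is at most \<open>8\<close>. This is the reason for the
    radius: \<open>y\<^sup>2\<close> has to be as small as the cube in the denominator.\<close>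
  also have "\<dots> \<le> 2 * (a ^ 3 / 2) / ((a / 2) * (a / 2)\<^sup>2)"
    using a b m2 rx \<rho>1 x\<rho> by (intro frac_le mult_mono mult_pos_pos) auto
  also have "\<dots> = 8" using a by (simp add: power2_eq_square power3_eq_cube)
  finally show "1 / (1 - norm \<zeta>) \<le> Re (1 / (1 - \<zeta>)) + 8" unfolding Re \<rho>_def by simp
qed

subsection \<open>The diagonal of the kernel\<close>

context exp_disc
begin

abbreviation v :: "complex \<Rightarrow> real" where "v \<equiv> exp_weight \<alpha>"

definition s :: "complex \<Rightarrow> real" where "s z = exp (- (\<alpha> / (2 * (1 - norm z))))"

lemma v_measurable [measurable]: "v \<in> borel_measurable borel"
  unfolding exp_weight_def by measurable

lemma s_measurable [measurable]: "s \<in> borel_measurable borel"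
  unfolding s_def by measurable

lemma s_pos [simp]: "s z > 0" by (simp add: s_def)

lemma s_square: "(s z)\<^sup>2 = v z"
proof -
  have "- (x / (2 * y)) + - (x / (2 * y)) = - (x / y)" for x y :: real by (simp add: field_simps)
  then show ?thesis unfolding s_def exp_weight_def power2_eq_square mult_exp_exp by (simp only:)
qed

lemma s_le_1: "norm z < 1 \<Longrightarrow> s z \<le> 1"
  using \<alpha> by (simp add: s_def)

lemma v_pos [simp]: "v z > 0" by (simp add: exp_weight_def)

lemma v_le_1: "norm z < 1 \<Longrightarrow> v z \<le> 1"
  using \<alpha> by (simp add: exp_weight_def)

lemma integrable_power_v: "integrable disc_area (\<lambda>z. norm z ^ k * v z)"
proof (rule disc_area.integrable_const_bound[where B=1])
  show "AE z in disc_area. norm (norm z ^ k * v z) \<le> 1"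
    by (auto intro!: AE_I2 mult_le_one simp: power_le_one v_le_1 abs_mult less_imp_le)
qed (auto intro!: measurable_disc_areaI)

lemma integrable_monomials_v: "integrable disc_area (\<lambda>z. z ^ m * cnj z ^ n * of_real (v z))"
proof (rule disc_area.integrable_const_bound[where B=1])
  show "AE z in disc_area. norm (z ^ m * cnj z ^ n * complex_of_real (v z)) \<le> 1"
    by (auto intro!: AE_I2 mult_le_one simp: power_le_one v_le_1 norm_mult norm_power less_imp_le)
qed (auto intro!: measurable_disc_areaI)

lemma integral_monomials_v:
  "(\<integral>z. z ^ m * cnj z ^ n * of_real (v z) \<partial>disc_area) = (if m = n then of_real (omega n) else 0)"
proof (cases "m = n")
  case True
  have "z ^ n * cnj z ^ n = of_real (norm z ^ (2 * n))" for z :: complex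
    by (simp add: power_mult_distrib[symmetric] complex_norm_square[symmetric] power_mult)
  then have "(\<integral>z. z ^ m * cnj z ^ n * of_real (v z) \<partial>disc_area) = (\<integral>z. of_real (norm z ^ (2 * n) * v z) \<partial>disc_area)"
    by (simp add: True)
  also have "\<dots> = of_real (omega n)" unfolding omega_def by (rule integral_complex_of_real)
  finally show ?thesis using True by simp
next
  case False
  then show ?thesis
    using integral_monomials_radial_eq_0[OF False, of "\<lambda>t. exp (- (\<alpha> / (1 - t)))"]
    by (simp add: exp_weight_def)
qed

lemma parseval_finite:
  "(\<integral>\<^sup>+z. ennreal ((norm (\<Sum>n<N. g n * z ^ n))\<^sup>2 * v z) \<partial>disc_area) = ennreal (\<Sum>n<N. (norm (g n))\<^sup>2 * omega n)"
proof -
  let ?P = "\<lambda>z. \<Sum>n<N. g n * z ^ n"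
  have eq: "complex_of_real ((norm (?P z))\<^sup>2 * v z) = (\<Sum>m<N. \<Sum>n<N. (g m * cnj (g n)) * (z ^ m * cnj z ^ n * of_real (v z)))" for z
  proof -
    have "?P z * cnj (?P z) = (\<Sum>m<N. \<Sum>n<N. (g m * z ^ m) * (cnj (g n) * cnj z ^ n))"
      unfolding cnj_sum sum_product by simp
    then show ?thesis unfolding of_real_mult complex_norm_square
      by (simp only: sum_distrib_right) (simp only: mult_ac)
  qed
  have i: "integrable disc_area (\<lambda>z. complex_of_real ((norm (?P z))\<^sup>2 * v z))"
    unfolding eq by (intro Bochner_Integration.integrable_sum integrable_mult_right integrable_monomials_v)
  have i': "integrable disc_area (\<lambda>z. (norm (?P z))\<^sup>2 * v z)"
    using integrable_Re[OF i] by simp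
  have "complex_of_real (\<integral>z. (norm (?P z))\<^sup>2 * v z \<partial>disc_area) = (\<integral>z. complex_of_real ((norm (?P z))\<^sup>2 * v z) \<partial>disc_area)"
    by (rule integral_complex_of_real[symmetric])
  also have "\<dots> = (\<Sum>m<N. \<Sum>n<N. (g m * cnj (g n)) * (\<integral>z. z ^ m * cnj z ^ n * of_real (v z) \<partial>disc_area))"
    unfolding eq
    by (simp add: Bochner_Integration.integral_sum integrable_monomials_v Bochner_Integration.integrable_sum)
  also have "\<dots> = (\<Sum>m<N. g m * cnj (g m) * of_real (omega m))"
    unfolding integral_monomials_v by (simp add: if_distrib[where f="\<lambda>x. _ * x"] sum.delta cong: if_cong)
  also have "\<dots> = complex_of_real (\<Sum>n<N. (norm (g n))\<^sup>2 * omega n)"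
    unfolding of_real_sum of_real_mult complex_norm_square ..
  finally have "(\<integral>z. (norm (?P z))\<^sup>2 * v z \<partial>disc_area) = (\<Sum>n<N. (norm (g n))\<^sup>2 * omega n)"
    using of_real_eq_iff by blast
  then show ?thesis using i'
    by (subst nn_integral_eq_integral) (auto intro!: AE_I2 simp: less_imp_le)
qed

text \<open>Fatou's lemma along the partial sums turns a bound on the coefficient sums into a bound
  on the norm.\<close>

lemma parseval_le:
  assumes G: "\<And>z. norm z < 1 \<Longrightarrow> (\<lambda>n. g n * z ^ n) sums G z"
    and B: "\<And>N. (\<Sum>n<N. (norm (g n))\<^sup>2 * omega n) \<le> B"
  shows "(\<integral>\<^sup>+z. ennreal ((norm (G z))\<^sup>2 * v z) \<partial>disc_area) \<le> ennreal B"
proof -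
  let ?f = "\<lambda>N z. ennreal ((norm (\<Sum>n<N. g n * z ^ n))\<^sup>2 * v z)"
  have "(\<integral>\<^sup>+z. ennreal ((norm (G z))\<^sup>2 * v z) \<partial>disc_area) = (\<integral>\<^sup>+z. liminf (\<lambda>N. ?f N z) \<partial>disc_area)"
  proof (rule nn_integral_cong)
    fix z assume "z \<in> space disc_area"
    then have "(\<lambda>N. ?f N z) \<longlonglongrightarrow> ennreal ((norm (G z))\<^sup>2 * v z)"
      using G[of z] unfolding sums_def by (intro tendsto_intros) auto
    then show "ennreal ((norm (G z))\<^sup>2 * v z) = liminf (\<lambda>N. ?f N z)"
      by (rule lim_imp_Liminf[symmetric, rotated]) simp
  qed
  also have "\<dots> \<le> liminf (\<lambda>N. \<integral>\<^sup>+z. ?f N z \<partial>disc_area)"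
    by (rule nn_integral_liminf) (auto intro!: measurable_disc_areaI)
  also have "\<dots> \<le> ennreal B"
    unfolding parseval_finite by (intro Liminf_le always_eventually allI ennreal_leI B) auto
  finally show ?thesis .
qed

text \<open>An extremal argument: the truncated kernel \<open>f\<close> at \<open>r\<close> has both
  its value at \<open>r\<close> and its squared norm equal to \<open>S\<close>. The submean value
  inequality for \<open>f\<close>, multiplied by the analytic substitute for the square root of the
  weight, bounds a multiple of \<open>S\<^sup>2\<close> by \<open>S\<close>, and one
  \<open>S\<close> cancels. Truncation keeps \<open>S\<close> finite.\<close>

lemma kernel_diag_partial_sum_le:
  assumes r: "1/2 \<le> r" "r < 1"
  shows "(\<Sum>n<N. r ^ (2 * n) / omega n) \<le> 4 * exp (8 * \<alpha>) * exp (\<alpha> / (1 - r)) / (1 - r) ^ 3"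
proof -
  define a where "a = 1 - r"
  define \<delta> where "\<delta> = (1 - r) * sqrt (1 - r) / 2"
  define S where "S = (\<Sum>n<N. r ^ (2 * n) / omega n)"
  define f where "f z = (\<Sum>n<N. complex_of_real (r ^ n / omega n) * z ^ n)" for z
  define F where "F z = f z * exp (- (of_real \<alpha> / (2 * (1 - z))))" for z
  have a: "0 < a" "a \<le> 1/2" using r by (auto simp: a_def)
  have \<delta>2: "\<delta>\<^sup>2 = a ^ 3 / 4" using a by (simp add: \<delta>_def a_def[symmetric] power_mult_distrib power2_eq_square power3_eq_cube)
  have "a * sqrt a \<le> a * 1" using a by (intro mult_left_mono) auto
  moreover have "0 < a * sqrt a" "\<delta> = a * sqrt a / 2" using a by (simp_all add: \<delta>_def a_def)
  ultimately have \<delta>: "0 < \<delta>" "\<delta> < a" using a by linarith+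
  have S0: "S \<ge> 0" unfolding S_def using r omega_pos by (intro sum_nonneg divide_nonneg_pos) auto
  have nz: "1 - z \<noteq> 0" if "norm z < 1" for z :: complex using that by auto
  have inD: "norm z < 1" if "z \<in> ball (of_real r) a" for z :: complex
  proof -
    have "norm z \<le> norm (z - of_real r) + norm (of_real r :: complex)" using norm_triangle_ineq[of "z - of_real r" "of_real r"] by simp
    then show ?thesis using that r by (simp add: dist_norm norm_minus_commute a_def)
  qed
  have hol: "F holomorphic_on ball (of_real r) a"
    unfolding F_def f_def using inD nz by (intro holomorphic_intros) auto
  have "ennreal ((norm (F (of_real r)))\<^sup>2 * \<delta>\<^sup>2) \<le> (\<integral>\<^sup>+z. ennreal ((norm (F z))\<^sup>2) * indicator (ball (of_real r) \<delta>) z \<partial>disc_area)"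
    using \<delta> inD by (intro submean_value_disc[OF hol]) auto
  also have "\<dots> \<le> (\<integral>\<^sup>+z. ennreal (exp (8 * \<alpha>)) * ennreal ((norm (f z))\<^sup>2 * v z) \<partial>disc_area)"
  proof (rule nn_integral_mono)
    fix z :: complex assume "z \<in> space disc_area"
    show "ennreal ((norm (F z))\<^sup>2) * indicator (ball (of_real r) \<delta>) z \<le> ennreal (exp (8 * \<alpha>)) * ennreal ((norm (f z))\<^sup>2 * v z)"
    proof (cases "z \<in> ball (of_real r) \<delta>")
      case True
      then have "1 / (1 - norm z) \<le> Re (1 / (1 - z)) + 8"
        using inverse_one_minus_diff_le[of r z] r by (simp add: \<delta>_def)
      then have "\<alpha> * (1 / (1 - norm z)) \<le> \<alpha> * (Re (1 / (1 - z)) + 8)" using \<alpha> by (intro mult_left_mono) auto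
      then have le: "- (\<alpha> * Re (1 / (1 - z))) \<le> 8 * \<alpha> + - (\<alpha> / (1 - norm z))" by (simp add: algebra_simps)
      have "(norm (F z))\<^sup>2 = (norm (f z))\<^sup>2 * exp (- (\<alpha> * Re (1 / (1 - z))))"
      proof -
        have "of_real \<alpha> / (2 * (1 - z)) = of_real (\<alpha> / 2) * (1 / (1 - z))" by simp
        then have "Re (- (of_real \<alpha> / (2 * (1 - z)))) = - (\<alpha> / 2 * Re (1 / (1 - z)))"
          by (simp only: uminus_complex.sel Re_complex_of_real Im_complex_of_real times_complex.sel)
        then have "norm (exp (- (of_real \<alpha> / (2 * (1 - z))))) = exp (- (\<alpha> / 2 * Re (1 / (1 - z))))"
          by (simp only: norm_exp_eq_Re)
        then show ?thesis by (simp add: F_def norm_mult power_mult_distrib power2_eq_square mult_exp_exp)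
      qed
      also have "\<dots> \<le> (norm (f z))\<^sup>2 * exp (8 * \<alpha> + - (\<alpha> / (1 - norm z)))"
        using le by (intro mult_left_mono) auto
      also have "\<dots> = exp (8 * \<alpha>) * ((norm (f z))\<^sup>2 * v z)" by (simp only: exp_add exp_weight_def mult_ac)
      finally show ?thesis using True by (simp add: ennreal_mult'[symmetric] ennreal_leI)
    qed simp
  qed
  also have "\<dots> = ennreal (exp (8 * \<alpha>)) * (\<integral>\<^sup>+z. ennreal ((norm (f z))\<^sup>2 * v z) \<partial>disc_area)"
    by (rule nn_integral_cmult) (auto intro!: measurable_disc_areaI simp: f_def)
  also have "\<dots> = ennreal (exp (8 * \<alpha>)) * ennreal S"
  proof -
    have "(norm (complex_of_real (r ^ n / omega n)))\<^sup>2 * omega n = r ^ (2 * n) / omega n" for n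
    proof -
      have "(r ^ n / omega n)\<^sup>2 * omega n = r ^ (2 * n) / omega n"
        using omega_pos[of n] by (simp add: power2_eq_square power_mult power_mult_distrib field_simps)
      then show ?thesis by (simp only: norm_of_real power2_abs)
    qed
    then show ?thesis unfolding f_def parseval_finite S_def by simp
  qed
  finally have "(norm (F (of_real r)))\<^sup>2 * \<delta>\<^sup>2 \<le> exp (8 * \<alpha>) * S"
    using S0 by (simp add: ennreal_mult'[symmetric])
  moreover have "(norm (F (of_real r)))\<^sup>2 = S\<^sup>2 * exp (- (\<alpha> / a))"
  proof -
    have "f (of_real r) = of_real S" by (simp add: f_def S_def power_mult power2_eq_square power_mult_distrib)
    moreover have "exp (- (of_real \<alpha> / (2 * (1 - of_real r))) :: complex) = of_real (exp (- (\<alpha> / (2 * a))))"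
      by (simp add: a_def exp_of_real[symmetric])
    ultimately have "norm (F (of_real r)) = S * exp (- (\<alpha> / (2 * a)))"
      using S0 by (simp add: F_def norm_mult)
    moreover have "- (\<alpha> / (2 * a)) + - (\<alpha> / (2 * a)) = - (\<alpha> / a)" using a by (simp add: field_simps)
    ultimately show ?thesis by (simp add: power_mult_distrib power2_eq_square mult_exp_exp)
  qed
  ultimately have "S\<^sup>2 * exp (- (\<alpha> / a)) * (a ^ 3 / 4) \<le> exp (8 * \<alpha>) * S"
    unfolding \<delta>2 by (simp only:)
  then have "S * (S * (exp (- (\<alpha> / a)) * (a ^ 3 / 4))) \<le> S * exp (8 * \<alpha>)"
    by (simp only: power2_eq_square mult_ac)
  then have "S * (exp (- (\<alpha> / a)) * (a ^ 3 / 4)) \<le> exp (8 * \<alpha>)"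
  proof (cases "S = 0")
    case False
    then show ?thesis using S0 \<open>S * _ \<le> S * _\<close> by (simp only: mult_le_cancel_left_pos)
  qed simp
  moreover have "S \<le> 4 * M * y / k" if "S * (x * (k / 4)) \<le> M" "x * y = 1" "y > 0" "k > 0" for x y k M :: real
  proof -
    have "S * k = S * (x * (k / 4)) * (4 * y)" using that(2) by algebra
    also have "\<dots> \<le> M * (4 * y)" using that by (intro mult_right_mono) auto
    finally show ?thesis using that(4) by (simp add: pos_le_divide_eq mult_ac)
  qed
  ultimately show ?thesis using a unfolding S_def[symmetric] a_def[symmetric]
    by (simp add: exp_minus)
qed

lemma kernel_diag_bound:
  "\<exists>C>0. \<forall>r. 0 < r \<and> r < 1 \<longrightarrow> summable (\<lambda>n. r ^ (2 * n) / omega n) \<and>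
     (\<Sum>n. r ^ (2 * n) / omega n) \<le> C * exp (\<alpha> / (1 - r)) / (1 - r) ^ 3"
proof -
  \<comment> \<open>The extra factor \<open>8 * exp (2 * \<alpha>)\<close> is the value of
    \<open>exp (\<alpha> / (1 - r)) / (1 - r) ^ 3\<close> at \<open>r = 1/2\<close>; it covers
    smaller \<open>r\<close>, since the series increases with \<open>r\<close>.\<close>
  define C where "C = 4 * exp (8 * \<alpha>) * (8 * exp (2 * \<alpha>))"
  have *: "(\<Sum>n<N. r ^ (2 * n) / omega n) \<le> C * exp (\<alpha> / (1 - r)) / (1 - r) ^ 3" if r: "0 < r" "r < 1" for r N
  proof (cases "1/2 \<le> r")
    case True
    have "(\<Sum>n<N. r ^ (2 * n) / omega n) \<le> 4 * exp (8 * \<alpha>) * exp (\<alpha> / (1 - r)) / (1 - r) ^ 3"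
      by (rule kernel_diag_partial_sum_le) (use True r in auto)
    also have "\<dots> \<le> C * exp (\<alpha> / (1 - r)) / (1 - r) ^ 3"
    proof (intro divide_right_mono mult_right_mono)
      have "1 \<le> 8 * exp (2 * \<alpha>)" using one_le_exp_iff[of "2 * \<alpha>"] \<alpha> by linarith
      then show "4 * exp (8 * \<alpha>) \<le> C" unfolding C_def by simp
    qed (use r in auto)
    finally show ?thesis .
  next
    case False
    have "(\<Sum>n<N. r ^ (2 * n) / omega n) \<le> (\<Sum>n<N. (1/2) ^ (2 * n) / omega n)"
      using False r omega_pos by (intro sum_mono divide_right_mono power_mono) (auto simp: less_imp_le)
    also have "\<dots> \<le> 4 * exp (8 * \<alpha>) * exp (\<alpha> / (1 - 1/2)) / (1 - 1/2) ^ 3"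
      by (rule kernel_diag_partial_sum_le) auto
    also have "\<dots> = C * 1 / 1" by (simp add: C_def mult.commute power3_eq_cube)
    also have "\<dots> \<le> C * exp (\<alpha> / (1 - r)) / (1 - r) ^ 3"
    proof (intro frac_le mult_left_mono)
      show "(1 - r) ^ 3 \<le> 1" using r by (simp add: power_le_one)
    qed (use r \<alpha> in \<open>auto simp: C_def\<close>)
    finally show ?thesis .
  qed
  have nn: "0 \<le> r ^ (2 * n) / omega n" for r n using omega_pos[of n] by simp
  have "summable (\<lambda>n. r ^ (2 * n) / omega n) \<and> (\<Sum>n. r ^ (2 * n) / omega n) \<le> C * exp (\<alpha> / (1 - r)) / (1 - r) ^ 3"
    if "0 < r" "r < 1" for r
  proof
    show "summable (\<lambda>n. r ^ (2 * n) / omega n)"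
      by (rule summableI_nonneg_bounded[OF nn *[OF that]])
    then show "(\<Sum>n. r ^ (2 * n) / omega n) \<le> C * exp (\<alpha> / (1 - r)) / (1 - r) ^ 3"
      by (rule suminf_le_const) (rule *[OF that])
  qed
  then show ?thesis by (intro exI[of _ C]) (auto simp: C_def)
qed

lemma summable_kernel_diag: "0 < r \<Longrightarrow> r < 1 \<Longrightarrow> summable (\<lambda>n. r ^ (2 * n) / omega n)"
  using kernel_diag_bound by blast

text \<open>This is the diagonal series at \<open>sqrt r\<close>. It supplies the majorants for the
  expansions of the kernel and of the projection.\<close>

lemma summable_power_omega:
  assumes "0 \<le> r" "r < 1"
  shows "summable (\<lambda>n. r ^ n / omega n)"
proof (cases "r = 0")
  case True
  then have "(\<lambda>n. r ^ n / omega n) = (\<lambda>n. if n = 0 then 1 / omega n else 0)" by (auto simp: power_0_left)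
  then show ?thesis by (simp only: summable_single)
next
  case False
  have "(sqrt r) ^ (2 * n) = r ^ n" for n using assms by (simp add: power_mult)
  then show ?thesis using summable_kernel_diag[of "sqrt r"] False assms by simp
qed

section \<open>Ratios of consecutive moments\<close>

text \<open>The value \<open>0\<close> at \<open>n = 0\<close> removes the boundary term of the
  shift identity and lets the formula for the twisted second differences hold at the lowest indices
  too.\<close>

definition ratio :: "nat \<Rightarrow> real" where "ratio n = (if n = 0 then 0 else omega n / omega (n - 1))"

lemma ratio_Suc: "ratio (Suc n) = omega (Suc n) / omega n" by (simp add: ratio_def)

lemma ratio_mono: "ratio n \<le> ratio (Suc n)"
proof (cases n)
  case 0 then show ?thesis using omega_pos by (simp add: ratio_def less_imp_le)
next
  case (Suc m)
  have "omega (Suc m) * omega (Suc m) \<le> omega (Suc (Suc m)) * omega m"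
    using omega_log_convex[of m] by (simp add: power2_eq_square)
  then show ?thesis using omega_pos[of m] omega_pos[of "Suc m"] by (simp add: Suc ratio_Suc field_simps)
qed

lemma weight_ratios_omega:
  "\<exists>\<kappa> C. weight_ratios ratio (\<lambda>r n. r ^ (2 * n) / omega n) (\<lambda>n. 1 / omega n) \<kappa> C"
proof -
  obtain c where c: "c > 0" "\<And>n. c / sqrt (real n + 1) \<le> 1 - omega (n + 1) / omega n"
    using omega_ratio_gap by blast
  obtain C where C: "C > 0" "\<And>n. omega (n + 2) / omega n - (omega (n + 1) / omega n)\<^sup>2 \<le> C / sqrt (real n + 1) ^ 3"
    using omega_variance by blast
  have q1: "ratio 1 > 0" using omega_pos by (simp add: ratio_def)
  have q_ge: "ratio 1 \<le> ratio (Suc n)" for n by (induction n) (use ratio_mono order_trans in auto)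
  \<comment> \<open>The \<open>1\<close> serves \<open>n = 0\<close>, where
    \<open>1 - ratio 0 = 1\<close>.\<close>
  define \<kappa> where "\<kappa> = min c 1"
  \<comment> \<open>The summand \<open>1\<close> serves \<open>n = 0\<close>. For
    \<open>n = Suc m\<close> the denominator comes from \<open>ratio n \<ge> ratio 1\<close>, and
    \<open>8 = 2 ^ 3\<close> from \<open>sqrt (n + 1) \<le> 2 * sqrt (m + 1)\<close>.\<close>
  define C1 where "C1 = 1 + 8 * C / ratio 1"
  have C1: "C1 > 0" "1 \<le> C1" "8 * C / ratio 1 \<le> C1" using C(1) q1 by (auto simp: C1_def add_pos_pos)
  have "weight_ratios ratio (\<lambda>r n. r ^ (2 * n) / omega n) (\<lambda>n. 1 / omega n) \<kappa> C1"
  proof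
    show "ratio 0 = 0" by (simp add: ratio_def)
    show "ratio n \<le> ratio (Suc n)" for n by (rule ratio_mono)
    show ql: "ratio n \<le> 1" for n using omega_antimono[of "n - 1"] omega_pos[of "n - 1"] by (cases n) (auto simp: ratio_def)
    show "\<kappa> > 0" using c by (simp add: \<kappa>_def)
    show "\<kappa> / sqrt (real n + 1) \<le> 1 - ratio n" for n
    proof (cases n)
      case 0 then show ?thesis by (simp add: \<kappa>_def ratio_def)
    next
      case (Suc m)
      have "\<kappa> / sqrt (real n + 1) \<le> c / sqrt (real m + 1)" using c Suc by (intro frac_le) (auto simp: \<kappa>_def)
      also have "\<dots> \<le> 1 - ratio n" using c(2)[of m] by (simp add: Suc ratio_Suc)
      finally show ?thesis .
    qed
    show "C1 > 0" by fact
    show "ratio (Suc n) - ratio n \<le> C1 / sqrt (real n + 1) ^ 3" for n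
    proof (cases n)
      case 0 then show ?thesis using ql[of 1] C1 by (simp add: ratio_def)
    next
      case (Suc m)
      \<comment> \<open>An increment of the ratios is the variance of \<open>t\<^sup>2\<close> for
        the index \<open>m\<close>, divided by the mean \<open>ratio n\<close>.\<close>
      have "(ratio (Suc n) - ratio n) * ratio n = omega (m + 2) / omega m - (omega (m + 1) / omega m)\<^sup>2"
        using omega_pos[of m] omega_pos[of "Suc m"] by (simp add: Suc ratio_Suc field_simps power2_eq_square)
      also have "\<dots> \<le> C / sqrt (real m + 1) ^ 3" by (rule C(2))
      finally have le: "(ratio (Suc n) - ratio n) * ratio n \<le> C / sqrt (real m + 1) ^ 3" .
      have "(ratio (Suc n) - ratio n) * ratio 1 \<le> (ratio (Suc n) - ratio n) * ratio n"
        using ratio_mono[of n] q_ge[of m] Suc by (intro mult_left_mono) auto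
      also note le
      also have "C / sqrt (real m + 1) ^ 3 \<le> C / (sqrt (real n + 1) / 2) ^ 3"
      proof (intro divide_left_mono power_mono)
        have "real n + 1 \<le> 4 * (real m + 1)" using Suc by simp
        then have "sqrt (real n + 1) \<le> sqrt (4 * (real m + 1))" by (rule real_sqrt_le_mono)
        then have "sqrt (real n + 1) \<le> 2 * sqrt (real m + 1)" by (simp only: real_sqrt_mult real_sqrt_four)
        then show "sqrt (real n + 1) / 2 \<le> sqrt (real m + 1)" by simp
      qed (use C in \<open>auto simp: less_imp_le\<close>)
      also have "\<dots> = 8 * C / sqrt (real n + 1) ^ 3" by (simp add: power_divide power3_eq_cube)
      finally have "ratio (Suc n) - ratio n \<le> 8 * C / sqrt (real n + 1) ^ 3 / ratio 1"
        by (simp only: pos_le_divide_eq[OF q1])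
      also have "\<dots> = (8 * C / ratio 1) / sqrt (real n + 1) ^ 3" by simp
      also have "\<dots> \<le> C1 / sqrt (real n + 1) ^ 3" using C1 by (intro divide_right_mono) auto
      finally show ?thesis .
    qed
    fix r :: real and n assume r: "0 < r" "r < 1"
    show "r ^ (2 * n) / omega n > 0" using r omega_pos by simp
    show "r ^ (2 * Suc n) / omega (Suc n) * ratio (Suc n) = r\<^sup>2 * (r ^ (2 * n) / omega n)"
      using omega_pos[of n] omega_pos[of "Suc n"] by (simp add: ratio_Suc field_simps power2_eq_square)
    show "r ^ (2 * n) / omega n \<le> 1 / omega n"
      using r omega_pos[of n] by (intro divide_right_mono) (auto simp: power_le_one)
    show "summable (\<lambda>n. r ^ (2 * n) / omega n)" by (rule summable_kernel_diag[OF r])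
  qed
  then show ?thesis by blast
qed

text \<open>\<open>x \<le> exp x\<close> at \<open>x = \<alpha> / (3 * a)\<close>, cubed. It lets an
  additive constant be absorbed into a multiple of
  \<open>a ^ 3 * exp (\<alpha> / a)\<close>.\<close>

lemma cube_exp_ge:
  assumes a: "0 < a"
  shows "(\<alpha> / 3) ^ 3 \<le> a ^ 3 * exp (\<alpha> / a)"
proof -
  have "\<alpha> / (3 * a) \<le> exp (\<alpha> / (3 * a))" using exp_ge_add_one_self[of "\<alpha> / (3 * a)"] by linarith
  then have "(a * (\<alpha> / (3 * a))) ^ 3 \<le> (a * exp (\<alpha> / (3 * a))) ^ 3" using a \<alpha> by (intro power_mono mult_left_mono) auto
  then show ?thesis using a by (simp add: power_mult_distrib exp_of_nat_mult[symmetric])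
qed

text \<open>The squared difference is at most \<open>2 * (ratio n - r\<^sup>2) ^ 4\<close> plus a
  multiple of \<open>e n ^ 6\<close>. The fourth moment estimate bounds the sum by
  \<open>(1 - r) ^ 6\<close> times the diagonal series, up to constants; the diagonal bound divides
  by \<open>(1 - r) ^ 3\<close>, and a cube survives.\<close>

lemma kernel_second_difference_sum:
  "\<exists>C>0. \<forall>r. 0 < r \<and> r < 1 \<longrightarrow> (\<forall>N. (\<Sum>n<N. (r ^ (2 * n) / omega n) * ((ratio n - r\<^sup>2)\<^sup>2 - ratio n * (ratio n - ratio (n - 1)))\<^sup>2)
     \<le> C * ((1 - r) ^ 3 * exp (\<alpha> / (1 - r))))"
proof -
  obtain \<kappa> C1 where "weight_ratios ratio (\<lambda>r n. r ^ (2 * n) / omega n) (\<lambda>n. 1 / omega n) \<kappa> C1"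
    using weight_ratios_omega by blast
  then interpret W: weight_ratios ratio "\<lambda>r n. r ^ (2 * n) / omega n" "\<lambda>n. 1 / omega n" \<kappa> C1 .
  obtain A where A0: "A > 0 \<and> (\<forall>r. 0 < r \<and> r < 1 \<longrightarrow> summable (\<lambda>n. (r ^ (2 * n) / omega n) * ((ratio n - r\<^sup>2) ^ 4 + W.e n ^ 6)) \<and>
    (\<Sum>n. (r ^ (2 * n) / omega n) * ((ratio n - r\<^sup>2) ^ 4 + W.e n ^ 6)) \<le> A * ((1 - r) ^ 6 * (\<Sum>n. r ^ (2 * n) / omega n) + 1))"
    using W.fourth_moment ..
  have A: "A > 0" "\<And>r. 0 < r \<Longrightarrow> r < 1 \<Longrightarrow> summable (\<lambda>n. (r ^ (2 * n) / omega n) * ((ratio n - r\<^sup>2) ^ 4 + W.e n ^ 6))"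
    "\<And>r. 0 < r \<Longrightarrow> r < 1 \<Longrightarrow> (\<Sum>n. (r ^ (2 * n) / omega n) * ((ratio n - r\<^sup>2) ^ 4 + W.e n ^ 6)) \<le> A * ((1 - r) ^ 6 * (\<Sum>n. r ^ (2 * n) / omega n) + 1)"
    using A0 by simp_all
  obtain B where B: "B > 0" "\<And>r. 0 < r \<Longrightarrow> r < 1 \<Longrightarrow> (\<Sum>n. r ^ (2 * n) / omega n) \<le> B * exp (\<alpha> / (1 - r)) / (1 - r) ^ 3"
    using kernel_diag_bound by blast
  define E where "E = 2 + 128 * C1\<^sup>2"
  \<comment> \<open>At \<open>n = 0\<close> the predecessor is again \<open>0\<close> and the
    difference vanishes. For \<open>n = Suc m\<close> the factor \<open>64\<close> is the square of
    \<open>2 ^ 3\<close>, from \<open>e m \<le> 2 * e n\<close>.\<close>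
  have diff: "(ratio n - ratio (n - 1))\<^sup>2 \<le> 64 * C1\<^sup>2 * W.e n ^ 6" for n
  proof (cases n)
    case 0
    have "0 \<le> 64 * C1\<^sup>2 * W.e 0 ^ 6" using W.e_pos[of 0] by simp
    then show ?thesis using 0 by simp
  next
    case (Suc m)
    have "sqrt (real n + 1) \<le> sqrt (4 * (real m + 1))" using Suc by (intro real_sqrt_le_mono) simp
    then have "sqrt (real n + 1) \<le> 2 * sqrt (real m + 1)" by (simp only: real_sqrt_mult real_sqrt_four)
    then have em: "W.e m \<le> 2 * W.e n" unfolding W.e_def by (simp add: field_simps)
    have "ratio n - ratio (n - 1) \<le> C1 / sqrt (real m + 1) ^ 3" using W.step[of m] Suc by simp
    also have "\<dots> = C1 * W.e m ^ 3" by (simp add: W.e_def power_divide)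
    also have "\<dots> \<le> C1 * (2 * W.e n) ^ 3"
      using W.C1 em W.e_pos[of m] by (intro mult_left_mono power_mono) (auto simp: less_imp_le)
    finally have "(ratio n - ratio (n - 1))\<^sup>2 \<le> (C1 * (2 * W.e n) ^ 3)\<^sup>2"
      using ratio_mono[of m] Suc by (intro power_mono) auto
    also have "\<dots> = 64 * C1\<^sup>2 * W.e n ^ 6" by (simp add: power_mult_distrib power_mult[symmetric])
    finally show ?thesis .
  qed
  have q01: "0 \<le> ratio n" "ratio n \<le> 1" for n
    using omega_pos[of n] omega_pos[of "n - 1"] W.q_le[of n] by (auto simp: ratio_def)
  have pt: "((ratio n - r\<^sup>2)\<^sup>2 - ratio n * (ratio n - ratio (n - 1)))\<^sup>2 \<le> E * ((ratio n - r\<^sup>2) ^ 4 + W.e n ^ 6)" for n r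
  proof -
    have "((ratio n - r\<^sup>2)\<^sup>2 - ratio n * (ratio n - ratio (n - 1)))\<^sup>2 \<le> 2 * ((ratio n - r\<^sup>2)\<^sup>2)\<^sup>2 + 2 * (ratio n * (ratio n - ratio (n - 1)))\<^sup>2"
      using zero_le_power2[of "(ratio n - r\<^sup>2)\<^sup>2 + ratio n * (ratio n - ratio (n - 1))"] by (simp add: power2_eq_square algebra_simps)
    also have "(ratio n * (ratio n - ratio (n - 1)))\<^sup>2 \<le> (ratio n - ratio (n - 1))\<^sup>2"
      unfolding power_mult_distrib using q01[of n] by (intro mult_left_le_one_le) (auto simp: power_le_one)
    also note diff
    also have "2 * ((ratio n - r\<^sup>2)\<^sup>2)\<^sup>2 + 2 * (64 * C1\<^sup>2 * W.e n ^ 6) \<le> E * ((ratio n - r\<^sup>2) ^ 4 + W.e n ^ 6)"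
    proof -
      have "0 \<le> C1\<^sup>2 * (ratio n - r\<^sup>2) ^ 4" "0 \<le> W.e n ^ 6" using W.e_pos[of n] by (auto simp: less_imp_le)
      then show ?thesis by (simp add: E_def algebra_simps power_mult[symmetric])
    qed
    finally show ?thesis by simp
  qed
  have E: "E > 0" by (simp add: E_def add_pos_nonneg)
  define C where "C = E * A * (B + 27 / \<alpha> ^ 3)"
  have "(\<Sum>n<N. (r ^ (2 * n) / omega n) * ((ratio n - r\<^sup>2)\<^sup>2 - ratio n * (ratio n - ratio (n - 1)))\<^sup>2) \<le> C * ((1 - r) ^ 3 * exp (\<alpha> / (1 - r)))"
    if r: "0 < r" "r < 1" for r N
  proof -
    let ?p = "\<lambda>n. r ^ (2 * n) / omega n"
    have p0: "0 \<le> ?p n" for n using omega_pos[of n] by simp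
    have "(\<Sum>n<N. ?p n * ((ratio n - r\<^sup>2)\<^sup>2 - ratio n * (ratio n - ratio (n - 1)))\<^sup>2) \<le> (\<Sum>n<N. E * (?p n * ((ratio n - r\<^sup>2) ^ 4 + W.e n ^ 6)))"
    proof (rule sum_mono)
      fix n
      show "?p n * ((ratio n - r\<^sup>2)\<^sup>2 - ratio n * (ratio n - ratio (n - 1)))\<^sup>2 \<le> E * (?p n * ((ratio n - r\<^sup>2) ^ 4 + W.e n ^ 6))"
        using mult_left_mono[OF pt[of n r] p0[of n]] by (simp only: mult_ac)
    qed
    also have "\<dots> = E * (\<Sum>n<N. ?p n * ((ratio n - r\<^sup>2) ^ 4 + W.e n ^ 6))" by (simp add: sum_distrib_left)
    also have "\<dots> \<le> E * (\<Sum>n. ?p n * ((ratio n - r\<^sup>2) ^ 4 + W.e n ^ 6))"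
    proof (intro mult_left_mono sum_le_suminf A(2)[OF r])
      show "0 \<le> ?p n * ((ratio n - r\<^sup>2) ^ 4 + W.e n ^ 6)" for n
        by (intro mult_nonneg_nonneg p0 add_nonneg_nonneg) auto
    qed (use E in auto)
    also have "\<dots> \<le> E * (A * ((1 - r) ^ 6 * (\<Sum>n. ?p n) + 1))"
      using E A(3)[OF r] by (intro mult_left_mono) auto
    also have "\<dots> \<le> E * (A * ((1 - r) ^ 6 * (B * exp (\<alpha> / (1 - r)) / (1 - r) ^ 3) + 27 / \<alpha> ^ 3 * ((1 - r) ^ 3 * exp (\<alpha> / (1 - r)))))"
    proof (intro mult_left_mono add_mono)
      have "27 / \<alpha> ^ 3 * (\<alpha> / 3) ^ 3 \<le> 27 / \<alpha> ^ 3 * ((1 - r) ^ 3 * exp (\<alpha> / (1 - r)))"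
        using r \<alpha> by (intro mult_left_mono cube_exp_ge) auto
      then show "1 \<le> 27 / \<alpha> ^ 3 * ((1 - r) ^ 3 * exp (\<alpha> / (1 - r)))" using \<alpha> by (simp add: power_divide)
    qed (use E A(1) B r in auto)
    also have "(1 - r) ^ 6 * (B * exp (\<alpha> / (1 - r)) / (1 - r) ^ 3) = B * ((1 - r) ^ 3 * exp (\<alpha> / (1 - r)))"
    proof -
      have *: "X6 * (b / X3) = X3 * b" if "X6 = X3 * X3" "X3 \<noteq> 0" for X6 X3 b :: real using that by simp
      have "(1 - r) ^ 6 * (B * exp (\<alpha> / (1 - r)) / (1 - r) ^ 3) = (1 - r) ^ 3 * (B * exp (\<alpha> / (1 - r)))"
        by (rule *) (use r in \<open>simp_all add: power_add[symmetric]\<close>)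
      then show ?thesis by simp
    qed
    also have "E * (A * (B * ((1 - r) ^ 3 * exp (\<alpha> / (1 - r))) + 27 / \<alpha> ^ 3 * ((1 - r) ^ 3 * exp (\<alpha> / (1 - r))))) = C * ((1 - r) ^ 3 * exp (\<alpha> / (1 - r)))"
    proof -
      have *: "E' * (A' * (B' * x + K * x)) = E' * A' * (B' + K) * x" for E' A' B' K x :: real by algebra
      show ?thesis unfolding C_def by (rule *)
    qed
    finally show ?thesis .
  qed
  moreover have "C > 0" unfolding C_def using E A(1) B(1) \<alpha> by (intro mult_pos_pos add_pos_pos) auto
  ultimately show ?thesis by (intro exI[of _ C] conjI allI impI) auto
qed

end

subsection \<open>The kernel estimate\<close>

lemma sums_shift_power:
  fixes b :: "nat \<Rightarrow> complex"
  assumes "(\<lambda>n. b n * z ^ n) sums S"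
  shows "(\<lambda>n. (case n of 0 \<Rightarrow> 0 | Suc m \<Rightarrow> b m) * z ^ n) sums (z * S)"
proof -
  have "(\<lambda>n. z * (b n * z ^ n)) sums (z * S)" using assms by (rule sums_mult)
  then have "(\<lambda>n. (\<lambda>n. (case n of 0 \<Rightarrow> 0 | Suc m \<Rightarrow> b m) * z ^ n) (Suc n)) sums (z * S)" by (simp add: mult_ac)
  from sums_Suc[OF this] show ?thesis by simp
qed

text \<open>Enlarging the domain to the disc of radius \<open>2\<close> about \<open>z\<close> makes
  the integral radial and its bound independent of \<open>z\<close>;
  \<open>- (d\<^sup>2 / (d + t\<^sup>2))\<close> is an antiderivative of
  \<open>2 * t * d\<^sup>2 / (d + t\<^sup>2)\<^sup>2\<close>.\<close>

lemma nn_integral_bump_le: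
  assumes d: "d > 0" and z: "norm z < 1"
  shows "(\<integral>\<^sup>+\<zeta>. ennreal (d\<^sup>2 / (d + (norm (\<zeta> - z))\<^sup>2)\<^sup>2) \<partial>disc_area) \<le> ennreal d"
proof -
  let ?f = "\<lambda>t. ennreal (d\<^sup>2 / (d + t\<^sup>2)\<^sup>2)"
  let ?H = "\<lambda>w. ?f (norm (w - z)) * indicator (ball z 2) w"
  have "(\<integral>\<^sup>+\<zeta>. ?f (norm (\<zeta> - z)) \<partial>disc_area) = ennreal (1/pi) * (\<integral>\<^sup>+\<zeta>. ?f (norm (\<zeta> - z)) * indicator unit_disc \<zeta> \<partial>lborel)"
    by (rule nn_integral_disc_area) (auto intro!: measurable_disc_areaI)
  also have "\<dots> \<le> ennreal (1/pi) * (\<integral>\<^sup>+\<zeta>. ?H \<zeta> \<partial>lborel)"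
  proof (rule mult_left_mono[OF nn_integral_mono])
    fix \<zeta>
    have "norm (\<zeta> - z) < 2" if "norm \<zeta> < 1" using norm_triangle_ineq4[of \<zeta> z] that z by linarith
    then show "?f (norm (\<zeta> - z)) * indicator unit_disc \<zeta> \<le> ?H \<zeta>"
      by (auto simp: dist_norm norm_minus_commute split: split_indicator)
  qed simp
  also have "(\<integral>\<^sup>+\<zeta>. ?H \<zeta> \<partial>lborel) = (\<integral>\<^sup>+w. ?H (z + 1 *\<^sub>R w) \<partial>lborel)"
  proof -
    have "?H \<in> borel_measurable borel"
      by (rule borel_measurable_times_ennreal[OF _ borel_measurable_indicator]) auto
    from nn_integral_lborel_affine[OF this, of 1 z] show ?thesis by simp
  qed
  also have "\<dots> = (\<integral>\<^sup>+w. ?f (norm w) * indicator (ball (0::complex) 2) w \<partial>lborel)"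
    by (rule nn_integral_cong) (auto simp: dist_norm split: split_indicator)
  also have "\<dots> = (\<integral>\<^sup>+t. ennreal (2 * pi * t) * ?f t * indicator {0<..<2} t \<partial>lborel)"
    by (rule nn_integral_norm_ball) auto
  also have "\<dots> \<le> (\<integral>\<^sup>+t. ennreal (2 * pi * t * (d\<^sup>2 / (d + t\<^sup>2)\<^sup>2)) * indicator {0..2} t \<partial>lborel)"
    by (intro nn_integral_mono) (auto simp: ennreal_mult'[symmetric] split: split_indicator)
  also have "\<dots> = ennreal (- (pi * d\<^sup>2 / (d + 2\<^sup>2)) - - (pi * d\<^sup>2 / (d + 0\<^sup>2)))"
  proof (rule nn_integral_FTC_Icc)
    fix t :: real assume t: "t \<in> {0..2}"
    have dt: "d + t\<^sup>2 > 0" using d by (simp add: add_pos_nonneg)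
    show "((\<lambda>t. - (pi * d\<^sup>2 / (d + t\<^sup>2))) has_real_derivative 2 * pi * t * (d\<^sup>2 / (d + t\<^sup>2)\<^sup>2)) (at t)"
      using dt by (auto intro!: derivative_eq_intros simp: power2_eq_square)
    show "0 \<le> 2 * pi * t * (d\<^sup>2 / (d + t\<^sup>2)\<^sup>2)" using t by simp
  qed auto
  also have "\<dots> \<le> ennreal (pi * d)"
  proof (rule ennreal_leI)
    have "0 \<le> pi * d\<^sup>2 / (d + 2\<^sup>2)" using d by simp
    moreover have "pi * d\<^sup>2 / (d + 0\<^sup>2) = pi * d" using d by (simp add: power2_eq_square)
    ultimately show "- (pi * d\<^sup>2 / (d + 2\<^sup>2)) - - (pi * d\<^sup>2 / (d + 0\<^sup>2)) \<le> pi * d" by linarith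
  qed
  finally have "(\<integral>\<^sup>+\<zeta>. ?f (norm (\<zeta> - z)) \<partial>disc_area) \<le> ennreal (1/pi) * ennreal (pi * d)"
    by (simp add: mult_left_mono)
  also have "\<dots> = ennreal d" using d by (simp add: ennreal_mult'[symmetric])
  finally show ?thesis .
qed

context exp_disc
begin

text \<open>The series converges for \<open>norm (z * w) < 1\<close>. As a formula on the whole
  plane it is jointly Borel measurable, which the exchange of integrals for the projection relies
  on.\<close>

definition ker :: "complex \<Rightarrow> complex \<Rightarrow> complex" where
  "ker z w = (\<Sum>n. (z * cnj w) ^ n / of_real (omega n))"

lemma ker_measurable [measurable]: "(\<lambda>x. ker (fst x) (snd x)) \<in> borel_measurable (borel \<Otimes>\<^sub>M borel)"
  unfolding ker_def by measurable

lemma ker_measurable' [measurable (raw)]: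
  "f \<in> borel_measurable M \<Longrightarrow> g \<in> borel_measurable M \<Longrightarrow> (\<lambda>x. ker (f x) (g x)) \<in> borel_measurable M"
  using measurable_compose[OF measurable_Pair ker_measurable, of f M g] by simp

lemma ker_summable:
  assumes "norm (z * w) < 1"
  shows "summable (\<lambda>n. norm ((z * cnj w) ^ n / of_real (omega n)))"
proof -
  have "summable (\<lambda>n. norm (z * w) ^ n / omega n)" by (rule summable_power_omega) (use assms in auto)
  moreover have "norm ((z * cnj w) ^ n / of_real (omega n)) = norm (z * w) ^ n / omega n" for n
    using omega_pos[of n] by (simp add: norm_divide norm_power norm_mult power_mult_distrib)
  ultimately show ?thesis by simp
qed

lemma norm_mult_less_1: "norm (z::complex) < 1 \<Longrightarrow> norm (w::complex) < 1 \<Longrightarrow> norm (z * w) < 1"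
  unfolding norm_mult using mult_strict_mono[of "norm z" 1 "norm w" 1] by simp

lemma ker_sums:
  assumes "norm z < 1" "norm w < 1"
  shows "(\<lambda>n. (cnj w ^ n / of_real (omega n)) * z ^ n) sums ker z w"
  using summable_sums[OF summable_norm_cancel[OF ker_summable[of z w]]] norm_mult_less_1[OF assms]
  by (simp add: ker_def power_mult_distrib mult_ac)

lemma ker_cnj:
  assumes "norm z < 1" "norm w < 1"
  shows "cnj (ker z w) = ker w z"
proof -
  have "(\<lambda>n. cnj ((cnj w ^ n / of_real (omega n)) * z ^ n)) sums cnj (ker z w)"
    using ker_sums[OF assms] by (simp only: sums_cnj)
  also have "(\<lambda>n. cnj ((cnj w ^ n / of_real (omega n)) * z ^ n)) = (\<lambda>n. (cnj z ^ n / of_real (omega n)) * w ^ n)"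
    by (simp add: mult_ac)
  finally show ?thesis using ker_sums[OF assms(2,1)] sums_unique2 by blast
qed

lemma ker_norm_commute: "norm z < 1 \<Longrightarrow> norm w < 1 \<Longrightarrow> norm (ker z w) = norm (ker w z)"
  by (metis ker_cnj complex_mod_cnj)

text \<open>The bound does not depend on \<open>z\<close>, so the kernel with \<open>w\<close> fixed
  is a bounded function on the disc.\<close>

lemma norm_ker_le:
  assumes "norm z < 1" "norm w < 1"
  shows "norm (ker z w) \<le> (\<Sum>n. norm w ^ n / omega n)"
proof -
  have sm: "summable (\<lambda>n. norm w ^ n / omega n)" using assms by (intro summable_power_omega) auto
  have le: "norm ((z * cnj w) ^ n / of_real (omega n)) \<le> norm w ^ n / omega n" for n
  proof -
    have "norm ((z * cnj w) ^ n / of_real (omega n)) = norm z ^ n * norm w ^ n / omega n"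
      using omega_pos[of n] by (simp add: norm_divide norm_power norm_mult power_mult_distrib)
    also have "\<dots> \<le> 1 * norm w ^ n / omega n" using omega_pos[of n] assms
      by (intro divide_right_mono mult_right_mono) (auto simp: power_le_one)
    finally show ?thesis by simp
  qed
  show ?thesis unfolding ker_def
    by (rule order_trans[OF summable_norm[OF ker_summable] suminf_le[OF le ker_summable sm]]) (use norm_mult_less_1[OF assms] in auto)
qed

lemma ker_holomorphic: "norm w < 1 \<Longrightarrow> (\<lambda>z. ker z w) holomorphic_on unit_disc"
  by (rule power_series_holomorphic[where a="\<lambda>n. cnj w ^ n / of_real (omega n)"]) (use ker_sums in auto)

text \<open>The Parseval sum of the coefficients \<open>cnj z ^ n / omega n\<close> is the diagonal
  series at \<open>norm z\<close>.\<close>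

lemma ker_L2:
  "\<exists>C>0. \<forall>z. z \<noteq> 0 \<and> norm z < 1 \<longrightarrow> (\<integral>\<^sup>+\<zeta>. ennreal ((norm (ker \<zeta> z))\<^sup>2 * v \<zeta>) \<partial>disc_area)
     \<le> ennreal (C * exp (\<alpha> / (1 - norm z)) / (1 - norm z) ^ 3)"
proof -
  obtain C where C: "C > 0" "\<And>r. 0 < r \<Longrightarrow> r < 1 \<Longrightarrow> (\<Sum>n. r ^ (2 * n) / omega n) \<le> C * exp (\<alpha> / (1 - r)) / (1 - r) ^ 3"
    using kernel_diag_bound by blast
  have "(\<integral>\<^sup>+\<zeta>. ennreal ((norm (ker \<zeta> z))\<^sup>2 * v \<zeta>) \<partial>disc_area) \<le> ennreal (C * exp (\<alpha> / (1 - norm z)) / (1 - norm z) ^ 3)"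
    if z: "z \<noteq> 0" "norm z < 1" for z
  proof (rule parseval_le)
    show "(\<lambda>n. (cnj z ^ n / of_real (omega n)) * \<zeta> ^ n) sums ker \<zeta> z" if "norm \<zeta> < 1" for \<zeta>
      using ker_sums[OF that z(2)] .
    fix N
    have "(norm (cnj z ^ n / complex_of_real (omega n)))\<^sup>2 * omega n = norm z ^ (2 * n) / omega n" for n
      using omega_pos[of n] by (simp add: norm_divide norm_power power_divide power2_eq_square mult_2 power_add)
    then have "(\<Sum>n<N. (norm (cnj z ^ n / complex_of_real (omega n)))\<^sup>2 * omega n) = (\<Sum>n<N. norm z ^ (2 * n) / omega n)"
      by simp
    also have "\<dots> \<le> (\<Sum>n. norm z ^ (2 * n) / omega n)"
      using z omega_pos by (intro sum_le_suminf summable_kernel_diag) (auto simp: less_imp_le)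
    also have "\<dots> \<le> C * exp (\<alpha> / (1 - norm z)) / (1 - norm z) ^ 3" using z by (intro C(2)) auto
    finally show "(\<Sum>n<N. (norm (cnj z ^ n / complex_of_real (omega n)))\<^sup>2 * omega n) \<le> C * exp (\<alpha> / (1 - norm z)) / (1 - norm z) ^ 3" .
  qed
  then show ?thesis using C(1) by (intro exI[of _ C]) auto
qed

text \<open>
  Multiplication by \<open>(\<zeta> - z)\<^sup>2\<close> turns the Taylor coefficients of the kernel into twisted second differences
  \<open>g\<close>, which are expressed by the ratios through \<open>X\<close>.
\<close>

lemma ker_L2_off_diagonal:
  "\<exists>C>0. \<forall>z. 1/2 \<le> norm z \<and> norm z < 1 \<longrightarrow> (\<integral>\<^sup>+\<zeta>. ennreal ((norm ((\<zeta> - z)\<^sup>2 * ker \<zeta> z))\<^sup>2 * v \<zeta>) \<partial>disc_area)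
     \<le> ennreal (C * ((1 - norm z) ^ 3 * exp (\<alpha> / (1 - norm z))))"
proof -
  obtain C where C0: "C > 0 \<and> (\<forall>r. 0 < r \<and> r < 1 \<longrightarrow> (\<forall>N. (\<Sum>n<N. (r ^ (2 * n) / omega n) * ((ratio n - r\<^sup>2)\<^sup>2 - ratio n * (ratio n - ratio (n - 1)))\<^sup>2)
     \<le> C * ((1 - r) ^ 3 * exp (\<alpha> / (1 - r)))))"
    using kernel_second_difference_sum ..
  then have C: "C > 0" by blast
  have "(\<integral>\<^sup>+\<zeta>. ennreal ((norm ((\<zeta> - z)\<^sup>2 * ker \<zeta> z))\<^sup>2 * v \<zeta>) \<partial>disc_area)
     \<le> ennreal ((16 * C) * ((1 - norm z) ^ 3 * exp (\<alpha> / (1 - norm z))))"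
    if z: "1/2 \<le> norm z" "norm z < 1" for z
  proof -
    define r where "r = norm z"
    have r: "1/2 \<le> r" "0 < r" "r < 1" using z by (auto simp: r_def)
    define b where "b n = cnj z ^ n / of_real (omega n)" for n
    \<comment> \<open>\<open>sh\<close> is multiplication by \<open>\<zeta>\<close> on coefficient
      sequences, so \<open>g\<close> consists of the coefficients of
      \<open>(\<zeta> - z)\<^sup>2 * ker \<zeta> z\<close>.\<close>
    define sh where "sh f = (\<lambda>n. case n of 0 \<Rightarrow> 0 | Suc m \<Rightarrow> f m)" for f :: "nat \<Rightarrow> complex"
    define g where "g n = sh (sh b) n - 2 * z * sh b n + z\<^sup>2 * b n" for n
    define X where "X n = (ratio n - r\<^sup>2)\<^sup>2 - ratio n * (ratio n - ratio (n - 1))" for n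
    have X: "X n = ratio n * ratio (n - 1) - 2 * r\<^sup>2 * ratio n + r ^ 4" for n
      unfolding X_def by (simp add: power2_eq_square power4_eq_xxxx algebra_simps)
    have zz: "z * cnj z = of_real (r\<^sup>2)" unfolding r_def by (rule complex_norm_square[symmetric])
    have ng: "r\<^sup>2 * norm (g n) = r ^ n / omega n * \<bar>X n\<bar>" for n
    proof -
      have om: "complex_of_real (omega k) \<noteq> 0" for k using omega_pos[of k] by simp
      \<comment> \<open>The factor \<open>cnj z ^ 2\<close> pairs every \<open>z\<close> with a
        \<open>cnj z\<close>, so that besides \<open>cnj z ^ n\<close> only \<open>r\<^sup>2\<close>
        and moments remain. For \<open>n = 0\<close> and \<open>n = 1\<close> shifted terms are
        missing, which \<open>ratio 0 = 0\<close> reproduces in \<open>X\<close>.\<close>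
      have "cnj z ^ 2 * g n = cnj z ^ n / of_real (omega n) * of_real (X n)"
      proof -
        consider "n = 0" | "n = 1" | m where "n = Suc (Suc m)" by (metis One_nat_def not0_implies_Suc)
        then show ?thesis
        proof cases
          case 1
          have "cnj z ^ 2 * g n = (z * cnj z)\<^sup>2 / of_real (omega 0)"
            by (simp add: 1 g_def sh_def b_def power_mult_distrib)
          then show ?thesis unfolding zz by (simp add: 1 X ratio_def power_mult[symmetric])
        next
          case 2
          have "cnj z ^ 2 * g n = cnj z * (- 2 * (z * cnj z) / of_real (omega 0) + (z * cnj z)\<^sup>2 / of_real (omega 1))"
            by (simp add: 2 g_def sh_def b_def power2_eq_square algebra_simps)
          also have "\<dots> = cnj z / of_real (omega 1) * (- 2 * of_real (r\<^sup>2) * (of_real (omega 1) / of_real (omega 0)) + (of_real (r\<^sup>2))\<^sup>2)"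
            unfolding zz using om[of 0] om[of 1] by (simp add: field_simps)
          also have "\<dots> = cnj z / of_real (omega 1) * of_real (X n)"
            by (simp add: 2 X ratio_def power_mult[symmetric])
          finally show ?thesis by (simp add: 2)
        next
          case 3
          have "cnj z ^ 2 * g n = cnj z ^ n * (1 / of_real (omega m) - 2 * (z * cnj z) / of_real (omega (Suc m)) + (z * cnj z)\<^sup>2 / of_real (omega n))"
            by (simp add: 3 g_def sh_def b_def power2_eq_square algebra_simps)
          also have "\<dots> = cnj z ^ n / of_real (omega n) * ((of_real (omega n) / of_real (omega (Suc m))) * (of_real (omega (Suc m)) / of_real (omega m)) - 2 * of_real (r\<^sup>2) * (of_real (omega n) / of_real (omega (Suc m))) + (of_real (r\<^sup>2))\<^sup>2)"
            unfolding zz using om[of n] om[of "Suc m"] om[of m] by (simp add: field_simps)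
          also have "\<dots> = cnj z ^ n / of_real (omega n) * of_real (X n)"
            by (simp add: 3 X ratio_Suc power_mult[symmetric])
          finally show ?thesis .
        qed
      qed
      then have "norm (cnj z ^ 2 * g n) = norm (cnj z ^ n / of_real (omega n) * of_real (X n))" by simp
      then show ?thesis using omega_pos[of n] by (simp add: norm_mult norm_divide norm_power r_def)
    qed
    have "(\<integral>\<^sup>+\<zeta>. ennreal ((norm ((\<zeta> - z)\<^sup>2 * ker \<zeta> z))\<^sup>2 * v \<zeta>) \<partial>disc_area) \<le> ennreal ((16 * C) * ((1 - r) ^ 3 * exp (\<alpha> / (1 - r))))"
    proof (rule parseval_le)
      fix \<zeta> :: complex assume \<zeta>: "norm \<zeta> < 1"
      have b: "(\<lambda>n. b n * \<zeta> ^ n) sums ker \<zeta> z" unfolding b_def by (rule ker_sums[OF \<zeta> z(2)])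
      have b1: "(\<lambda>n. sh b n * \<zeta> ^ n) sums (\<zeta> * ker \<zeta> z)" unfolding sh_def by (rule sums_shift_power[OF b])
      have b2: "(\<lambda>n. sh (sh b) n * \<zeta> ^ n) sums (\<zeta> * (\<zeta> * ker \<zeta> z))"
        unfolding sh_def[of "sh b"] by (rule sums_shift_power[OF b1])
      have "(\<lambda>n. sh (sh b) n * \<zeta> ^ n - 2 * z * (sh b n * \<zeta> ^ n) + z\<^sup>2 * (b n * \<zeta> ^ n)) sums
        (\<zeta> * (\<zeta> * ker \<zeta> z) - 2 * z * (\<zeta> * ker \<zeta> z) + z\<^sup>2 * ker \<zeta> z)"
        by (intro sums_add sums_diff sums_mult b b1 b2)
      then show "(\<lambda>n. g n * \<zeta> ^ n) sums ((\<zeta> - z)\<^sup>2 * ker \<zeta> z)"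
        by (simp add: g_def power2_eq_square algebra_simps)
    next
      fix N
      have eq: "(norm (g n))\<^sup>2 * omega n = (r ^ (2 * n) / omega n) * (X n)\<^sup>2 / r ^ 4" for n
      proof -
        have "norm (g n) = (r\<^sup>2 * norm (g n)) / r\<^sup>2" using r by simp
        also note ng
        finally have "norm (g n) = r ^ n / omega n * \<bar>X n\<bar> / r\<^sup>2" .
        then have "(norm (g n))\<^sup>2 = (r ^ n)\<^sup>2 / (omega n)\<^sup>2 * (X n)\<^sup>2 / (r\<^sup>2)\<^sup>2"
          by (simp add: power_mult_distrib power_divide)
        also have "\<dots> = r ^ (2 * n) / (omega n)\<^sup>2 * (X n)\<^sup>2 / r ^ 4"
          by (simp add: power_mult[symmetric] mult.commute)
        finally show ?thesis using omega_pos[of n] by (simp add: power2_eq_square)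
      qed
      have "(\<Sum>n<N. (norm (g n))\<^sup>2 * omega n) = (\<Sum>n<N. (r ^ (2 * n) / omega n) * (X n)\<^sup>2) / r ^ 4"
        unfolding eq by (simp add: sum_divide_distrib)
      \<comment> \<open>Division by \<open>r ^ 4\<close> is where \<open>r \<ge> 1/2\<close> enters;
        it costs the factor \<open>16\<close>.\<close>
      also have "\<dots> \<le> (C * ((1 - r) ^ 3 * exp (\<alpha> / (1 - r)))) / (1/2) ^ 4"
      proof (rule frac_le)
        show "(\<Sum>n<N. (r ^ (2 * n) / omega n) * (X n)\<^sup>2) \<le> C * ((1 - r) ^ 3 * exp (\<alpha> / (1 - r)))"
          unfolding X_def using C0 r by blast
        show "(1/2) ^ 4 \<le> r ^ 4" using r by (intro power_mono) auto
      qed (use C r in auto)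
      finally show "(\<Sum>n<N. (norm (g n))\<^sup>2 * omega n) \<le> (16 * C) * ((1 - r) ^ 3 * exp (\<alpha> / (1 - r)))"
        by (simp add: power4_eq_xxxx)
    qed
    then show ?thesis by (simp add: r_def)
  qed
  then show ?thesis using C by (intro exI[of _ "16 * C"]) auto
qed

text \<open>For \<open>norm z < 1/2\<close> the kernel is bounded and \<open>s z \<le> 1\<close>.
  Otherwise Cauchy-Schwarz is used as a pointwise inequality between sums, so that three integrals
  with known bounds are added.\<close>

theorem ker_bound:
  "\<exists>C>0. \<forall>z. norm z < 1 \<longrightarrow> (\<integral>\<^sup>+\<zeta>. ennreal (norm (ker \<zeta> z) * s \<zeta>) \<partial>disc_area) \<le> ennreal (C / s z)"
proof -
  obtain A where A: "A > 0" "\<And>z. z \<noteq> 0 \<Longrightarrow> norm z < 1 \<Longrightarrow> (\<integral>\<^sup>+\<zeta>. ennreal ((norm (ker \<zeta> z))\<^sup>2 * v \<zeta>) \<partial>disc_area)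
     \<le> ennreal (A * exp (\<alpha> / (1 - norm z)) / (1 - norm z) ^ 3)" using ker_L2 by blast
  obtain B where B: "B > 0" "\<And>z. 1/2 \<le> norm z \<Longrightarrow> norm z < 1 \<Longrightarrow> (\<integral>\<^sup>+\<zeta>. ennreal ((norm ((\<zeta> - z)\<^sup>2 * ker \<zeta> z))\<^sup>2 * v \<zeta>) \<partial>disc_area)
     \<le> ennreal (B * ((1 - norm z) ^ 3 * exp (\<alpha> / (1 - norm z))))" using ker_L2_off_diagonal by blast
  define D where "D = (\<Sum>n. (1/2) ^ n / omega n)"
  have D: "D \<ge> 0" unfolding D_def using omega_pos
    by (intro suminf_nonneg summable_power_omega divide_nonneg_pos) auto
  define C where "C = A + B + 1/2 + D"
  have "(\<integral>\<^sup>+\<zeta>. ennreal (norm (ker \<zeta> z) * s \<zeta>) \<partial>disc_area) \<le> ennreal (C / s z)" if z: "norm z < 1" for z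
  proof (cases "1/2 \<le> norm z")
    case False
    have "norm (ker \<zeta> z) * s \<zeta> \<le> D" if \<zeta>: "norm \<zeta> < 1" for \<zeta>
    proof -
      have "norm (ker \<zeta> z) \<le> (\<Sum>n. norm z ^ n / omega n)" by (rule norm_ker_le[OF \<zeta> z])
      also have "\<dots> \<le> D" unfolding D_def using False omega_pos z
        by (intro suminf_le summable_power_omega divide_right_mono power_mono) (auto simp: less_imp_le)
      finally have "norm (ker \<zeta> z) * s \<zeta> \<le> D * 1" using s_le_1[OF \<zeta>] D by (intro mult_mono) (auto simp: less_imp_le)
      then show ?thesis by simp
    qed
    then have "(\<integral>\<^sup>+\<zeta>. ennreal (norm (ker \<zeta> z) * s \<zeta>) \<partial>disc_area) \<le> (\<integral>\<^sup>+\<zeta>. ennreal D \<partial>disc_area)"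
      by (intro nn_integral_mono ennreal_leI) auto
    also have "\<dots> = ennreal D" using emeasure_disc_area_space by simp
    also have "\<dots> \<le> ennreal (C / s z)"
    proof (rule ennreal_leI)
      have "D \<le> C" using A B by (simp add: C_def)
      also have "C = C / 1" by simp
      also have "\<dots> \<le> C / s z" using A B D s_le_1[OF z] by (intro divide_left_mono) (auto simp: C_def)
      finally show "D \<le> C / s z" .
    qed
    finally show ?thesis .
  next
    case True
    define d where "d = (1 - norm z) ^ 3"
    define E where "E = exp (\<alpha> / (1 - norm z))"
    \<comment> \<open>The balancing parameter: as \<open>E = 1 / (s z)\<^sup>2\<close>, the three
      terms become \<open>A / s z\<close>, \<open>B / s z\<close> and
      \<open>1 / (2 * s z)\<close>.\<close>
    define c where "c = s z * d"
    have d: "d > 0" using z by (simp add: d_def)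
    have c: "c > 0" using d by (simp add: c_def)
    have sE: "s z * s z * E = 1"
      using s_square[of z] by (simp add: power2_eq_square E_def exp_weight_def exp_minus)
    let ?f1 = "\<lambda>\<zeta>. (norm (ker \<zeta> z))\<^sup>2 * v \<zeta>"
    let ?f2 = "\<lambda>\<zeta>. (norm ((\<zeta> - z)\<^sup>2 * ker \<zeta> z))\<^sup>2 * v \<zeta>"
    let ?f3 = "\<lambda>\<zeta>. d\<^sup>2 / (d + (norm (\<zeta> - z))\<^sup>2)\<^sup>2"
    \<comment> \<open>\<open>2 x \<le> u x\<^sup>2 + 1 / u\<close> with \<open>u = c (1 + |\<zeta> - z|\<^sup>2 / d)\<^sup>2\<close>\<close>
    have pt: "norm (ker \<zeta> z) * s \<zeta> \<le> c * ?f1 \<zeta> + c / d\<^sup>2 * ?f2 \<zeta> + 1 / (2 * c) * ?f3 \<zeta>" for \<zeta>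
    proof -
      define t where "t = norm (\<zeta> - z)"
      define x where "x = norm (ker \<zeta> z) * s \<zeta>"
      define W where "W = (d + t\<^sup>2)\<^sup>2 / d\<^sup>2"
      have dt: "d + t\<^sup>2 > 0" using d by (simp add: add_pos_nonneg)
      have W: "W > 0" using dt d by (simp add: W_def)
      have u: "c * W > 0" using c W by simp
      have x2: "x\<^sup>2 = ?f1 \<zeta>" by (simp add: x_def power_mult_distrib s_square)
      have f2: "?f2 \<zeta> = t ^ 4 * x\<^sup>2" unfolding x2 t_def by (simp add: norm_mult norm_power power_mult_distrib power_mult[symmetric])
      have "0 \<le> (c * W * x - 1)\<^sup>2" by simp
      then have "x * (2 * (c * W)) \<le> c * W * (c * W * x\<^sup>2) + 1" by (simp add: power2_eq_square algebra_simps)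
      then have "x \<le> (c * W * (c * W * x\<^sup>2) + 1) / (2 * (c * W))" using u by (simp only: pos_le_divide_eq)
      also have "\<dots> = c * W * x\<^sup>2 / 2 + 1 / (2 * c) * (1 / W)" using u c W by (simp add: field_simps)
      also have "W \<le> 2 + 2 * t ^ 4 / d\<^sup>2"
      proof -
        have "(d + t\<^sup>2)\<^sup>2 \<le> 2 * d\<^sup>2 + 2 * t ^ 4"
          using zero_le_power2[of "d - t\<^sup>2"] by (simp add: power2_eq_square power4_eq_xxxx algebra_simps)
        then have "W \<le> (2 * d\<^sup>2 + 2 * t ^ 4) / d\<^sup>2" unfolding W_def by (rule divide_right_mono) simp
        then show ?thesis using d by (simp add: add_divide_distrib)
      qed
      then have "c * W * x\<^sup>2 / 2 \<le> c * (2 + 2 * t ^ 4 / d\<^sup>2) * x\<^sup>2 / 2"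
        using c by (intro divide_right_mono mult_right_mono mult_left_mono) auto
      also have "\<dots> = c * x\<^sup>2 + c / d\<^sup>2 * (t ^ 4 * x\<^sup>2)" by (simp add: algebra_simps add_divide_distrib)
      also have "1 / W = ?f3 \<zeta>" by (simp add: W_def t_def)
      finally show ?thesis unfolding f2 x2[symmetric] by (simp add: x_def)
    qed
    have "(\<integral>\<^sup>+\<zeta>. ennreal (norm (ker \<zeta> z) * s \<zeta>) \<partial>disc_area) \<le>
      (\<integral>\<^sup>+\<zeta>. ennreal c * ennreal (?f1 \<zeta>) + ennreal (c / d\<^sup>2) * ennreal (?f2 \<zeta>) + ennreal (1 / (2 * c)) * ennreal (?f3 \<zeta>) \<partial>disc_area)"
    proof (rule nn_integral_mono)
      fix \<zeta>
      have "ennreal c * ennreal (?f1 \<zeta>) + ennreal (c / d\<^sup>2) * ennreal (?f2 \<zeta>) + ennreal (1 / (2 * c)) * ennreal (?f3 \<zeta>)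
        = ennreal (c * ?f1 \<zeta> + c / d\<^sup>2 * ?f2 \<zeta> + 1 / (2 * c) * ?f3 \<zeta>)"
        using c by (simp add: ennreal_mult'[symmetric] ennreal_plus[symmetric] less_imp_le del: ennreal_plus)
      then show "ennreal (norm (ker \<zeta> z) * s \<zeta>) \<le> ennreal c * ennreal (?f1 \<zeta>) + ennreal (c / d\<^sup>2) * ennreal (?f2 \<zeta>) + ennreal (1 / (2 * c)) * ennreal (?f3 \<zeta>)"
        using ennreal_leI[OF pt[of \<zeta>]] by simp
    qed
    also have "\<dots> = ennreal c * (\<integral>\<^sup>+\<zeta>. ennreal (?f1 \<zeta>) \<partial>disc_area) + ennreal (c / d\<^sup>2) * (\<integral>\<^sup>+\<zeta>. ennreal (?f2 \<zeta>) \<partial>disc_area) + ennreal (1 / (2 * c)) * (\<integral>\<^sup>+\<zeta>. ennreal (?f3 \<zeta>) \<partial>disc_area)"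
    proof -
      have [measurable]: "(\<lambda>\<zeta>. ennreal (?f1 \<zeta>)) \<in> borel_measurable disc_area" "(\<lambda>\<zeta>. ennreal (?f2 \<zeta>)) \<in> borel_measurable disc_area"
        "(\<lambda>\<zeta>. ennreal (?f3 \<zeta>)) \<in> borel_measurable disc_area"
        by (rule measurable_disc_areaI, measurable)+
      show ?thesis by (simp add: nn_integral_add nn_integral_cmult)
    qed
    also have "\<dots> \<le> ennreal c * ennreal (A * E / d) + ennreal (c / d\<^sup>2) * ennreal (B * (d * E)) + ennreal (1 / (2 * c)) * ennreal d"
    proof (intro add_mono mult_left_mono)
      show "(\<integral>\<^sup>+\<zeta>. ennreal (?f1 \<zeta>) \<partial>disc_area) \<le> ennreal (A * E / d)" unfolding E_def d_def using True z by (intro A(2)) auto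
      show "(\<integral>\<^sup>+\<zeta>. ennreal (?f2 \<zeta>) \<partial>disc_area) \<le> ennreal (B * (d * E))" unfolding E_def d_def by (rule B(2)[OF True z])
      show "(\<integral>\<^sup>+\<zeta>. ennreal (?f3 \<zeta>) \<partial>disc_area) \<le> ennreal d" by (rule nn_integral_bump_le[OF d z])
    qed auto
    also have "\<dots> = ennreal (c * (A * E / d) + c / d\<^sup>2 * (B * (d * E)) + 1 / (2 * c) * d)"
      using c d A(1) B(1) by (simp add: ennreal_mult'[symmetric] ennreal_plus[symmetric] less_imp_le E_def del: ennreal_plus)
    also have "\<dots> \<le> ennreal (C / s z)"
    proof (rule ennreal_leI)
      have E: "E = 1 / (s z * s z)" using sE less_imp_neq[OF s_pos[of z]] by (simp add: nonzero_eq_divide_eq mult_ac)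
      have "c * (A * E / d) + c / d\<^sup>2 * (B * (d * E)) + 1 / (2 * c) * d = (A + B + 1/2) / s z"
        unfolding c_def E using d s_pos[of z] by (simp add: field_simps power2_eq_square)
      also have "\<dots> \<le> C / s z" using D by (intro divide_right_mono) (auto simp: C_def less_imp_le)
      finally show "c * (A * E / d) + c / d\<^sup>2 * (B * (d * E)) + 1 / (2 * c) * d \<le> C / s z" .
    qed
    finally show ?thesis .
  qed
  moreover have "C > 0" using A B D by (simp add: C_def add_pos_nonneg)
  ultimately show ?thesis by blast
qed

end

subsection \<open>The Bergman projection\<close>

text \<open>Young's inequality for \<open>u / \<tau>\<close> and \<open>1\<close>, multiplied by
  \<open>\<tau>\<close>; the scale is chosen only after integration.\<close>

lemma Young_scaled:
  fixes u :: real
  assumes "p \<ge> 1" "u \<ge> 0" "\<tau> > 0"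
  shows "u \<le> \<tau> powr (1 - p) * u powr p / p + \<tau> * (1 - 1 / p)"
proof (cases "p = 1")
  case True then show ?thesis using assms by (cases "u = 0") auto
next
  case False
  define q where "q = p / (p - 1)"
  have pq: "p > 1" "q > 1" "1 / p + 1 / q = 1" using False assms by (auto simp: q_def field_simps)
  have "u / \<tau> * 1 \<le> (u / \<tau>) powr p / p + 1 powr q / q"
    by (rule Youngs_inequality) (use pq assms in auto)
  also have "\<dots> = (u / \<tau>) powr p / p + (1 - 1 / p)" using pq by simp
  finally have "\<tau> * (u / \<tau> * 1) \<le> \<tau> * ((u / \<tau>) powr p / p + (1 - 1 / p))"
    using assms by (intro mult_left_mono) auto
  also have "\<dots> = (\<tau> * (u / \<tau>) powr p) / p + \<tau> * (1 - 1 / p)" by (simp add: distrib_left)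
  also have "\<tau> * (u / \<tau>) powr p = \<tau> powr (1 - p) * u powr p"
    using assms by (simp add: powr_divide powr_diff)
  finally show ?thesis using assms by simp
qed

text \<open>Jensen's inequality for the measure with density \<open>k\<close>, of mass at most
  \<open>C\<close>. Integrating the scaled Young inequality treats all \<open>p \<ge> 1\<close>
  alike and yields finiteness of the integral as well.\<close>

lemma weighted_powr_mean:
  fixes k u :: "'a \<Rightarrow> real"
  assumes [measurable]: "k \<in> borel_measurable M" "u \<in> borel_measurable M"
    and nn: "\<And>x. x \<in> space M \<Longrightarrow> k x \<ge> 0" "\<And>x. x \<in> space M \<Longrightarrow> u x \<ge> 0"
    and C: "(\<integral>\<^sup>+x. ennreal (k x) \<partial>M) \<le> ennreal C" "C > 0" and p: "p \<ge> 1"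
    and A: "(\<integral>\<^sup>+x. ennreal (k x * u x powr p) \<partial>M) \<le> ennreal A" "A \<ge> 0"
  shows "\<exists>B\<ge>0. (\<integral>\<^sup>+x. ennreal (k x * u x) \<partial>M) = ennreal B \<and> B powr p \<le> C powr (p - 1) * A"
proof -
  have step: "(\<integral>\<^sup>+x. ennreal (k x * u x) \<partial>M) \<le> ennreal (\<tau> powr (1 - p) / p * A + \<tau> * (1 - 1 / p) * C)" if l: "\<tau> > 0" for \<tau>
  proof -
    have pp: "0 \<le> 1 - 1 / p" using p by simp
    have "(\<integral>\<^sup>+x. ennreal (k x * u x) \<partial>M) \<le> (\<integral>\<^sup>+x. ennreal (\<tau> powr (1 - p) / p) * ennreal (k x * u x powr p) + ennreal (\<tau> * (1 - 1 / p)) * ennreal (k x) \<partial>M)"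
    proof (rule nn_integral_mono)
      fix x assume x: "x \<in> space M"
      have "k x * u x \<le> k x * (\<tau> powr (1 - p) * u x powr p / p + \<tau> * (1 - 1 / p))"
        using nn[OF x] by (intro mult_left_mono Young_scaled p l) auto
      then have "ennreal (k x * u x) \<le> ennreal (\<tau> powr (1 - p) / p * (k x * u x powr p) + \<tau> * (1 - 1 / p) * k x)"
        by (intro ennreal_leI) (simp add: algebra_simps)
      also have "\<dots> = ennreal (\<tau> powr (1 - p) / p) * ennreal (k x * u x powr p) + ennreal (\<tau> * (1 - 1 / p)) * ennreal (k x)"
        using nn[OF x] p l pp by (simp only: ennreal_plus[symmetric] ennreal_mult[symmetric] mult_nonneg_nonneg divide_nonneg_nonneg powr_ge_zero less_imp_le order_trans[OF zero_le_one])
      finally show "ennreal (k x * u x) \<le> ennreal (\<tau> powr (1 - p) / p) * ennreal (k x * u x powr p) + ennreal (\<tau> * (1 - 1 / p)) * ennreal (k x)" .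
    qed
    also have "\<dots> = ennreal (\<tau> powr (1 - p) / p) * (\<integral>\<^sup>+x. ennreal (k x * u x powr p) \<partial>M) + ennreal (\<tau> * (1 - 1 / p)) * (\<integral>\<^sup>+x. ennreal (k x) \<partial>M)"
      by (simp add: nn_integral_add nn_integral_cmult)
    also have "\<dots> \<le> ennreal (\<tau> powr (1 - p) / p) * ennreal A + ennreal (\<tau> * (1 - 1 / p)) * ennreal C"
      by (intro add_mono mult_left_mono A C) auto
    also have "\<dots> = ennreal (\<tau> powr (1 - p) / p * A + \<tau> * (1 - 1 / p) * C)"
      using p l pp A(2) C(2) by (simp only: ennreal_plus[symmetric] ennreal_mult[symmetric] mult_nonneg_nonneg divide_nonneg_nonneg powr_ge_zero less_imp_le order_trans[OF zero_le_one])
    finally show ?thesis .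
  qed
  define B where "B = enn2real (\<integral>\<^sup>+x. ennreal (k x * u x) \<partial>M)"
  have "(\<integral>\<^sup>+x. ennreal (k x * u x) \<partial>M) < \<infinity>" by (rule le_less_trans[OF step[of 1]]) auto
  then have B: "(\<integral>\<^sup>+x. ennreal (k x * u x) \<partial>M) = ennreal B" by (simp add: B_def)
  have B0: "B \<ge> 0" by (simp add: B_def)
  have "B powr p \<le> C powr (p - 1) * A"
  proof (cases "B = 0")
    case True then show ?thesis using A(2) by simp
  next
    case False
    then have Bp: "B > 0" using B0 by simp
    \<comment> \<open>The average of \<open>u\<close> if the mass is exactly \<open>C\<close>. With
      this scale the second term is \<open>B - B / p\<close>, which leaves \<open>B / p\<close> on
      the left.\<close>
    define \<tau> where "\<tau> = B / C"
    have l: "\<tau> > 0" using Bp C by (simp add: \<tau>_def)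
    have "0 \<le> \<tau> powr (1 - p) / p * A + \<tau> * (1 - 1 / p) * C" using p l A(2) C(2) by (intro add_nonneg_nonneg mult_nonneg_nonneg) auto
    then have "B \<le> \<tau> powr (1 - p) / p * A + \<tau> * (1 - 1 / p) * C" using step[OF l] unfolding B by (simp add: ennreal_le_iff)
    also have "\<tau> * (1 - 1 / p) * C = B - B / p" using C(2) by (simp add: \<tau>_def algebra_simps)
    finally have "B / p \<le> \<tau> powr (1 - p) * A / p" by simp
    then have "B \<le> \<tau> powr (1 - p) * A" using p by (simp add: divide_le_cancel)
    then have "\<tau> powr (p - 1) * B \<le> \<tau> powr (p - 1) * (\<tau> powr (1 - p) * A)" by (rule mult_left_mono) simp
    also have "\<dots> = A" using l by (simp add: mult.assoc[symmetric] powr_add[symmetric])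
    finally have "(B / C) powr (p - 1) * B \<le> A" by (simp add: \<tau>_def)
    then have "C powr (p - 1) * ((B / C) powr (p - 1) * B) \<le> C powr (p - 1) * A" by (rule mult_left_mono) simp
    also have "C powr (p - 1) * ((B / C) powr (p - 1) * B) = B powr p"
      using Bp C(2) by (simp add: powr_divide powr_diff)
    finally show ?thesis .
  qed
  with B B0 show ?thesis by blast
qed

lemma disc_analytic_measurable: "f \<in> disc_analytic \<Longrightarrow> f \<in> borel_measurable disc_area"
  unfolding disc_analytic_def by (auto intro: continuous_on_measurable_disc_area holomorphic_on_imp_continuous_on)

interpretation disc_pair: pair_sigma_finite disc_area disc_area
  by standard

lemma borel_pair_measurable_disc:
  assumes "f \<in> borel_measurable (borel \<Otimes>\<^sub>M borel)"
  shows "f \<in> borel_measurable (disc_area \<Otimes>\<^sub>M disc_area)"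
proof -
  have "(\<lambda>x. x) \<in> measurable disc_area borel" by (rule measurable_disc_areaI) simp
  then have "(\<lambda>x. (fst x, snd x)) \<in> measurable (disc_area \<Otimes>\<^sub>M disc_area) (borel \<Otimes>\<^sub>M borel)"
    by (intro measurable_Pair measurable_compose[OF measurable_fst] measurable_compose[OF measurable_snd])
  from measurable_compose[OF this assms] show ?thesis by simp
qed

context exp_disc
begin

lemma s_neq_0 [simp]: "s z \<noteq> 0"
  using s_pos[of z] by linarith

section \<open>The projection and Schur's test\<close>

text \<open>Extended by zero like the elements of \<open>disc_analytic\<close>. A non-integrable
  integrand gives the value \<open>0\<close>, so upper bounds for \<open>proj f\<close> hold for
  every measurable \<open>f\<close>.\<close>

definition proj :: "(complex \<Rightarrow> complex) \<Rightarrow> complex \<Rightarrow> complex" where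
  "proj f z = (if norm z < 1 then \<integral>\<zeta>. f \<zeta> * of_real (v \<zeta>) * ker z \<zeta> \<partial>disc_area else 0)"

text \<open>The \<open>p\<close>-th power of the norm of \<open>L^p(s^p)\<close>, with values in
  \<open>ennreal\<close> so that estimates include the infinite case.\<close>

definition wlp :: "real \<Rightarrow> (complex \<Rightarrow> complex) \<Rightarrow> ennreal" where
  "wlp p f = (\<integral>\<^sup>+z. ennreal ((norm (f z) * s z) powr p) \<partial>disc_area)"

definition Cker :: real where
  "Cker = (SOME C. C > 0 \<and> (\<forall>z. norm z < 1 \<longrightarrow> (\<integral>\<^sup>+\<zeta>. ennreal (norm (ker \<zeta> z) * s \<zeta>) \<partial>disc_area) \<le> ennreal (C / s z)))"

lemma Cker: "Cker > 0" "norm z < 1 \<Longrightarrow> (\<integral>\<^sup>+\<zeta>. ennreal (norm (ker \<zeta> z) * s \<zeta>) \<partial>disc_area) \<le> ennreal (Cker / s z)"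
  using someI_ex[OF ker_bound] unfolding Cker_def by blast+

lemma s_disc_measurable: "s \<in> borel_measurable disc_area"
  by (rule measurable_disc_areaI) measurable

lemma v_disc_measurable: "v \<in> borel_measurable disc_area"
  by (rule measurable_disc_areaI) measurable

lemma ker_disc_measurable: "(\<lambda>w. ker z w) \<in> borel_measurable disc_area" "(\<lambda>w. ker w z) \<in> borel_measurable disc_area"
  by (rule measurable_disc_areaI, measurable)+

text \<open>Jensen's inequality for the density
  \<open>norm (ker z \<zeta>) * s \<zeta> * s z\<close>, whose mass is at most \<open>Cker\<close>
  by the kernel estimate. Of the two factors in \<open>v \<zeta> = s \<zeta> * s \<zeta>\<close> one
  goes to \<open>f\<close> and one to the kernel.\<close>

lemma proj_pointwise:
  assumes f: "f \<in> borel_measurable disc_area" and p: "p \<ge> 1" and z: "norm z < 1"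
  shows "ennreal ((norm (proj f z) * s z) powr p) \<le>
    ennreal (Cker powr (p - 1)) * (\<integral>\<^sup>+\<zeta>. ennreal (norm (ker z \<zeta>) * s \<zeta> * s z * (norm (f \<zeta>) * s \<zeta>) powr p) \<partial>disc_area)"
    (is "_ \<le> _ * ?A")
proof (cases "?A = \<infinity>")
  case True
  then show ?thesis using Cker(1) by (simp add: ennreal_mult_top)
next
  case False
  note [measurable] = f s_disc_measurable ker_disc_measurable v_disc_measurable
  define A where "A = enn2real ?A"
  have A: "?A = ennreal A" "A \<ge> 0" using False by (auto simp: A_def less_top)
  have "(\<integral>\<^sup>+\<zeta>. ennreal (norm (ker z \<zeta>) * s \<zeta> * s z) \<partial>disc_area) = (\<integral>\<^sup>+\<zeta>. ennreal (s z) * ennreal (norm (ker \<zeta> z) * s \<zeta>) \<partial>disc_area)"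
    by (intro nn_integral_cong) (auto simp: ennreal_mult'[symmetric] ker_norm_commute[OF z] less_imp_le mult_ac)
  also have "\<dots> = ennreal (s z) * (\<integral>\<^sup>+\<zeta>. ennreal (norm (ker \<zeta> z) * s \<zeta>) \<partial>disc_area)"
    by (rule nn_integral_cmult) measurable
  also have "\<dots> \<le> ennreal (s z) * ennreal (Cker / s z)"
    by (rule mult_left_mono[OF Cker(2)[OF z]]) simp
  also have "\<dots> = ennreal Cker" using s_pos[of z] by (simp add: ennreal_mult'[symmetric] less_imp_le)
  finally have "(\<integral>\<^sup>+\<zeta>. ennreal (norm (ker z \<zeta>) * s \<zeta> * s z) \<partial>disc_area) \<le> ennreal Cker" .
  then have "\<exists>B\<ge>0. (\<integral>\<^sup>+\<zeta>. ennreal (norm (ker z \<zeta>) * s \<zeta> * s z * (norm (f \<zeta>) * s \<zeta>)) \<partial>disc_area) = ennreal B \<and>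
    B powr p \<le> Cker powr (p - 1) * A"
  proof (rule weighted_powr_mean[rotated 4])
    show "?A \<le> ennreal A" using A(1) by simp
  qed (use Cker(1) p A(2) in \<open>auto simp: less_imp_le\<close>)
  then obtain B where B: "B \<ge> 0" "(\<integral>\<^sup>+\<zeta>. ennreal (norm (ker z \<zeta>) * s \<zeta> * s z * (norm (f \<zeta>) * s \<zeta>)) \<partial>disc_area) = ennreal B"
    "B powr p \<le> Cker powr (p - 1) * A" by (elim exE conjE)
  have "ennreal (norm (proj f z) * s z) \<le> ennreal B"
  proof -
    have "ennreal (norm (proj f z)) \<le> (\<integral>\<^sup>+\<zeta>. ennreal (norm (f \<zeta> * of_real (v \<zeta>) * ker z \<zeta>)) \<partial>disc_area)"
    proof (cases "integrable disc_area (\<lambda>\<zeta>. f \<zeta> * of_real (v \<zeta>) * ker z \<zeta>)")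
      case True then show ?thesis using integral_norm_bound_ennreal[OF True] z by (simp add: proj_def)
    next
      case False then show ?thesis using z by (simp add: proj_def not_integrable_integral_eq)
    qed
    then have "ennreal (s z) * ennreal (norm (proj f z)) \<le> ennreal (s z) * (\<integral>\<^sup>+\<zeta>. ennreal (norm (f \<zeta> * of_real (v \<zeta>) * ker z \<zeta>)) \<partial>disc_area)"
      by (rule mult_left_mono) simp
    also have "\<dots> = (\<integral>\<^sup>+\<zeta>. ennreal (s z) * ennreal (norm (f \<zeta> * of_real (v \<zeta>) * ker z \<zeta>)) \<partial>disc_area)"
      by (rule nn_integral_cmult[symmetric]) measurable
    also have "\<dots> = (\<integral>\<^sup>+\<zeta>. ennreal (norm (ker z \<zeta>) * s \<zeta> * s z * (norm (f \<zeta>) * s \<zeta>)) \<partial>disc_area)"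
      by (intro nn_integral_cong) (simp add: ennreal_mult'[symmetric] norm_mult s_square[symmetric] power2_eq_square less_imp_le mult_ac)
    finally show ?thesis unfolding B(2) by (simp add: ennreal_mult'[symmetric] less_imp_le mult.commute)
  qed
  then have "norm (proj f z) * s z \<le> B" using B(1) by (simp add: ennreal_le_iff)
  then have "(norm (proj f z) * s z) powr p \<le> B powr p" using p by (intro powr_mono2) (auto simp: less_imp_le)
  also note B(3)
  finally show ?thesis unfolding A(1) using A(2) by (simp add: ennreal_mult'[symmetric])
qed

text \<open>Schur's test: the pointwise bound contributes \<open>Cker powr (p - 1)\<close>, and
  after exchanging the integrals the kernel estimate in the other variable contributes one more
  \<open>Cker\<close>.\<close>

theorem proj_bounded:
  assumes f: "f \<in> borel_measurable disc_area" and p: "p \<ge> 1"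
  shows "wlp p (proj f) \<le> ennreal (Cker powr p) * wlp p f"
proof -
  note [measurable] = f s_disc_measurable ker_disc_measurable v_disc_measurable
  let ?h = "\<lambda>z \<zeta>. ennreal (norm (ker z \<zeta>) * s \<zeta> * s z * (norm (f \<zeta>) * s \<zeta>) powr p)"
  have km [measurable]: "(\<lambda>x. ker (fst x) (snd x)) \<in> borel_measurable (disc_area \<Otimes>\<^sub>M disc_area)"
    by (rule borel_pair_measurable_disc) measurable
  have hm: "(\<lambda>x. ?h (fst x) (snd x)) \<in> borel_measurable (disc_area \<Otimes>\<^sub>M disc_area)" by measurable
  have "wlp p (proj f) \<le> (\<integral>\<^sup>+z. ennreal (Cker powr (p - 1)) * (\<integral>\<^sup>+\<zeta>. ?h z \<zeta> \<partial>disc_area) \<partial>disc_area)"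
    unfolding wlp_def by (intro nn_integral_mono proj_pointwise[OF f p]) simp
  also have "\<dots> = ennreal (Cker powr (p - 1)) * (\<integral>\<^sup>+z. (\<integral>\<^sup>+\<zeta>. ?h z \<zeta> \<partial>disc_area) \<partial>disc_area)"
    by (rule nn_integral_cmult) (use disc_area.borel_measurable_nn_integral_fst[OF hm] in simp)
  also have "(\<integral>\<^sup>+z. (\<integral>\<^sup>+\<zeta>. ?h z \<zeta> \<partial>disc_area) \<partial>disc_area) = (\<integral>\<^sup>+\<zeta>. (\<integral>\<^sup>+z. ?h z \<zeta> \<partial>disc_area) \<partial>disc_area)"
    by (rule disc_pair.Fubini'[symmetric]) (use hm in \<open>simp add: case_prod_unfold\<close>)
  also have "\<dots> \<le> (\<integral>\<^sup>+\<zeta>. ennreal Cker * ennreal ((norm (f \<zeta>) * s \<zeta>) powr p) \<partial>disc_area)"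
  proof (rule nn_integral_mono)
    fix \<zeta> assume "\<zeta> \<in> space disc_area"
    then have z: "norm \<zeta> < 1" by simp
    have "(\<integral>\<^sup>+z. ?h z \<zeta> \<partial>disc_area) = (\<integral>\<^sup>+z. ennreal (s \<zeta> * (norm (f \<zeta>) * s \<zeta>) powr p) * ennreal (norm (ker z \<zeta>) * s z) \<partial>disc_area)"
      by (intro nn_integral_cong) (simp add: ennreal_mult'[symmetric] less_imp_le mult_ac)
    also have "\<dots> = ennreal (s \<zeta> * (norm (f \<zeta>) * s \<zeta>) powr p) * (\<integral>\<^sup>+z. ennreal (norm (ker z \<zeta>) * s z) \<partial>disc_area)"
      by (rule nn_integral_cmult) measurable
    also have "\<dots> \<le> ennreal (s \<zeta> * (norm (f \<zeta>) * s \<zeta>) powr p) * ennreal (Cker / s \<zeta>)"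
      by (rule mult_left_mono[OF Cker(2)[OF z]]) simp
    also have "\<dots> = ennreal Cker * ennreal ((norm (f \<zeta>) * s \<zeta>) powr p)"
    proof -
      have "s \<zeta> * (norm (f \<zeta>) * s \<zeta>) powr p * (Cker / s \<zeta>) = Cker * (norm (f \<zeta>) * s \<zeta>) powr p"
        using less_imp_neq[OF s_pos[of \<zeta>]] by (simp add: mult_ac)
      then show ?thesis using Cker(1) by (simp add: ennreal_mult'[symmetric] less_imp_le del: times_divide_eq_right)
    qed
    finally show "(\<integral>\<^sup>+z. ?h z \<zeta> \<partial>disc_area) \<le> ennreal Cker * ennreal ((norm (f \<zeta>) * s \<zeta>) powr p)" .
  qed
  also have "\<dots> = ennreal Cker * wlp p f" unfolding wlp_def by (rule nn_integral_cmult) measurable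
  finally have "wlp p (proj f) \<le> ennreal (Cker powr (p - 1)) * (ennreal Cker * wlp p f)"
    by (simp add: mult_left_mono)
  also have "\<dots> = ennreal (Cker powr p) * wlp p f"
  proof -
    have "Cker powr (p - 1) * Cker = Cker powr p" using Cker(1) by (simp add: powr_diff)
    then show ?thesis by (simp add: mult.assoc[symmetric] ennreal_mult'[symmetric])
  qed
  finally show ?thesis .
qed

section \<open>The reproducing property\<close>

text \<open>The indicator of a centred disc is radial, so orthogonality of the monomials survives
  truncation.\<close>

lemma integral_cball_monomial:
  assumes "0 \<le> \<rho>" "\<rho> < 1"
  shows "(\<integral>\<zeta>. indicator (cball 0 \<rho>) \<zeta> * \<zeta> ^ m * cnj \<zeta> ^ n * of_real (v \<zeta>) \<partial>disc_area)
    = (if m = n then of_real (\<integral>\<zeta>. indicator (cball 0 \<rho>) \<zeta> * (norm \<zeta> ^ (2 * n) * v \<zeta>) \<partial>disc_area) else 0)"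
proof (cases "m = n")
  case True
  have "indicator (cball 0 \<rho>) z * z ^ n * cnj z ^ n * of_real (v z) = complex_of_real (indicator (cball 0 \<rho>) z * (norm z ^ (2 * n) * v z))" for z
  proof -
    have "z ^ n * cnj z ^ n = of_real (norm z ^ (2 * n))"
      by (simp add: power_mult_distrib[symmetric] complex_norm_square[symmetric] power_mult)
    then show ?thesis by (simp add: mult.assoc split: split_indicator)
  qed
  then show ?thesis by (simp only: integral_complex_of_real True) simp
next
  case False
  have "(\<integral>\<zeta>. \<zeta> ^ m * cnj \<zeta> ^ n * of_real ((\<lambda>t. indicator {..\<rho>} t * exp (- (\<alpha> / (1 - t)))) (norm \<zeta>)) \<partial>disc_area) = 0"
    by (rule integral_monomials_radial_eq_0[OF False]) measurable
  also have "(\<integral>\<zeta>. \<zeta> ^ m * cnj \<zeta> ^ n * of_real ((\<lambda>t. indicator {..\<rho>} t * exp (- (\<alpha> / (1 - t)))) (norm \<zeta>)) \<partial>disc_area)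
    = (\<integral>\<zeta>. indicator (cball 0 \<rho>) \<zeta> * \<zeta> ^ m * cnj \<zeta> ^ n * of_real (v \<zeta>) \<partial>disc_area)"
    by (rule Bochner_Integration.integral_cong) (auto simp: exp_weight_def split: split_indicator)
  finally show ?thesis using False by simp
qed

definition radii :: "nat \<Rightarrow> real" where "radii k = 1 - 1 / (real k + 2)"

lemma radii: "0 \<le> radii k" "radii k < 1" by (auto simp: radii_def field_simps)

lemma eventually_radii:
  assumes "t < 1" shows "eventually (\<lambda>k. t \<le> radii k) sequentially"
proof -
  obtain N where N: "1 / (1 - t) \<le> real N" using real_arch_simple by blast
  have "t \<le> radii k" if "k \<ge> N" for k
  proof -
    have "1 / (1 - t) \<le> real k + 2" using N that by linarith
    then have "1 / (real k + 2) \<le> 1 - t" using assms by (simp add: field_simps)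
    then show ?thesis by (simp add: radii_def)
  qed
  then show ?thesis by (auto simp: eventually_sequentially)
qed

lemma tendsto_integral_cball:
  fixes f :: "complex \<Rightarrow> 'b::{real_normed_algebra_1, banach, second_countable_topology}"
  assumes f: "integrable disc_area f"
  shows "(\<lambda>k. \<integral>\<zeta>. indicator (cball 0 (radii k)) \<zeta> * f \<zeta> \<partial>disc_area) \<longlonglongrightarrow> (\<integral>\<zeta>. f \<zeta> \<partial>disc_area)"
proof (rule integral_dominated_convergence[where w="\<lambda>\<zeta>. norm (f \<zeta>)"])
  have [measurable]: "f \<in> borel_measurable disc_area" using f by simp
  have [measurable]: "(indicator (cball 0 r) :: complex \<Rightarrow> 'b) \<in> borel_measurable disc_area" for r
    by (rule measurable_disc_areaI, rule borel_measurable_indicator) simp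
  show "f \<in> borel_measurable disc_area" by measurable
  show "(\<lambda>\<zeta>. indicator (cball 0 (radii k)) \<zeta> * f \<zeta>) \<in> borel_measurable disc_area" for k by measurable
  show "integrable disc_area (\<lambda>\<zeta>. norm (f \<zeta>))" using f by simp
  show "AE \<zeta> in disc_area. (\<lambda>k. indicator (cball 0 (radii k)) \<zeta> * f \<zeta>) \<longlonglongrightarrow> f \<zeta>"
  proof (rule AE_I2)
    fix \<zeta> assume "\<zeta> \<in> space disc_area"
    then have "eventually (\<lambda>k. norm \<zeta> \<le> radii k) sequentially" by (intro eventually_radii) simp
    then have "eventually (\<lambda>k. indicator (cball 0 (radii k)) \<zeta> * f \<zeta> = f \<zeta>) sequentially"
      by eventually_elim simp
    then show "(\<lambda>k. indicator (cball 0 (radii k)) \<zeta> * f \<zeta>) \<longlonglongrightarrow> f \<zeta>" by (rule tendsto_eventually)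
  qed
  show "AE \<zeta> in disc_area. norm (indicator (cball 0 (radii k)) \<zeta> * f \<zeta>) \<le> norm (f \<zeta>)" for k
    by (auto split: split_indicator)
qed

lemma integrable_times_v:
  fixes f :: "complex \<Rightarrow> complex"
  assumes "f \<in> borel_measurable disc_area" "integrable disc_area (\<lambda>z. norm (f z) * s z)"
  shows "integrable disc_area (\<lambda>z. f z * of_real (v z))"
proof (rule Bochner_Integration.integrable_bound[OF assms(2)])
  show "(\<lambda>z. f z * of_real (v z)) \<in> borel_measurable disc_area" using assms(1) v_disc_measurable by measurable
  show "AE z in disc_area. norm (f z * complex_of_real (v z)) \<le> norm (norm (f z) * s z)"
  proof (rule AE_I2)
    fix z assume "z \<in> space disc_area"
    then have "v z \<le> s z" using s_le_1[of z] s_pos[of z] by (simp add: s_square[symmetric] power2_eq_square)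
    then show "norm (f z * complex_of_real (v z)) \<le> norm (norm (f z) * s z)"
      by (simp add: norm_mult mult_left_mono less_imp_le)
  qed
qed

text \<open>The Taylor series of \<open>f\<close> may fail to converge uniformly up to the circle.
  On \<open>cball 0 \<rho>\<close> it does converge uniformly, and orthogonality leaves one term;
  then \<open>\<rho>\<close> tends to \<open>1\<close> by dominated convergence.\<close>

lemma integral_times_monomial:
  assumes f: "f \<in> disc_analytic" and i: "integrable disc_area (\<lambda>z. norm (f z) * s z)"
    and a: "\<And>z. norm z < 1 \<Longrightarrow> (\<lambda>n. a n * z ^ n) sums f z" "\<And>\<rho>. 0 \<le> \<rho> \<Longrightarrow> \<rho> < 1 \<Longrightarrow> summable (\<lambda>n. norm (a n) * \<rho> ^ n)"
  shows "(\<integral>\<zeta>. f \<zeta> * of_real (v \<zeta>) * cnj \<zeta> ^ n \<partial>disc_area) = a n * of_real (omega n)"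
proof -
  have fm: "f \<in> borel_measurable disc_area" by (rule disc_analytic_measurable[OF f])
  have cm: "cnj \<in> borel_measurable disc_area" by (rule measurable_disc_areaI) measurable
  have ifv: "integrable disc_area (\<lambda>z. f z * of_real (v z))" by (rule integrable_times_v[OF fm i])
  have int1: "integrable disc_area (\<lambda>\<zeta>. f \<zeta> * of_real (v \<zeta>) * cnj \<zeta> ^ n)"
  proof (rule Bochner_Integration.integrable_bound[OF ifv])
    show "(\<lambda>\<zeta>. f \<zeta> * of_real (v \<zeta>) * cnj \<zeta> ^ n) \<in> borel_measurable disc_area" using fm v_disc_measurable cm by measurable
    show "AE z in disc_area. norm (f z * complex_of_real (v z) * cnj z ^ n) \<le> norm (f z * complex_of_real (v z))"
      by (auto intro!: AE_I2 mult_left_le simp: norm_mult norm_power power_le_one less_imp_le)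
  qed
  have eq: "(\<integral>\<zeta>. indicator (cball 0 \<rho>) \<zeta> * (f \<zeta> * of_real (v \<zeta>) * cnj \<zeta> ^ n) \<partial>disc_area) =
     a n * of_real (\<integral>\<zeta>. indicator (cball 0 \<rho>) \<zeta> * (norm \<zeta> ^ (2 * n) * v \<zeta>) \<partial>disc_area)" if \<rho>: "0 \<le> \<rho>" "\<rho> < 1" for \<rho>
  proof -
    let ?I = "indicator (cball 0 \<rho>) :: complex \<Rightarrow> complex"
    have [measurable]: "?I \<in> borel_measurable borel" by (rule borel_measurable_indicator) simp
    have "(\<lambda>m. \<integral>\<zeta>. (cnj \<zeta> ^ n * of_real (v \<zeta>)) * (a m * \<zeta> ^ m * ?I \<zeta>) \<partial>disc_area) sums
      (\<integral>\<zeta>. (cnj \<zeta> ^ n * of_real (v \<zeta>)) * (\<Sum>m. a m * \<zeta> ^ m * ?I \<zeta>) \<partial>disc_area)"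
    proof (rule integral_disc_sums(1))
      show "integrable disc_area (\<lambda>\<zeta>. cnj \<zeta> ^ n * of_real (v \<zeta>))" using integrable_monomials_v[of 0 n] by simp
      show "(\<lambda>\<zeta>. a m * \<zeta> ^ m * ?I \<zeta>) \<in> borel_measurable disc_area" for m by (rule measurable_disc_areaI) measurable
      show "summable (\<lambda>m. norm (a m) * \<rho> ^ m)" by (rule a(2)[OF \<rho>])
      show "norm (a m * z ^ m * ?I z) \<le> norm (a m) * \<rho> ^ m" for m z
        using \<rho> by (auto simp: norm_mult norm_power intro!: mult_left_mono power_mono split: split_indicator)
    qed
    also have "(\<lambda>m. \<integral>\<zeta>. (cnj \<zeta> ^ n * of_real (v \<zeta>)) * (a m * \<zeta> ^ m * ?I \<zeta>) \<partial>disc_area) =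
      (\<lambda>m. if m = n then a n * of_real (\<integral>\<zeta>. indicator (cball 0 \<rho>) \<zeta> * (norm \<zeta> ^ (2 * n) * v \<zeta>) \<partial>disc_area) else 0)"
    proof
      fix m
      have "(\<integral>\<zeta>. (cnj \<zeta> ^ n * of_real (v \<zeta>)) * (a m * \<zeta> ^ m * ?I \<zeta>) \<partial>disc_area) = a m * (\<integral>\<zeta>. ?I \<zeta> * \<zeta> ^ m * cnj \<zeta> ^ n * of_real (v \<zeta>) \<partial>disc_area)"
        by (subst integral_mult_right_zero[symmetric]) (simp add: mult_ac)
      then show "(\<integral>\<zeta>. (cnj \<zeta> ^ n * of_real (v \<zeta>)) * (a m * \<zeta> ^ m * ?I \<zeta>) \<partial>disc_area) = (if m = n then a n * of_real (\<integral>\<zeta>. indicator (cball 0 \<rho>) \<zeta> * (norm \<zeta> ^ (2 * n) * v \<zeta>) \<partial>disc_area) else 0)"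
        unfolding integral_cball_monomial[OF \<rho>] by simp
    qed
    also have "(\<integral>\<zeta>. (cnj \<zeta> ^ n * of_real (v \<zeta>)) * (\<Sum>m. a m * \<zeta> ^ m * ?I \<zeta>) \<partial>disc_area) = (\<integral>\<zeta>. ?I \<zeta> * (f \<zeta> * of_real (v \<zeta>) * cnj \<zeta> ^ n) \<partial>disc_area)"
    proof (rule Bochner_Integration.integral_cong[OF refl])
      fix \<zeta> assume "\<zeta> \<in> space disc_area"
      then have "(\<Sum>m. a m * \<zeta> ^ m) = f \<zeta>" using a(1)[of \<zeta>] by (simp add: sums_iff)
      then show "(cnj \<zeta> ^ n * of_real (v \<zeta>)) * (\<Sum>m. a m * \<zeta> ^ m * ?I \<zeta>) = ?I \<zeta> * (f \<zeta> * of_real (v \<zeta>) * cnj \<zeta> ^ n)"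
        by (auto split: split_indicator)
    qed
    finally show ?thesis
      using sums_unique2[OF _ sums_single[of n "\<lambda>n. a n * of_real (\<integral>\<zeta>. indicator (cball 0 \<rho>) \<zeta> * (norm \<zeta> ^ (2 * n) * v \<zeta>) \<partial>disc_area)"]] by (simp cong: if_cong)
  qed
  have "(\<lambda>k. \<integral>\<zeta>. indicator (cball 0 (radii k)) \<zeta> * (f \<zeta> * of_real (v \<zeta>) * cnj \<zeta> ^ n) \<partial>disc_area) \<longlonglongrightarrow> (\<integral>\<zeta>. f \<zeta> * of_real (v \<zeta>) * cnj \<zeta> ^ n \<partial>disc_area)"
    by (rule tendsto_integral_cball[OF int1])
  moreover have "(\<lambda>k. \<integral>\<zeta>. indicator (cball 0 (radii k)) \<zeta> * (f \<zeta> * of_real (v \<zeta>) * cnj \<zeta> ^ n) \<partial>disc_area) \<longlonglongrightarrow> a n * of_real (omega n)"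
    unfolding eq[OF radii] omega_def by (intro tendsto_intros tendsto_integral_cball integrable_power_v)
  ultimately show ?thesis by (rule LIMSEQ_unique)
qed

text \<open>For fixed \<open>z\<close> the kernel series has the majorant
  \<open>norm z ^ n / omega n\<close>, uniform in \<open>\<zeta>\<close>, so integration against
  \<open>f * v\<close> is termwise.\<close>

lemma proj_series:
  assumes i: "integrable disc_area (\<lambda>z. f z * of_real (v z))" and z: "norm z < 1"
  shows "(\<lambda>n. (\<integral>\<zeta>. f \<zeta> * of_real (v \<zeta>) * cnj \<zeta> ^ n \<partial>disc_area) / of_real (omega n) * z ^ n) sums proj f z"
    and "integrable disc_area (\<lambda>\<zeta>. f \<zeta> * of_real (v \<zeta>) * ker z \<zeta>)"
proof -
  have 1: "summable (\<lambda>n. norm z ^ n / omega n)" by (rule summable_power_omega) (use z in auto)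
  have 2: "(\<lambda>\<zeta>. (z * cnj \<zeta>) ^ n / of_real (omega n)) \<in> borel_measurable disc_area" for n
    by (rule measurable_disc_areaI) measurable
  have 3: "norm ((z * cnj \<zeta>) ^ n / complex_of_real (omega n)) \<le> norm z ^ n / omega n" if "norm \<zeta> < 1" for n \<zeta>
  proof -
    have "norm z * norm \<zeta> \<le> norm z" using that by (intro mult_left_le) auto
    then have "(norm z * norm \<zeta>) ^ n / omega n \<le> norm z ^ n / omega n"
      using omega_pos[of n] by (intro divide_right_mono power_mono) auto
    then show ?thesis using omega_pos[of n] by (simp add: norm_divide norm_power norm_mult)
  qed
  have eq: "(\<integral>\<zeta>. f \<zeta> * of_real (v \<zeta>) * ((z * cnj \<zeta>) ^ n / of_real (omega n)) \<partial>disc_area) = (\<integral>\<zeta>. f \<zeta> * of_real (v \<zeta>) * cnj \<zeta> ^ n \<partial>disc_area) / of_real (omega n) * z ^ n" for n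
  proof -
    have *: "(\<lambda>\<zeta>. f \<zeta> * of_real (v \<zeta>) * ((z * cnj \<zeta>) ^ n / of_real (omega n))) = (\<lambda>\<zeta>. (z ^ n / of_real (omega n)) * (f \<zeta> * of_real (v \<zeta>) * cnj \<zeta> ^ n))"
      by (simp add: fun_eq_iff power_mult_distrib)
    show ?thesis unfolding * integral_mult_right_zero by simp
  qed
  show "(\<lambda>n. (\<integral>\<zeta>. f \<zeta> * of_real (v \<zeta>) * cnj \<zeta> ^ n \<partial>disc_area) / of_real (omega n) * z ^ n) sums proj f z"
    using integral_disc_sums(1)[OF i 2 3 1] z unfolding eq by (simp add: proj_def ker_def)
  show "integrable disc_area (\<lambda>\<zeta>. f \<zeta> * of_real (v \<zeta>) * ker z \<zeta>)"
    using integral_disc_sums(2)[OF i 2 3 1] by (simp add: ker_def)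
qed

text \<open>The Taylor coefficients agree: \<open>proj_series\<close> divides by the
  \<open>omega n\<close> that \<open>integral_times_monomial\<close> produces.\<close>

theorem proj_reproduces:
  assumes f: "f \<in> disc_analytic" and i: "integrable disc_area (\<lambda>z. norm (f z) * s z)"
  shows "proj f = f"
proof
  fix z
  show "proj f z = f z"
  proof (cases "norm z < 1")
    case False then show ?thesis using f by (simp add: proj_def disc_analytic_def)
  next
    case True
    have "f holomorphic_on ball 0 1" using f by (simp add: disc_analytic_def)
    then obtain a where
      a: "\<And>z. norm z < 1 \<Longrightarrow> (\<lambda>n. a n * z ^ n) sums f z" "\<And>\<rho>. 0 \<le> \<rho> \<Longrightarrow> \<rho> < 1 \<Longrightarrow> summable (\<lambda>n. norm (a n) * \<rho> ^ n)"
      by (rule holomorphic_disc_series) (rule that)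
    have c: "(\<integral>\<zeta>. f \<zeta> * of_real (v \<zeta>) * cnj \<zeta> ^ n \<partial>disc_area) = a n * of_real (omega n)" for n
      by (rule integral_times_monomial[OF f i a])
    have "(\<lambda>n. (\<integral>\<zeta>. f \<zeta> * of_real (v \<zeta>) * cnj \<zeta> ^ n \<partial>disc_area) / of_real (omega n) * z ^ n) sums proj f z"
      by (rule proj_series(1)[OF integrable_times_v[OF disc_analytic_measurable[OF f] i] True])
    also have "(\<lambda>n. (\<integral>\<zeta>. f \<zeta> * of_real (v \<zeta>) * cnj \<zeta> ^ n \<partial>disc_area) / of_real (omega n) * z ^ n) = (\<lambda>n. a n * z ^ n)"
    proof
      fix n
      show "(\<integral>\<zeta>. f \<zeta> * of_real (v \<zeta>) * cnj \<zeta> ^ n \<partial>disc_area) / of_real (omega n) * z ^ n = a n * z ^ n"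
        unfolding c using omega_pos[of n] by simp
    qed
    finally show ?thesis using a(1)[OF True] by (rule sums_unique2)
  qed
qed

end

subsection \<open>Representation of functionals\<close>

text \<open>The bound on \<open>NY g\<close> is asked for every admissible \<open>K\<close>: with
  the dual norm for \<open>K\<close> it becomes the lower norm estimate. The upper one is the bound
  on \<open>B\<close>, with constant \<open>1\<close>.\<close>

lemma is_dual_underI:
  fixes X :: "('a \<Rightarrow> complex) set" and Y :: "('b \<Rightarrow> complex) set"
  assumes X0: "(\<lambda>_. 0) \<in> X"
    and X_add: "\<And>f g. f \<in> X \<Longrightarrow> g \<in> X \<Longrightarrow> (\<lambda>z. f z + g z) \<in> X"
    and X_scale: "\<And>c f. f \<in> X \<Longrightarrow> (\<lambda>z. c * f z) \<in> X"
    and NX_scale: "\<And>c f. f \<in> X \<Longrightarrow> NX (\<lambda>z. c * f z) = norm c * NX f"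
    and NX_nonneg: "\<And>f. f \<in> X \<Longrightarrow> NX f \<ge> 0" and NY_nonneg: "\<And>g. g \<in> Y \<Longrightarrow> NY g \<ge> 0"
    and B_add: "\<And>f g h. f \<in> X \<Longrightarrow> g \<in> Y \<Longrightarrow> h \<in> Y \<Longrightarrow> B f (\<lambda>z. g z + h z) = B f g + B f h"
    and B_scale: "\<And>c f g. f \<in> X \<Longrightarrow> g \<in> Y \<Longrightarrow> B f (\<lambda>z. c * g z) = cnj c * B f g"
    and B_add_left: "\<And>f g h. f \<in> X \<Longrightarrow> g \<in> X \<Longrightarrow> h \<in> Y \<Longrightarrow> B (\<lambda>z. f z + g z) h = B f h + B g h"
    and B_scale_left: "\<And>c f g. f \<in> X \<Longrightarrow> g \<in> Y \<Longrightarrow> B (\<lambda>z. c * f z) g = c * B f g"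
    and bound: "\<And>f g. f \<in> X \<Longrightarrow> g \<in> Y \<Longrightarrow> norm (B f g) \<le> NX f * NY g"
    and inj: "\<And>g h. g \<in> Y \<Longrightarrow> h \<in> Y \<Longrightarrow> (\<And>f. f \<in> X \<Longrightarrow> B f g = B f h) \<Longrightarrow> g = h"
    and repr: "\<And>\<phi>. \<phi> \<in> dual_space X NX \<Longrightarrow> \<exists>g\<in>Y. (\<forall>f\<in>X. \<phi> f = B f g) \<and>
      (\<forall>K\<ge>0. (\<forall>f\<in>X. norm (\<phi> f) \<le> K * NX f) \<longrightarrow> NY g \<le> M * K)"
    and M: "M > 0"
  shows "is_dual_under X NX Y NY B"
proof -
  define F where "F g = restrict (\<lambda>f. B f g) X" for g
  have F: "F g \<in> dual_space X NX" if g: "g \<in> Y" for g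
    unfolding dual_space_def F_def
    using X_add X_scale B_add_left[OF _ _ g] B_scale_left[OF _ g] bound[OF _ g]
    by (auto intro!: exI[of _ "NY g"] simp: mult.commute)
  have NX0: "NX (\<lambda>_. 0) = 0" using NX_scale[OF X0, of 0] by simp
  have ball: "{f \<in> X. NX f \<le> 1} \<noteq> {}" using X0 NX0 by auto
  have le: "norm (F g f) \<le> NY g" if "g \<in> Y" "f \<in> {f \<in> X. NX f \<le> 1}" for f g
  proof -
    have "norm (F g f) \<le> NX f * NY g" using that bound by (simp add: F_def)
    also have "\<dots> \<le> 1 * NY g" using that NY_nonneg by (intro mult_right_mono) auto
    finally show ?thesis by simp
  qed
  have upper: "dual_norm X NX (F g) \<le> 1 * NY g" if "g \<in> Y" for g
    unfolding dual_norm_def mult_1 by (rule cSUP_least[OF ball le[OF that]])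
  have dn: "norm (F g f) \<le> dual_norm X NX (F g) * NX f" if g: "g \<in> Y" and f: "f \<in> X" for f g
  proof (cases "NX f = 0")
    case True
    then show ?thesis using bound[OF f g] f by (simp add: F_def)
  next
    case False
    then have pos: "NX f > 0" using NX_nonneg[OF f] by simp
    define c where "c = complex_of_real (1 / NX f)"
    have c: "norm c = 1 / NX f" using pos by (simp add: c_def norm_divide)
    define f' where "f' = (\<lambda>z. c * f z)"
    have f': "f' \<in> X" "NX f' = 1" unfolding f'_def using f pos X_scale[OF f] NX_scale[OF f] c by auto
    have "norm (F g f') \<le> dual_norm X NX (F g)"
      unfolding dual_norm_def
      by (rule cSUP_upper) (use f' in simp, rule bdd_aboveI2[OF le[OF g]])
    moreover have "norm (F g f') = norm (F g f) / NX f"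
    proof -
      have "F g f' = c * F g f" using f f'(1) B_scale_left[OF f g, of c] by (simp add: F_def f'_def)
      then show ?thesis by (simp add: norm_mult c)
    qed
    ultimately show ?thesis using pos by (simp add: field_simps)
  qed
  have rep: "\<exists>h\<in>Y. F h = \<phi> \<and> (\<forall>K\<ge>0. (\<forall>f\<in>X. norm (\<phi> f) \<le> K * NX f) \<longrightarrow> NY h \<le> M * K)" if \<phi>: "\<phi> \<in> dual_space X NX" for \<phi>
  proof -
    obtain h where h: "h \<in> Y" "\<forall>f\<in>X. \<phi> f = B f h" "\<forall>K\<ge>0. (\<forall>f\<in>X. norm (\<phi> f) \<le> K * NX f) \<longrightarrow> NY h \<le> M * K"
      using repr[OF \<phi>] by blast
    have "\<phi> \<in> extensional X" using \<phi> by (simp add: dual_space_def)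
    then have "F h = \<phi>" unfolding F_def using h(2) by (intro extensionalityI[of _ X]) auto
    with h show ?thesis by blast
  qed
  have F_inj: "g = h" if "g \<in> Y" "h \<in> Y" "F g = F h" for g h
  proof (rule inj[OF that(1,2)])
    fix f assume "f \<in> X"
    then show "B f g = B f h" using fun_cong[OF that(3), of f] by (simp add: F_def)
  qed
  \<comment> \<open>The functional \<open>F g\<close> is represented anew by some \<open>h\<close>
    with controlled norm, and injectivity gives \<open>h = g\<close>.\<close>
  have lower: "1 / M * NY g \<le> dual_norm X NX (F g)" if g: "g \<in> Y" for g
  proof -
    obtain h where h: "h \<in> Y" "F h = F g" "\<forall>K\<ge>0. (\<forall>f\<in>X. norm (F g f) \<le> K * NX f) \<longrightarrow> NY h \<le> M * K"
      using rep[OF F[OF g]] by blast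
    have "h = g" by (rule F_inj) (use h g in auto)
    have "0 \<le> norm (F g (\<lambda>_. 0))" by simp
    also have "\<dots> \<le> dual_norm X NX (F g)" unfolding dual_norm_def
      by (rule cSUP_upper) (use X0 NX0 in simp, rule bdd_aboveI2[OF le[OF g]])
    finally have "NY g \<le> M * dual_norm X NX (F g)" using h(3) dn[OF g] \<open>h = g\<close> by blast
    then show ?thesis using M by (simp add: field_simps)
  qed
  have "bij_betw F Y (dual_space X NX)"
    unfolding bij_betw_def
  proof
    show "inj_on F Y" by (rule inj_onI) (rule F_inj)
    show "F ` Y = dual_space X NX" using F rep by blast
  qed
  then have 1: "bij_betw (\<lambda>g. restrict (\<lambda>f. B f g) X) Y (dual_space X NX)" by (simp only: F_def[symmetric])
  have 2: "\<exists>c>0. \<exists>C>0. \<forall>g\<in>Y. c * NY g \<le> dual_norm X NX (F g) \<and> dual_norm X NX (F g) \<le> C * NY g"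
    by (rule exI[of _ "1 / M"], rule conjI, use M in simp, rule exI[of _ 1]) (use lower upper in auto)
  show ?thesis unfolding is_dual_under_def
    using B_add B_scale 1 2[unfolded F_def] by blast
qed

text \<open>Young's inequality applied to \<open>F / a\<close> and \<open>G / b\<close>. Stating it
  with positive upper bounds instead of the norms spares a separate treatment of functions of norm
  zero.\<close>

lemma holder_nn:
  fixes F G :: "'a \<Rightarrow> real"
  assumes [measurable]: "F \<in> borel_measurable M" "G \<in> borel_measurable M"
    and nn: "\<And>x. x \<in> space M \<Longrightarrow> F x \<ge> 0" "\<And>x. x \<in> space M \<Longrightarrow> G x \<ge> 0"
    and pq: "p > 1" "q > 1" "1 / p + 1 / q = 1" and ab: "a > 0" "b > 0"
    and FA: "(\<integral>\<^sup>+x. ennreal (F x powr p) \<partial>M) \<le> ennreal (a powr p)"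
    and GB: "(\<integral>\<^sup>+x. ennreal (G x powr q) \<partial>M) \<le> ennreal (b powr q)"
  shows "(\<integral>\<^sup>+x. ennreal (F x * G x) \<partial>M) \<le> ennreal (a * b)"
proof -
  define c where "c = a * b / (p * a powr p)"
  define d where "d = a * b / (q * b powr q)"
  have cd: "c \<ge> 0" "d \<ge> 0" using pq ab by (auto simp: c_def d_def)
  have "(\<integral>\<^sup>+x. ennreal (F x * G x) \<partial>M) \<le> (\<integral>\<^sup>+x. ennreal c * ennreal (F x powr p) + ennreal d * ennreal (G x powr q) \<partial>M)"
  proof (rule nn_integral_mono)
    fix x assume x: "x \<in> space M"
    have "(F x / a) * (G x / b) \<le> (F x / a) powr p / p + (G x / b) powr q / q"
      by (rule Youngs_inequality) (use pq nn[OF x] ab in auto)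
    then have "(a * b) * ((F x / a) * (G x / b)) \<le> (a * b) * ((F x / a) powr p / p + (G x / b) powr q / q)"
      using ab by (intro mult_left_mono) auto
    also have "\<dots> = c * F x powr p + d * G x powr q"
      using ab nn[OF x] by (simp add: c_def d_def powr_divide distrib_left mult_ac)
    finally have "F x * G x \<le> c * F x powr p + d * G x powr q" using ab by simp
    then have "ennreal (F x * G x) \<le> ennreal (c * F x powr p + d * G x powr q)" by (rule ennreal_leI)
    also have "\<dots> = ennreal c * ennreal (F x powr p) + ennreal d * ennreal (G x powr q)"
      using cd by (simp add: ennreal_plus ennreal_mult)
    finally show "ennreal (F x * G x) \<le> ennreal c * ennreal (F x powr p) + ennreal d * ennreal (G x powr q)" .
  qed
  also have "\<dots> = ennreal c * (\<integral>\<^sup>+x. ennreal (F x powr p) \<partial>M) + ennreal d * (\<integral>\<^sup>+x. ennreal (G x powr q) \<partial>M)"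
    by (simp add: nn_integral_add nn_integral_cmult)
  also have "\<dots> \<le> ennreal c * ennreal (a powr p) + ennreal d * ennreal (b powr q)"
    by (intro add_mono mult_left_mono FA GB) auto
  also have "\<dots> = ennreal (c * a powr p + d * b powr q)" using cd by (simp add: ennreal_plus ennreal_mult)
  also have "c * a powr p + d * b powr q = a * b * (1 / p + 1 / q)"
    using ab by (simp add: c_def d_def distrib_left)
  finally show ?thesis using pq by simp
qed

lemma conjugate_exponent:
  fixes p q :: real
  assumes p: "p > 1" and pq: "1 / p + 1 / q = 1"
  shows "q > 1" "(q - 1) * p = q"
proof -
  have "0 < 1 / p" "1 / p < 1" using p by auto
  then have *: "0 < 1 / q" "1 / q < 1" using pq by linarith+
  then have "q > 0" by (simp only: zero_less_divide_1_iff)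
  then show "q > 1" using *(2) by (simp add: divide_less_eq_1)
  have "q * p * (1 / p + 1 / q) = q * p" by (simp only: pq)
  then have "q + p = q * p" using p \<open>q > 0\<close> by (simp add: distrib_left)
  then show "(q - 1) * p = q" by (simp add: algebra_simps)
qed

lemma disc_analytic_cong:
  "f \<in> disc_analytic \<Longrightarrow> g \<in> disc_analytic \<Longrightarrow> (\<And>z. norm z < 1 \<Longrightarrow> f z = g z) \<Longrightarrow> f = g"
proof
  fix z
  assume "f \<in> disc_analytic" "g \<in> disc_analytic" "\<And>z. norm z < 1 \<Longrightarrow> f z = g z"
  then show "f z = g z" by (cases "norm z < 1") (auto simp: disc_analytic_def)
qed

lemma disc_analytic_extend:
  assumes "f holomorphic_on unit_disc"
  shows "(\<lambda>z. if norm z < 1 then f z else 0) \<in> disc_analytic"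
proof -
  have "(\<lambda>z. if norm z < 1 then f z else 0) holomorphic_on unit_disc"
    by (rule holomorphic_transform[OF assms]) simp
  then show ?thesis by (simp add: disc_analytic_def)
qed

lemma disc_analytic_add: "f \<in> disc_analytic \<Longrightarrow> g \<in> disc_analytic \<Longrightarrow> (\<lambda>z. f z + g z) \<in> disc_analytic"
  by (simp add: disc_analytic_def holomorphic_on_add)

lemma disc_analytic_scale: "f \<in> disc_analytic \<Longrightarrow> (\<lambda>z. c * f z) \<in> disc_analytic"
  by (simp add: disc_analytic_def holomorphic_on_mult)

lemma disc_analytic_series:
  assumes "\<And>\<rho>. 0 \<le> \<rho> \<Longrightarrow> \<rho> < 1 \<Longrightarrow> summable (\<lambda>n. norm (c n) * \<rho> ^ n)"
  shows "(\<lambda>z. if norm z < 1 then \<Sum>n. c n * z ^ n else 0) \<in> disc_analytic"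
proof (rule disc_analytic_extend, rule power_series_holomorphic[where a=c])
  fix w :: complex assume w: "w \<in> unit_disc"
  have "summable (\<lambda>n. norm (c n * w ^ n))" using assms[of "norm w"] w by (simp add: norm_mult norm_power)
  then show "(\<lambda>n. c n * (w - 0) ^ n) sums (\<Sum>n. c n * w ^ n)"
    using summable_norm_cancel summable_sums by fastforce
qed

context exp_disc
begin

section \<open>The spaces \<open>Ap p\<close> and their norms\<close>

abbreviation Ap :: "real \<Rightarrow> (complex \<Rightarrow> complex) set" where "Ap p \<equiv> bergman p (\<lambda>z. v z powr (p / 2))"
abbreviation Np :: "real \<Rightarrow> (complex \<Rightarrow> complex) \<Rightarrow> real" where "Np p \<equiv> bergman_norm p (\<lambda>z. v z powr (p / 2))"

text \<open>As \<open>v = s\<^sup>2\<close>, the weight \<open>v powr (p / 2)\<close> is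
  \<open>s powr p\<close>; the norm of \<open>Ap p\<close> is therefore that of
  \<open>L^p(s^p)\<close>, on which the projection is bounded.\<close>

lemma norm_powr_weight: "norm (f z) powr p * v z powr (p / 2) = (norm (f z) * s z) powr p"
proof -
  have "v z powr (p / 2) = (s z powr 2) powr (p / 2)" using powr_realpow[of "s z" 2] by (simp add: s_square)
  also have "\<dots> = s z powr p" by (simp only: powr_powr) simp
  finally show ?thesis by (simp add: powr_mult less_imp_le)
qed

lemma powr_s_measurable: "f \<in> disc_analytic \<Longrightarrow> (\<lambda>z. (norm (f z) * s z) powr p) \<in> borel_measurable disc_area"
  using disc_analytic_measurable[of f] s_disc_measurable by measurable

lemma Ap_iff: "f \<in> Ap p \<longleftrightarrow> f \<in> disc_analytic \<and> wlp p f < \<infinity>"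
proof (cases "f \<in> disc_analytic")
  case True
  then show ?thesis
    using powr_s_measurable[OF True, of p]
    by (simp add: bergman_def norm_powr_weight integrable_iff_bounded wlp_def)
qed (simp add: bergman_def)

lemma Np_eq: "f \<in> disc_analytic \<Longrightarrow> Np p f = enn2real (wlp p f) powr (1 / p)"
  unfolding bergman_norm_def norm_powr_weight wlp_def
  using powr_s_measurable[of f p] by (subst integral_eq_nn_integral) auto

lemma Np_nonneg: "Np p f \<ge> 0" by (simp add: bergman_norm_def)

lemma wlp_eq: "f \<in> Ap p \<Longrightarrow> p \<ge> 1 \<Longrightarrow> wlp p f = ennreal (Np p f powr p)"
  by (simp add: Np_eq Ap_iff powr_powr)

lemma Ap_leI:
  assumes "f \<in> disc_analytic" "wlp p f \<le> ennreal (c powr p)" "c \<ge> 0" "p \<ge> 1"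
  shows "f \<in> Ap p" "Np p f \<le> c"
proof -
  show "f \<in> Ap p" using assms by (auto simp: Ap_iff intro: le_less_trans)
  have "enn2real (wlp p f) \<le> c powr p" using assms(2) by (rule enn2real_leI[rotated]) simp
  then have "enn2real (wlp p f) powr (1 / p) \<le> (c powr p) powr (1 / p)"
    using assms by (intro powr_mono2) auto
  then show "Np p f \<le> c" using assms by (simp add: Np_eq powr_powr)
qed

lemma Ap_bounded:
  assumes f: "f \<in> disc_analytic" and c: "\<And>z. norm z < 1 \<Longrightarrow> norm (f z) \<le> c" and p: "p \<ge> 1"
  shows "f \<in> Ap p" "Np p f \<le> c"
proof -
  have c0: "c \<ge> 0" using order_trans[OF norm_ge_zero c[of 0]] by simp
  have "wlp p f \<le> (\<integral>\<^sup>+z. ennreal (c powr p) \<partial>disc_area)"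
    unfolding wlp_def
  proof (intro nn_integral_mono ennreal_leI powr_mono2)
    fix z assume "z \<in> space disc_area"
    then have "norm (f z) * s z \<le> c * 1" using c[of z] s_le_1[of z] c0 by (intro mult_mono) (auto simp: less_imp_le)
    then show "norm (f z) * s z \<le> c" by simp
  qed (use p in \<open>auto simp: less_imp_le\<close>)
  also have "\<dots> = ennreal (c powr p)" using emeasure_disc_area_space by simp
  finally show "f \<in> Ap p" "Np p f \<le> c" using Ap_leI[OF f _ c0 p] by auto
qed

text \<open>\<open>(a + b) powr p \<le> 2 powr p * (a powr p + b powr p)\<close>, from
  \<open>a + b \<le> 2 * max a b\<close>.\<close>

lemma Ap_add:
  assumes "f \<in> Ap p" "g \<in> Ap p" "p \<ge> 1"
  shows "(\<lambda>z. f z + g z) \<in> Ap p"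
proof -
  have fg: "f \<in> disc_analytic" "g \<in> disc_analytic" using assms by (auto simp: Ap_iff)
  have "wlp p (\<lambda>z. f z + g z) \<le> (\<integral>\<^sup>+z. ennreal (2 powr p) * (ennreal ((norm (f z) * s z) powr p) + ennreal ((norm (g z) * s z) powr p)) \<partial>disc_area)"
    unfolding wlp_def
  proof (rule nn_integral_mono)
    fix z
    let ?a = "norm (f z) * s z" and ?b = "norm (g z) * s z"
    have ab: "0 \<le> ?a" "0 \<le> ?b" by (auto simp: less_imp_le)
    have "norm (f z + g z) * s z \<le> (norm (f z) + norm (g z)) * s z" by (intro mult_right_mono norm_triangle_ineq) (simp add: less_imp_le)
    also have "\<dots> \<le> 2 * max ?a ?b" by (simp add: distrib_right)
    finally have "(norm (f z + g z) * s z) powr p \<le> (2 * max ?a ?b) powr p"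
      using assms(3) by (intro powr_mono2) (auto simp: less_imp_le)
    also have "\<dots> = 2 powr p * max ?a ?b powr p" using ab by (intro powr_mult)
    also have "max ?a ?b powr p \<le> ?a powr p + ?b powr p" by (simp add: max_def)
    finally have "(norm (f z + g z) * s z) powr p \<le> 2 powr p * (?a powr p + ?b powr p)" by simp
    then have "ennreal ((norm (f z + g z) * s z) powr p) \<le> ennreal (2 powr p * (?a powr p + ?b powr p))" by (rule ennreal_leI)
    then show "ennreal ((norm (f z + g z) * s z) powr p) \<le> ennreal (2 powr p) * (ennreal (?a powr p) + ennreal (?b powr p))"
      by (simp add: ennreal_mult ennreal_plus)
  qed
  also have "\<dots> = ennreal (2 powr p) * (wlp p f + wlp p g)"
    unfolding wlp_def using powr_s_measurable[OF fg(1), of p] powr_s_measurable[OF fg(2), of p]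
    by (simp add: nn_integral_cmult nn_integral_add)
  also have "\<dots> < \<infinity>" using assms by (auto simp: Ap_iff ennreal_mult_less_top)
  finally show ?thesis using fg by (simp add: Ap_iff disc_analytic_add)
qed

lemma wlp_scale:
  assumes "f \<in> disc_analytic" shows "wlp p (\<lambda>z. c * f z) = ennreal (norm c powr p) * wlp p f"
proof -
  have "wlp p (\<lambda>z. c * f z) = (\<integral>\<^sup>+z. ennreal (norm c powr p) * ennreal ((norm (f z) * s z) powr p) \<partial>disc_area)"
    unfolding wlp_def by (intro nn_integral_cong) (simp add: norm_mult mult.assoc powr_mult ennreal_mult[symmetric] less_imp_le)
  also have "\<dots> = ennreal (norm c powr p) * wlp p f"
    unfolding wlp_def by (rule nn_integral_cmult) (use powr_s_measurable[OF assms, of p] in simp)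
  finally show ?thesis .
qed

lemma Ap_scale: "f \<in> Ap p \<Longrightarrow> (\<lambda>z. c * f z) \<in> Ap p"
  by (auto simp: Ap_iff wlp_scale disc_analytic_scale ennreal_mult_less_top)

lemma Np_scale: "f \<in> Ap p \<Longrightarrow> p \<ge> 1 \<Longrightarrow> Np p (\<lambda>z. c * f z) = norm c * Np p f"
  by (simp add: Np_eq Ap_iff wlp_scale disc_analytic_scale enn2real_mult powr_mult powr_powr)

lemma Ap_0: "p \<ge> 1 \<Longrightarrow> (\<lambda>_. 0) \<in> Ap p"
  by (rule Ap_bounded[where c=0]) (auto simp: disc_analytic_def)

text \<open>Jensen's inequality on the probability measure \<open>disc_area\<close>, with constant
  density \<open>1\<close>. It places every \<open>Ap p\<close> inside \<open>L^1(s)\<close>, where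
  the reproducing formula holds.\<close>

lemma Ap_integrable_s:
  assumes "f \<in> Ap p" "p \<ge> 1"
  shows "integrable disc_area (\<lambda>z. norm (f z) * s z)"
proof -
  have fm: "f \<in> borel_measurable disc_area" using assms by (simp add: Ap_iff disc_analytic_measurable)
  have m: "(\<lambda>z. norm (f z) * s z) \<in> borel_measurable disc_area" using fm s_disc_measurable by measurable
  have "\<exists>B\<ge>0. (\<integral>\<^sup>+z. ennreal (1 * (norm (f z) * s z)) \<partial>disc_area) = ennreal B \<and> B powr p \<le> 1 powr (p - 1) * Np p f powr p"
  proof (rule weighted_powr_mean)
    show "(\<integral>\<^sup>+z. ennreal (1 * (norm (f z) * s z) powr p) \<partial>disc_area) \<le> ennreal (Np p f powr p)"
      using wlp_eq[OF assms] by (simp add: wlp_def)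
    show "(\<integral>\<^sup>+z. ennreal 1 \<partial>disc_area) \<le> ennreal 1" using emeasure_disc_area_space by simp
  qed (use assms m in \<open>auto simp: less_imp_le\<close>)
  then obtain B where B: "(\<integral>\<^sup>+z. ennreal (norm (f z) * s z) \<partial>disc_area) = ennreal B" by auto
  show ?thesis using m B by (simp add: integrable_iff_bounded less_imp_le abs_mult)
qed

text \<open>The kernel as an element of the spaces, with the base point \<open>w\<close> as first
  argument.\<close>

definition disc_kernel :: "complex \<Rightarrow> complex \<Rightarrow> complex" where
  "disc_kernel w z = (if norm z < 1 then ker z w else 0)"

lemma disc_kernel_Ap: "norm w < 1 \<Longrightarrow> p \<ge> 1 \<Longrightarrow> disc_kernel w \<in> Ap p"
  unfolding disc_kernel_def
  by (rule Ap_bounded[where c="\<Sum>n. norm w ^ n / omega n"])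
     (auto intro!: disc_analytic_extend ker_holomorphic norm_ker_le)

text \<open>The reproducing formula, conjugated. It makes the map from \<open>g\<close> to its
  functional injective.\<close>

lemma pairing_disc_kernel:
  assumes g: "g \<in> disc_analytic" "integrable disc_area (\<lambda>z. norm (g z) * s z)" and w: "norm w < 1"
  shows "weighted_pairing v (disc_kernel w) g = cnj (g w)"
proof -
  have "cnj (g w) = cnj (proj g w)" by (simp add: proj_reproduces[OF g])
  also have "\<dots> = (\<integral>z. cnj (g z * of_real (v z) * ker w z) \<partial>disc_area)"
    using w by (simp add: proj_def del: complex_cnj_mult)
  also have "\<dots> = weighted_pairing v (disc_kernel w) g"
    unfolding weighted_pairing_def
    by (rule Bochner_Integration.integral_cong) (use w in \<open>simp_all add: disc_kernel_def ker_cnj mult_ac\<close>)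
  finally show ?thesis by simp
qed

definition disc_power :: "nat \<Rightarrow> complex \<Rightarrow> complex" where
  "disc_power n z = (if norm z < 1 then z ^ n else 0)"

lemma disc_power_Ap: "p \<ge> 1 \<Longrightarrow> disc_power n \<in> Ap p" and Np_disc_power: "p \<ge> 1 \<Longrightarrow> Np p (disc_power n) \<le> 1"
  unfolding disc_power_def
  by (rule Ap_bounded[where c=1]; simp add: disc_analytic_extend holomorphic_on_power norm_power power_le_one)+

end

section \<open>Representation of one fixed bounded functional\<close>

text \<open>The representative is constructed for all \<open>p \<ge> 1\<close> at once;
  \<open>p = 1\<close> and \<open>p > 1\<close> separate only in the estimate of its norm.\<close>

locale bergman_functional = exp_disc +
  fixes p :: real and \<phi> :: "(complex \<Rightarrow> complex) \<Rightarrow> complex"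
  assumes p: "p \<ge> 1" and \<phi>: "\<phi> \<in> dual_space (Ap p) (Np p)"
begin

lemma \<phi>_add: "f \<in> Ap p \<Longrightarrow> g \<in> Ap p \<Longrightarrow> \<phi> (\<lambda>z. f z + g z) = \<phi> f + \<phi> g"
  and \<phi>_scale: "f \<in> Ap p \<Longrightarrow> \<phi> (\<lambda>z. c * f z) = c * \<phi> f"
  using \<phi> by (auto simp: dual_space_def)

lemma \<phi>_bounded: obtains C where "C \<ge> 0" "\<And>f. f \<in> Ap p \<Longrightarrow> norm (\<phi> f) \<le> C * Np p f"
proof -
  obtain C where C: "\<forall>f\<in>Ap p. norm (\<phi> f) \<le> C * Np p f" using \<phi> by (auto simp: dual_space_def)
  have "norm (\<phi> f) \<le> \<bar>C\<bar> * Np p f" if "f \<in> Ap p" for f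
  proof -
    have "norm (\<phi> f) \<le> C * Np p f" using C that by blast
    also have "\<dots> \<le> \<bar>C\<bar> * Np p f" by (intro mult_right_mono Np_nonneg) simp
    finally show ?thesis .
  qed
  then show ?thesis by (intro that[of "\<bar>C\<bar>"]) auto
qed

lemma \<phi>_disc_power_bounded: obtains D where "\<And>n. norm (\<phi> (disc_power n)) \<le> D"
proof -
  obtain C where C: "C \<ge> 0" "\<And>f. f \<in> Ap p \<Longrightarrow> norm (\<phi> f) \<le> C * Np p f" by (rule \<phi>_bounded) (rule that)
  have "norm (\<phi> (disc_power n)) \<le> C * 1" for n
    using C(2)[OF disc_power_Ap[OF p]] mult_left_mono[OF Np_disc_power[OF p] C(1)] order_trans by blast
  then show ?thesis using that by blast
qed

text \<open>Absolutely summable coefficients give uniform convergence on the disc, hence convergence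
  in \<open>Ap p\<close>, so the bounded functional applies term by term.\<close>

lemma \<phi>_series:
  assumes c: "summable (\<lambda>n. norm (c n))"
    and F: "F = (\<lambda>z. if norm z < 1 then \<Sum>n. c n * z ^ n else 0)"
  shows "F \<in> Ap p" "(\<lambda>n. c n * \<phi> (disc_power n)) sums \<phi> F"
proof -
  obtain C where C: "C \<ge> 0" "\<And>f. f \<in> Ap p \<Longrightarrow> norm (\<phi> f) \<le> C * Np p f" by (rule \<phi>_bounded) (rule that)
  have le: "norm (c n * z ^ n) \<le> norm (c n)" if "norm z < 1" for n z
    using that by (simp add: norm_mult norm_power power_le_one mult_left_le)
  have sm: "summable (\<lambda>n. norm (c n * z ^ n))" if "norm z < 1" for z
    by (rule summable_comparison_test'[OF c, of 0]) (use le[OF that] in simp)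
  have an: "F \<in> disc_analytic" unfolding F
  proof (rule disc_analytic_series)
    fix \<rho> :: real assume \<rho>: "0 \<le> \<rho>" "\<rho> < 1"
    show "summable (\<lambda>n. norm (c n) * \<rho> ^ n)" using sm[of "of_real \<rho>"] \<rho> by (simp add: norm_mult norm_power)
  qed
  have Fb: "norm (F z) \<le> (\<Sum>n. norm (c n))" if "norm z < 1" for z
    unfolding F using that by (simp add: order_trans[OF summable_norm[OF sm[OF that]] suminf_le[OF le[OF that] sm[OF that] c]])
  show FA: "F \<in> Ap p" by (rule Ap_bounded(1)[OF an Fb p])
  define S where "S N = (\<lambda>z. \<Sum>n<N. c n * disc_power n z)" for N
  have S: "S N \<in> Ap p \<and> \<phi> (S N) = (\<Sum>n<N. c n * \<phi> (disc_power n))" for N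
  proof (induction N)
    case 0
    have "\<phi> (\<lambda>z. 0 * disc_power 0 z) = 0 * \<phi> (disc_power 0)" by (rule \<phi>_scale[OF disc_power_Ap[OF p]])
    then show ?case using Ap_0[OF p] by (simp add: S_def)
  next
    case (Suc N)
    have eq: "S (Suc N) = (\<lambda>z. S N z + (\<lambda>z. c N * disc_power N z) z)" by (simp add: S_def)
    have m: "(\<lambda>z. c N * disc_power N z) \<in> Ap p" by (rule Ap_scale[OF disc_power_Ap[OF p]])
    have "\<phi> (S (Suc N)) = \<phi> (S N) + \<phi> (\<lambda>z. c N * disc_power N z)"
      unfolding eq by (rule \<phi>_add) (use Suc m in auto)
    moreover have "S (Suc N) \<in> Ap p" unfolding eq using Ap_add[OF _ m p] Suc by blast
    ultimately show ?case using Suc \<phi>_scale[OF disc_power_Ap[OF p]] by simp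
  qed
  define R where "R N = (\<lambda>z. F z + (-1) * S N z)" for N
  have mS: "(\<lambda>z. (-1) * S N z) \<in> Ap p" for N using S Ap_scale by blast
  have R: "R N \<in> Ap p" for N unfolding R_def by (rule Ap_add[OF FA mS p])
  have \<phi>R: "\<phi> (R N) = \<phi> F - (\<Sum>n<N. c n * \<phi> (disc_power n))" for N
    unfolding R_def using \<phi>_add[OF FA mS] \<phi>_scale[of "S N" "-1"] S by simp
  have NR: "Np p (R N) \<le> (\<Sum>n. norm (c (n + N)))" for N
  proof (rule Ap_bounded(2)[OF _ _ p])
    show "R N \<in> disc_analytic" using R by (simp add: Ap_iff)
    fix z :: complex assume z: "norm z < 1"
    have "R N z = (\<Sum>n. c n * z ^ n) - (\<Sum>n<N. c n * z ^ n)" using z by (simp add: R_def S_def F disc_power_def)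
    also have "\<dots> = (\<Sum>n. c (n + N) * z ^ (n + N))"
      by (rule suminf_minus_initial_segment[OF summable_norm_cancel[OF sm[OF z]], symmetric])
    finally have "norm (R N z) = norm (\<Sum>n. c (n + N) * z ^ (n + N))" by simp
    also have "\<dots> \<le> (\<Sum>n. norm (c (n + N) * z ^ (n + N)))"
      by (rule summable_norm) (rule summable_ignore_initial_segment[OF sm[OF z]])
    also have "\<dots> \<le> (\<Sum>n. norm (c (n + N)))"
      using le[OF z] by (intro suminf_le summable_ignore_initial_segment[OF sm[OF z]] summable_ignore_initial_segment[OF c]) auto
    finally show "norm (R N z) \<le> (\<Sum>n. norm (c (n + N)))" .
  qed
  have "(\<lambda>N. \<phi> F - (\<Sum>n<N. c n * \<phi> (disc_power n))) \<longlonglongrightarrow> 0"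
  proof (rule Lim_null_comparison)
    show "eventually (\<lambda>N. norm (\<phi> F - (\<Sum>n<N. c n * \<phi> (disc_power n))) \<le> C * (\<Sum>n. norm (c (n + N)))) sequentially"
      using C(2)[OF R] mult_left_mono[OF NR C(1)] unfolding \<phi>R by (intro always_eventually allI) (rule order_trans)
    have "(\<lambda>N. \<Sum>n. norm (c (n + N))) \<longlonglongrightarrow> 0" by (rule suminf_exist_split2[OF c])
    then show "(\<lambda>N. C * (\<Sum>n. norm (c (n + N)))) \<longlonglongrightarrow> 0" by (rule tendsto_mult_right_zero)
  qed
  then have "(\<lambda>N. \<phi> F - (\<phi> F - (\<Sum>n<N. c n * \<phi> (disc_power n)))) \<longlonglongrightarrow> \<phi> F - 0" by (intro tendsto_diff tendsto_const)
  then show "(\<lambda>n. c n * \<phi> (disc_power n)) sums \<phi> F" by (simp add: sums_def)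
qed

text \<open>Forced by orthogonality: the pairing of \<open>z ^ n\<close> with it has to return
  \<open>\<phi> (disc_power n)\<close>. Prescribing Taylor coefficients makes it analytic at once;
  its description by kernels is \<open>\<phi>_disc_kernel\<close>.\<close>

definition rep :: "complex \<Rightarrow> complex" where
  "rep z = (if norm z < 1 then \<Sum>n. (cnj (\<phi> (disc_power n)) / of_real (omega n)) * z ^ n else 0)"

lemma rep_analytic: "rep \<in> disc_analytic"
  unfolding rep_def
proof (rule disc_analytic_series)
  fix \<rho> :: real assume \<rho>: "0 \<le> \<rho>" "\<rho> < 1"
  obtain D where D: "\<And>n. norm (\<phi> (disc_power n)) \<le> D" by (rule \<phi>_disc_power_bounded) (rule that)
  show "summable (\<lambda>n. norm (cnj (\<phi> (disc_power n)) / of_real (omega n)) * \<rho> ^ n)"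
  proof (rule summable_comparison_test'[OF summable_mult[OF summable_power_omega[OF \<rho>], of D], of 0])
    fix n
    have "norm (\<phi> (disc_power n)) * (\<rho> ^ n / omega n) \<le> D * (\<rho> ^ n / omega n)"
      using D[of n] \<rho> omega_pos[of n] by (intro mult_right_mono) auto
    then show "norm (norm (cnj (\<phi> (disc_power n)) / complex_of_real (omega n)) * \<rho> ^ n) \<le> D * (\<rho> ^ n / omega n)"
      using \<rho> omega_pos[of n] by (simp add: norm_divide abs_mult)
  qed
qed

text \<open>Applies \<open>\<phi>\<close> to the Taylor series of the kernel. For
  \<open>p = 1\<close> this point evaluation gives the norm of \<open>rep\<close>.\<close>

lemma \<phi>_disc_kernel:
  assumes w: "norm w < 1"
  shows "\<phi> (disc_kernel w) = cnj (rep w)"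
proof -
  have sm: "summable (\<lambda>n. norm (cnj w ^ n / complex_of_real (omega n)))"
    using summable_power_omega[of "norm w"] w omega_pos by (simp add: norm_divide norm_power less_imp_le)
  have k: "disc_kernel w = (\<lambda>z. if norm z < 1 then \<Sum>n. (cnj w ^ n / of_real (omega n)) * z ^ n else 0)"
    using ker_sums[OF _ w] by (auto simp: disc_kernel_def fun_eq_iff sums_iff)
  have 1: "(\<lambda>n. cnj w ^ n / of_real (omega n) * \<phi> (disc_power n)) sums \<phi> (disc_kernel w)" by (rule \<phi>_series(2)[OF sm k])
  have "(\<lambda>n. cnj (cnj w ^ n / of_real (omega n) * \<phi> (disc_power n))) sums cnj (\<phi> (disc_kernel w))"
    using 1 by (simp only: sums_cnj)
  then have "(\<lambda>n. (cnj (\<phi> (disc_power n)) / of_real (omega n)) * w ^ n) sums cnj (\<phi> (disc_kernel w))"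
    by (simp add: mult_ac)
  then have "rep w = cnj (\<phi> (disc_kernel w))" using w by (simp add: rep_def sums_iff)
  then show ?thesis by simp
qed

text \<open>The support in \<open>cball 0 \<rho>\<close> bounds the coefficients of
  \<open>proj f\<close> by a multiple of \<open>\<rho> ^ n / omega n\<close>, so they are absolutely
  summable; both sides are then the series with terms
  \<open>a n / omega n * \<phi> (disc_power n)\<close>.\<close>

lemma \<phi>_proj:
  assumes f: "f \<in> borel_measurable disc_area" and B: "\<And>z. norm z < 1 \<Longrightarrow> norm (f z) \<le> B"
    and \<rho>: "0 \<le> \<rho>" "\<rho> < 1" and supp: "\<And>z. norm z > \<rho> \<Longrightarrow> f z = 0"
  shows "proj f \<in> Ap p" "\<phi> (proj f) = weighted_pairing v f rep"
proof -
  have i: "integrable disc_area (\<lambda>z. f z * of_real (v z))"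
  proof (rule disc_area.integrable_const_bound[where B=B])
    show "AE z in disc_area. norm (f z * complex_of_real (v z)) \<le> B"
    proof (rule AE_I2)
      fix z assume "z \<in> space disc_area"
      then have "norm (f z) * v z \<le> B * 1" using B[of z] v_le_1[of z] order_trans[OF norm_ge_zero B[of z]]
        by (intro mult_mono) (auto simp: less_imp_le)
      then show "norm (f z * complex_of_real (v z)) \<le> B" by (simp add: norm_mult less_imp_le)
    qed
  qed (use f v_disc_measurable in measurable)
  define a where "a n = (\<integral>\<zeta>. f \<zeta> * of_real (v \<zeta>) * cnj \<zeta> ^ n \<partial>disc_area)" for n
  define A where "A = (\<integral>\<zeta>. norm (f \<zeta> * of_real (v \<zeta>)) \<partial>disc_area)"
  have a: "norm (a n) \<le> A * \<rho> ^ n" for n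
  proof -
    have le: "norm (f \<zeta> * of_real (v \<zeta>) * cnj \<zeta> ^ n) \<le> norm (f \<zeta> * of_real (v \<zeta>)) * \<rho> ^ n" for \<zeta>
    proof (cases "norm \<zeta> \<le> \<rho>")
      case True
      then show ?thesis by (simp add: norm_mult norm_power mult_left_mono power_mono)
    next
      case False then show ?thesis using supp[of \<zeta>] by simp
    qed
    have "norm (a n) \<le> (\<integral>\<zeta>. norm (f \<zeta> * of_real (v \<zeta>) * cnj \<zeta> ^ n) \<partial>disc_area)"
      unfolding a_def by (rule integral_norm_bound)
    also have "\<dots> \<le> (\<integral>\<zeta>. norm (f \<zeta> * of_real (v \<zeta>)) * \<rho> ^ n \<partial>disc_area)"
      by (rule integral_mono_AE') (use i le \<rho> in \<open>auto simp del: norm_mult intro!: AE_I2 mult_nonneg_nonneg\<close>)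
    finally show ?thesis by (simp add: A_def)
  qed
  have sm: "summable (\<lambda>n. norm (a n / of_real (omega n)))"
  proof (rule summable_comparison_test'[OF summable_mult[OF summable_power_omega[OF \<rho>], of A], of 0])
    fix n
    have "norm (a n) / omega n \<le> A * \<rho> ^ n / omega n" using a[of n] omega_pos[of n] by (intro divide_right_mono) auto
    then show "norm (norm (a n / complex_of_real (omega n))) \<le> A * (\<rho> ^ n / omega n)"
      using omega_pos[of n] by (simp add: norm_divide)
  qed
  have pr: "proj f = (\<lambda>z. if norm z < 1 then \<Sum>n. (a n / of_real (omega n)) * z ^ n else 0)"
  proof
    fix z
    show "proj f z = (if norm z < 1 then \<Sum>n. (a n / of_real (omega n)) * z ^ n else 0)"
    proof (cases "norm z < 1")
      case True
      then show ?thesis using proj_series(1)[OF i True] by (simp add: a_def sums_iff)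
    qed (simp add: proj_def)
  qed
  show "proj f \<in> Ap p" by (rule \<phi>_series(1)[OF sm pr])
  have 1: "(\<lambda>n. a n / of_real (omega n) * \<phi> (disc_power n)) sums \<phi> (proj f)" by (rule \<phi>_series(2)[OF sm pr])
  obtain D where D: "\<And>n. norm (\<phi> (disc_power n)) \<le> D" by (rule \<phi>_disc_power_bounded) (rule that)
  let ?I = "indicator (cball 0 \<rho>) :: complex \<Rightarrow> complex"
  \<comment> \<open>The indicator is harmless where \<open>f\<close> is nonzero, and it gives the
    terms the majorant \<open>D * (\<rho> ^ n / omega n)\<close> on the whole disc.\<close>
  let ?u = "\<lambda>n \<zeta>. \<phi> (disc_power n) / of_real (omega n) * cnj \<zeta> ^ n * ?I \<zeta>"
  have [measurable]: "?I \<in> borel_measurable borel" by (rule borel_measurable_indicator) simp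
  have S: "(\<lambda>n. \<integral>\<zeta>. (f \<zeta> * of_real (v \<zeta>)) * ?u n \<zeta> \<partial>disc_area) sums (\<integral>\<zeta>. (f \<zeta> * of_real (v \<zeta>)) * (\<Sum>n. ?u n \<zeta>) \<partial>disc_area)"
  proof (rule integral_disc_sums(1)[OF i])
    show "?u n \<in> borel_measurable disc_area" for n by (rule measurable_disc_areaI) measurable
    show "summable (\<lambda>n. D * (\<rho> ^ n / omega n))" by (rule summable_mult[OF summable_power_omega[OF \<rho>]])
    fix n and \<zeta> :: complex
    have "norm (?u n \<zeta>) \<le> norm (\<phi> (disc_power n)) * (\<rho> ^ n / omega n)"
      using omega_pos[of n] \<rho> by (auto simp: norm_mult norm_divide norm_power intro!: mult_left_mono divide_right_mono power_mono split: split_indicator)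
    also have "\<dots> \<le> D * (\<rho> ^ n / omega n)" using D[of n] omega_pos[of n] \<rho> by (intro mult_right_mono) auto
    finally show "norm (?u n \<zeta>) \<le> D * (\<rho> ^ n / omega n)" .
  qed
  have E1: "(\<integral>\<zeta>. (f \<zeta> * of_real (v \<zeta>)) * ?u n \<zeta> \<partial>disc_area) = a n / of_real (omega n) * \<phi> (disc_power n)" for n
  proof -
    have "(f \<zeta> * of_real (v \<zeta>)) * ?u n \<zeta> = (\<phi> (disc_power n) / of_real (omega n)) * (f \<zeta> * of_real (v \<zeta>) * cnj \<zeta> ^ n)" for \<zeta>
      using supp[of \<zeta>] by (auto split: split_indicator)
    then show ?thesis unfolding a_def by (simp only: integral_mult_right_zero) simp
  qed
  have E2: "(\<integral>\<zeta>. (f \<zeta> * of_real (v \<zeta>)) * (\<Sum>n. ?u n \<zeta>) \<partial>disc_area) = weighted_pairing v f rep"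
    unfolding weighted_pairing_def
  proof (rule Bochner_Integration.integral_cong[OF refl])
    fix \<zeta> assume "\<zeta> \<in> space disc_area"
    then have z: "norm \<zeta> < 1" by simp
    show "(f \<zeta> * of_real (v \<zeta>)) * (\<Sum>n. ?u n \<zeta>) = f \<zeta> * cnj (rep \<zeta>) * of_real (v \<zeta>)"
    proof (cases "norm \<zeta> \<le> \<rho>")
      case True
      have sm: "summable (\<lambda>n. (cnj (\<phi> (disc_power n)) / of_real (omega n)) * \<zeta> ^ n)"
      proof (rule summable_norm_cancel, rule summable_comparison_test'[OF summable_mult[OF summable_power_omega[OF \<rho>], of D], of 0])
        fix n
        have "norm ((cnj (\<phi> (disc_power n)) / of_real (omega n)) * \<zeta> ^ n) = norm (\<phi> (disc_power n)) * (norm \<zeta> ^ n / omega n)"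
          using omega_pos[of n] by (simp add: norm_mult norm_divide norm_power)
        also have "\<dots> \<le> D * (\<rho> ^ n / omega n)"
          using D[of n] order_trans[OF norm_ge_zero D[of n]] omega_pos[of n] True by (intro mult_mono divide_right_mono power_mono) auto
        finally show "norm (norm ((cnj (\<phi> (disc_power n)) / of_real (omega n)) * \<zeta> ^ n)) \<le> D * (\<rho> ^ n / omega n)" by simp
      qed
      have "(\<lambda>n. cnj ((cnj (\<phi> (disc_power n)) / of_real (omega n)) * \<zeta> ^ n)) sums cnj (rep \<zeta>)"
        using summable_sums[OF sm] z unfolding rep_def by (simp only: sums_cnj if_True)
      then have "(\<Sum>n. ?u n \<zeta>) = cnj (rep \<zeta>)" using True by (simp add: sums_iff)
      then show ?thesis by simp
    next
      case False then show ?thesis using supp[of \<zeta>] by simp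
    qed
  qed
  show "\<phi> (proj f) = weighted_pairing v f rep" using 1 S unfolding E1 E2 by (rule sums_unique2)
qed

text \<open>
  Here \<open>f\<close> is the limit in norm of the projections of its truncations, as the projection is bounded and
  reproduces \<open>f\<close>.
\<close>

lemma \<phi>_eq_pairing:
  assumes f: "f \<in> Ap p" and i: "integrable disc_area (\<lambda>z. f z * cnj (rep z) * of_real (v z))"
  shows "\<phi> f = weighted_pairing v f rep"
proof -
  obtain C where C: "C \<ge> 0" "\<And>f. f \<in> Ap p \<Longrightarrow> norm (\<phi> f) \<le> C * Np p f" by (rule \<phi>_bounded) (rule that)
  have fa: "f \<in> disc_analytic" using f by (simp add: Ap_iff)
  have fm: "f \<in> borel_measurable disc_area" by (rule disc_analytic_measurable[OF fa])
  let ?I = "\<lambda>k. indicator (cball 0 (radii k)) :: complex \<Rightarrow> complex"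
  have Im [measurable]: "?I k \<in> borel_measurable disc_area" for k
    by (rule measurable_disc_areaI, rule borel_measurable_indicator) simp
  define F where "F k = (\<lambda>z. ?I k z * f z)" for k
  have Fm: "F k \<in> borel_measurable disc_area" for k unfolding F_def using fm by measurable
  have F: "proj (F k) \<in> Ap p \<and> \<phi> (proj (F k)) = weighted_pairing v (F k) rep" for k
  proof -
    have "continuous_on (cball 0 (radii k)) f"
      using fa radii[of k] by (auto simp: disc_analytic_def intro: continuous_on_subset[OF holomorphic_on_imp_continuous_on])
    then have "bounded (f ` cball 0 (radii k))" by (intro compact_imp_bounded compact_continuous_image) auto
    then obtain B where B0: "B > 0" "\<forall>x\<in>f ` cball 0 (radii k). norm x \<le> B" unfolding bounded_pos by blast
    then have B: "\<And>z. z \<in> cball 0 (radii k) \<Longrightarrow> norm (f z) \<le> B" "B > 0" by blast+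
    have "norm (F k z) \<le> B" for z using B by (auto simp: F_def split: split_indicator)
    moreover have "F k z = 0" if "norm z > radii k" for z using that by (simp add: F_def)
    ultimately show ?thesis using \<phi>_proj[OF Fm _ radii, of k B k] by blast
  qed
  have "(\<lambda>k. \<integral>z. ?I k z * (f z * cnj (rep z) * of_real (v z)) \<partial>disc_area) \<longlonglongrightarrow> (\<integral>z. f z * cnj (rep z) * of_real (v z) \<partial>disc_area)"
    by (rule tendsto_integral_cball[OF i])
  then have lim1: "(\<lambda>k. \<phi> (proj (F k))) \<longlonglongrightarrow> weighted_pairing v f rep"
    using F by (simp add: weighted_pairing_def F_def mult.assoc)
  \<comment> \<open>The \<open>p\<close>-th power of the norm of \<open>f - F k\<close> in
    \<open>L^p(s^p)\<close>; the difference of powers is exact, because truncation either keeps a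
    value or replaces it by \<open>0\<close>.\<close>
  define e where "e k = (\<integral>z. (norm (f z) * s z) powr p - indicator (cball 0 (radii k)) z * (norm (f z) * s z) powr p \<partial>disc_area)" for k
  have pint: "integrable disc_area (\<lambda>z. (norm (f z) * s z) powr p)"
    using f powr_s_measurable[OF fa, of p] by (simp add: integrable_iff_bounded Ap_iff wlp_def)
  have Ir: "(\<lambda>z. indicator (cball 0 (radii k)) z :: real) \<in> borel_measurable disc_area" for k
    by (rule measurable_disc_areaI, rule borel_measurable_indicator) simp
  have pintI: "integrable disc_area (\<lambda>z. indicator (cball 0 (radii k)) z * (norm (f z) * s z) powr p)" for k
    by (rule Bochner_Integration.integrable_bound[OF pint])
       (use Ir powr_s_measurable[OF fa, of p] in \<open>auto split: split_indicator\<close>)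
  have "(\<lambda>k. \<integral>z. indicator (cball 0 (radii k)) z * (norm (f z) * s z) powr p \<partial>disc_area) \<longlonglongrightarrow> (\<integral>z. (norm (f z) * s z) powr p \<partial>disc_area)"
    by (rule tendsto_integral_cball[OF pint])
  then have e0: "e \<longlonglongrightarrow> 0"
    unfolding e_def Bochner_Integration.integral_diff[OF pint pintI]
    using tendsto_diff[OF tendsto_const[of "\<integral>z. (norm (f z) * s z) powr p \<partial>disc_area"]] by fastforce
  have N: "norm (\<phi> f - \<phi> (proj (F k))) \<le> C * (Cker * e k powr (1 / p))" for k
  proof -
    define G where "G = (\<lambda>z. f z + (-1) * F k z)"
    define H where "H = (\<lambda>z. f z + (-1) * proj (F k) z)"
    have mF: "(\<lambda>z. (-1) * proj (F k) z) \<in> Ap p" using F Ap_scale by blast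
    have H: "H \<in> Ap p" unfolding H_def by (rule Ap_add[OF f mF p])
    have \<phi>H: "\<phi> H = \<phi> f - \<phi> (proj (F k))" unfolding H_def using \<phi>_add[OF f mF] \<phi>_scale[of "proj (F k)" "-1"] F by simp
    have Gm: "G \<in> borel_measurable disc_area" unfolding G_def using fm Fm by measurable
    have if': "integrable disc_area (\<lambda>z. f z * of_real (v z))" by (rule integrable_times_v[OF fm Ap_integrable_s[OF f p]])
    have iF: "integrable disc_area (\<lambda>z. F k z * of_real (v z))"
      by (rule Bochner_Integration.integrable_bound[OF if'])
         (use Fm v_disc_measurable in \<open>auto simp: F_def norm_mult split: split_indicator\<close>)
    \<comment> \<open>\<open>f - proj (F k) = proj (f - F k)\<close> by reproduction, so boundedness
      of the projection controls the norm of \<open>H\<close>.\<close>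
    have HG: "H = proj G"
    proof
      fix z
      show "H z = proj G z"
      proof (cases "norm z < 1")
        case True
        have 1: "f z = proj f z" using proj_reproduces[OF fa Ap_integrable_s[OF f p]] by simp
        have "H z = (\<integral>\<zeta>. f \<zeta> * of_real (v \<zeta>) * ker z \<zeta> \<partial>disc_area) - (\<integral>\<zeta>. F k \<zeta> * of_real (v \<zeta>) * ker z \<zeta> \<partial>disc_area)"
          using True unfolding H_def by (subst 1) (simp add: proj_def)
        also have "\<dots> = (\<integral>\<zeta>. f \<zeta> * of_real (v \<zeta>) * ker z \<zeta> - F k \<zeta> * of_real (v \<zeta>) * ker z \<zeta> \<partial>disc_area)"
          by (rule Bochner_Integration.integral_diff[OF proj_series(2)[OF if' True] proj_series(2)[OF iF True], symmetric])
        also have "\<dots> = proj G z" using True by (simp add: proj_def G_def algebra_simps)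
        finally show ?thesis .
      next
        case False then show ?thesis using fa by (simp add: H_def proj_def disc_analytic_def)
      qed
    qed
    have e: "e k \<ge> 0" unfolding e_def by (rule integral_nonneg_AE) (auto intro!: AE_I2 split: split_indicator)
    have "wlp p G = (\<integral>\<^sup>+z. ennreal ((norm (f z) * s z) powr p - indicator (cball 0 (radii k)) z * (norm (f z) * s z) powr p) \<partial>disc_area)"
      unfolding wlp_def by (rule nn_integral_cong) (auto simp: G_def F_def split: split_indicator)
    also have "\<dots> = ennreal (e k)"
      unfolding e_def by (rule nn_integral_eq_integral) (auto intro!: Bochner_Integration.integrable_diff pint pintI AE_I2 split: split_indicator)
    finally have "wlp p H \<le> ennreal (Cker powr p) * ennreal (e k)" using proj_bounded[OF Gm p] by (simp add: HG)
    also have "\<dots> = ennreal ((Cker * e k powr (1 / p)) powr p)"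
      using e p Cker(1) by (simp add: ennreal_mult[symmetric] powr_mult powr_powr)
    finally have "Np p H \<le> Cker * e k powr (1 / p)"
      using H Cker(1) p by (intro Ap_leI(2)) (auto simp: Ap_iff)
    then show ?thesis using C(2)[OF H] mult_left_mono[OF _ C(1)] order_trans unfolding \<phi>H by blast
  qed
  have "(\<lambda>k. \<phi> f - \<phi> (proj (F k))) \<longlonglongrightarrow> 0"
  proof (rule Lim_null_comparison[OF always_eventually, OF allI[OF N]])
    have "(\<lambda>k. e k powr (1 / p)) \<longlonglongrightarrow> 0 powr (1 / p)"
      using p by (intro tendsto_powr' e0 tendsto_const) (auto simp: e_def intro!: always_eventually integral_nonneg_AE AE_I2 split: split_indicator)
    then have "(\<lambda>k. C * (Cker * e k powr (1 / p))) \<longlonglongrightarrow> C * (Cker * 0 powr (1 / p))"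
      by (intro tendsto_mult[OF tendsto_const])
    then show "(\<lambda>k. C * (Cker * e k powr (1 / p))) \<longlonglongrightarrow> 0" by simp
  qed
  then have "(\<lambda>k. \<phi> f - (\<phi> f - \<phi> (proj (F k)))) \<longlonglongrightarrow> \<phi> f - 0" by (intro tendsto_diff tendsto_const)
  then have "(\<lambda>k. \<phi> (proj (F k))) \<longlonglongrightarrow> \<phi> f" by simp
  then show ?thesis using lim1 by (rule LIMSEQ_unique)
qed

text \<open>Tests \<open>\<phi>\<close> on the projection of the truncated extremal function of Hoelder's inequality for \<open>rep\<close>.\<close>

lemma rep_Ap:
  fixes q :: real
  assumes pq: "p > 1" "1 / p + 1 / q = 1" and K: "K \<ge> 0" "\<And>f. f \<in> Ap p \<Longrightarrow> norm (\<phi> f) \<le> K * Np p f"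
  shows "rep \<in> Ap q" "Np q rep \<le> Cker * K"
proof -
  note q = conjugate_exponent(1)[OF pq] and pq' = conjugate_exponent(2)[OF pq]
  have ra: "rep \<in> disc_analytic" by (rule rep_analytic)
  let ?h = "\<lambda>z. norm (rep z) * s z"
  have hm: "?h \<in> borel_measurable disc_area" using disc_analytic_measurable[OF ra] s_disc_measurable by measurable
  have main: "(\<integral>\<^sup>+z. indicator (cball 0 (radii k)) z * ennreal (?h z powr q) \<partial>disc_area) \<le> ennreal ((Cker * K) powr q)" for k
  proof -
    define \<rho> where "\<rho> = radii k"
    have \<rho>: "0 \<le> \<rho>" "\<rho> < 1" using radii by (auto simp: \<rho>_def)
    \<comment> \<open>Chosen so that inside the truncation
      \<open>norm f * s = ?h powr (q - 1)\<close> and \<open>f * cnj rep * v = ?h powr q\<close>; as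
      \<open>(q - 1) * p = q\<close>, both \<open>wlp p f\<close> and the pairing give the same
      number \<open>A\<close>.\<close>
    define f where "f = (\<lambda>z. indicator (cball 0 \<rho>) z * (rep z * of_real (?h z powr (q - 2))))"
    have [measurable]: "(indicator (cball 0 \<rho>) :: complex \<Rightarrow> complex) \<in> borel_measurable disc_area"
      by (rule measurable_disc_areaI, rule borel_measurable_indicator) simp
    have fm: "f \<in> borel_measurable disc_area" unfolding f_def using hm disc_analytic_measurable[OF ra] by measurable
    have nf: "norm (f z) * s z = indicator (cball 0 \<rho>) z * ?h z powr (q - 1)" for z
    proof -
      have "x powr (q - 1) = x * x powr (q - 2)" if "x \<ge> 0" for x
        using that by (cases "x = 0") (simp_all add: powr_diff power2_eq_square)
      then have "?h z powr (q - 1) = ?h z * ?h z powr (q - 2)" by (simp add: less_imp_le)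
      then show ?thesis by (simp add: f_def norm_mult split: split_indicator)
    qed
    have "continuous_on (cball 0 \<rho>) rep"
      using ra \<rho> by (auto simp: disc_analytic_def intro: continuous_on_subset[OF holomorphic_on_imp_continuous_on])
    then have "bounded (rep ` cball 0 \<rho>)" by (intro compact_imp_bounded compact_continuous_image) auto
    then obtain B where B0: "B > 0" "\<forall>x\<in>rep ` cball 0 \<rho>. norm x \<le> B" unfolding bounded_pos by blast
    then have B: "\<And>z. z \<in> cball 0 \<rho> \<Longrightarrow> norm (rep z) \<le> B" "B > 0" by blast+
    \<comment> \<open>For \<open>q < 2\<close> the exponent in \<open>f\<close> is negative, so the
      bound goes through \<open>norm f * s\<close>, where the exponent \<open>q - 1\<close> is
      positive.\<close>
    have fb: "norm (f z) \<le> B powr (q - 1) / s (of_real \<rho>)" if "norm z < 1" for z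
    proof (cases "z \<in> cball 0 \<rho>")
      case True
      have sz: "s (of_real \<rho>) \<le> s z"
      proof -
        have "1 / (1 - norm z) \<le> 1 / (1 - \<rho>)" using True \<rho> by (intro divide_left_mono) auto
        then have "\<alpha> / (2 * (1 - norm z)) \<le> \<alpha> / (2 * (1 - \<rho>))" using \<alpha> True \<rho> by (intro divide_left_mono) auto
        then show ?thesis using \<rho> by (simp add: s_def)
      qed
      have "?h z \<le> B * 1" using B True s_le_1[OF that] by (intro mult_mono) (auto simp: less_imp_le)
      then have "?h z powr (q - 1) \<le> B powr (q - 1)" using q by (intro powr_mono2) (auto simp: less_imp_le)
      then have "norm (f z) * s z \<le> B powr (q - 1)" using True by (simp add: nf)
      then have "norm (f z) \<le> B powr (q - 1) / s z" by (simp add: pos_le_divide_eq)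
      also have "\<dots> \<le> B powr (q - 1) / s (of_real \<rho>)" using sz by (intro divide_left_mono) auto
      finally show ?thesis .
    qed (simp add: f_def less_imp_le)
    have supp: "f z = 0" if "norm z > \<rho>" for z using that by (simp add: f_def)
    have P: "proj f \<in> Ap p" "\<phi> (proj f) = weighted_pairing v f rep"
      by (rule \<phi>_proj[OF fm fb \<rho> supp]; assumption)+
    define A where "A = (\<integral>z. indicator (cball 0 \<rho>) z * ?h z powr q \<partial>disc_area)"
    have Am: "(\<lambda>z. indicator (cball 0 \<rho>) z * ?h z powr q) \<in> borel_measurable disc_area"
      using hm measurable_disc_areaI[OF borel_measurable_indicator, of "cball 0 \<rho>"] by measurable
    have Ai: "integrable disc_area (\<lambda>z. indicator (cball 0 \<rho>) z * ?h z powr q)"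
    proof (rule disc_area.integrable_const_bound[where B="B powr q"])
      show "AE z in disc_area. norm (indicator (cball 0 \<rho>) z * ?h z powr q) \<le> B powr q"
      proof (rule AE_I2)
        fix z assume z: "z \<in> space disc_area"
        show "norm (indicator (cball 0 \<rho>) z * ?h z powr q) \<le> B powr q"
        proof (cases "z \<in> cball 0 \<rho>")
          case True
          have "?h z \<le> B * 1" using B True s_le_1[of z] z by (intro mult_mono) (auto simp: less_imp_le)
          then show ?thesis using True q by (auto intro!: powr_mono2 simp: less_imp_le)
        qed simp
      qed
    qed (rule Am)
    have A0: "A \<ge> 0" unfolding A_def by (rule integral_nonneg_AE) (auto intro!: AE_I2)
    have An: "(\<integral>\<^sup>+z. ennreal (indicator (cball 0 \<rho>) z * ?h z powr q) \<partial>disc_area) = ennreal A"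
      unfolding A_def by (rule nn_integral_eq_integral[OF Ai]) (auto intro!: AE_I2)
    have "weighted_pairing v f rep = (\<integral>z. complex_of_real (indicator (cball 0 \<rho>) z * ?h z powr q) \<partial>disc_area)"
      unfolding weighted_pairing_def
    proof (rule Bochner_Integration.integral_cong[OF refl])
      fix z
      have "x powr q = x\<^sup>2 * x powr (q - 2)" if "x \<ge> 0" for x
        using that by (cases "x = 0") (simp_all add: powr_diff power2_eq_square)
      then have "?h z powr q = ?h z ^ 2 * ?h z powr (q - 2)" by (simp add: less_imp_le)
      moreover have "rep z * cnj (rep z) * of_real (v z) = of_real (?h z ^ 2)"
        by (simp add: complex_norm_square[symmetric] power_mult_distrib s_square)
      ultimately show "f z * cnj (rep z) * complex_of_real (v z) = complex_of_real (indicator (cball 0 \<rho>) z * ?h z powr q)"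
        by (simp add: f_def mult_ac split: split_indicator)
    qed
    also have "\<dots> = of_real A" unfolding A_def by (rule integral_complex_of_real)
    finally have "A = norm (\<phi> (proj f))" using P(2) A0 by simp
    also have "\<dots> \<le> K * Np p (proj f)" by (rule K(2)[OF P(1)])
    also have "\<dots> \<le> K * (Cker * A powr (1 / p))"
    proof (intro mult_left_mono Ap_leI(2))
      have "wlp p (proj f) \<le> ennreal (Cker powr p) * wlp p f" by (rule proj_bounded[OF fm p])
      also have "wlp p f = (\<integral>\<^sup>+z. ennreal (indicator (cball 0 \<rho>) z * ?h z powr q) \<partial>disc_area)"
        unfolding wlp_def nf using pq(1) by (intro nn_integral_cong) (simp add: powr_powr pq' split: split_indicator)
      also have "\<dots> = ennreal A" by (rule An)
      also have "ennreal (Cker powr p) * ennreal A = ennreal ((Cker * A powr (1 / p)) powr p)"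
        using A0 Cker(1) p by (simp add: ennreal_mult[symmetric] powr_mult powr_powr)
      finally show "wlp p (proj f) \<le> ennreal ((Cker * A powr (1 / p)) powr p)" .
      show "proj f \<in> disc_analytic" using P(1) by (simp add: Ap_iff)
    qed (use Cker(1) K(1) p in auto)
    finally have le: "A \<le> (Cker * K) * A powr (1 / p)" by (simp add: mult_ac)
    \<comment> \<open>Truncation makes \<open>A\<close> finite, so \<open>A powr (1 / p)\<close>
      cancels and \<open>A powr (1 / q) \<le> Cker * K\<close> is left.\<close>
    have "A \<le> (Cker * K) powr q"
    proof (cases "A = 0")
      case False
      then have Ap: "A > 0" using A0 by simp
      have "A powr (1 / q) * A powr (1 / p) \<le> (Cker * K) * A powr (1 / p)"
        using le Ap pq(2) by (simp add: powr_add[symmetric] add.commute)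
      then have "A powr (1 / q) \<le> Cker * K" using Ap by (simp add: mult_le_cancel_right)
      then have "(A powr (1 / q)) powr q \<le> (Cker * K) powr q" using q by (intro powr_mono2) auto
      then show ?thesis using Ap q by (simp add: powr_powr)
    qed simp
    moreover have "(\<integral>\<^sup>+z. indicator (cball 0 (radii k)) z * ennreal (?h z powr q) \<partial>disc_area) = ennreal A"
      unfolding An[symmetric] \<rho>_def by (rule nn_integral_cong) (auto split: split_indicator)
    ultimately show ?thesis by (simp add: ennreal_leI)
  qed
  have Inm: "(\<lambda>z. indicator (cball 0 (radii k)) z * ennreal (?h z powr q)) \<in> borel_measurable disc_area" for k
  proof -
    have [measurable]: "(indicator (cball 0 (radii k)) :: complex \<Rightarrow> ennreal) \<in> borel_measurable disc_area"
      by (rule measurable_disc_areaI, rule borel_measurable_indicator) simp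
    show ?thesis using hm by measurable
  qed
  \<comment> \<open>The bound is uniform in \<open>k\<close>; Fatou's lemma carries it to the whole
    disc.\<close>
  have "wlp q rep = (\<integral>\<^sup>+z. liminf (\<lambda>k. indicator (cball 0 (radii k)) z * ennreal (?h z powr q)) \<partial>disc_area)"
    unfolding wlp_def
  proof (rule nn_integral_cong)
    fix z assume "z \<in> space disc_area"
    then have "eventually (\<lambda>k. norm z \<le> radii k) sequentially" by (intro eventually_radii) simp
    then have "eventually (\<lambda>k. indicator (cball 0 (radii k)) z * ennreal (?h z powr q) = ennreal (?h z powr q)) sequentially"
      by eventually_elim simp
    then have "(\<lambda>k. indicator (cball 0 (radii k)) z * ennreal (?h z powr q)) \<longlonglongrightarrow> ennreal (?h z powr q)" by (rule tendsto_eventually)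
    then show "ennreal (?h z powr q) = liminf (\<lambda>k. indicator (cball 0 (radii k)) z * ennreal (?h z powr q))"
      by (rule lim_imp_Liminf[symmetric, rotated]) simp
  qed
  also have "\<dots> \<le> liminf (\<lambda>k. \<integral>\<^sup>+z. indicator (cball 0 (radii k)) z * ennreal (?h z powr q) \<partial>disc_area)"
    by (rule nn_integral_liminf[OF Inm])
  also have "\<dots> \<le> ennreal ((Cker * K) powr q)"
    by (intro Liminf_le always_eventually allI main) simp
  finally have "wlp q rep \<le> ennreal ((Cker * K) powr q)" .
  then show "rep \<in> Ap q" "Np q rep \<le> Cker * K"
    using Ap_leI[OF ra _ _ less_imp_le[OF q]] Cker(1) K(1) by auto
qed

end

subsection \<open>Duality\<close>

context exp_disc
begin

lemma pairing_integrand_measurable: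
  "f \<in> disc_analytic \<Longrightarrow> g \<in> disc_analytic \<Longrightarrow> (\<lambda>z. f z * cnj (g z) * of_real (v z)) \<in> borel_measurable disc_area"
  using disc_analytic_measurable[of f] measurable_compose[OF disc_analytic_measurable cnj_borel_measurable, of g] v_disc_measurable
  by measurable

lemma norm_pairing_integrand: "norm (f z * cnj (g z) * of_real (v z)) = (norm (f z) * s z) * (norm (g z) * s z)"
  by (simp add: norm_mult s_square[symmetric] power2_eq_square less_imp_le mult_ac)

lemma pairing_boundI:
  assumes fg: "f \<in> disc_analytic" "g \<in> disc_analytic"
    and le: "(\<integral>\<^sup>+z. ennreal ((norm (f z) * s z) * (norm (g z) * s z)) \<partial>disc_area) \<le> ennreal c" and c: "c \<ge> 0"
  shows "integrable disc_area (\<lambda>z. f z * cnj (g z) * of_real (v z))" "norm (weighted_pairing v f g) \<le> c"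
proof -
  let ?h = "\<lambda>z. f z * cnj (g z) * of_real (v z)"
  have n: "(\<integral>\<^sup>+z. ennreal (norm (?h z)) \<partial>disc_area) \<le> ennreal c" using le by (simp only: norm_pairing_integrand)
  have "(\<integral>\<^sup>+z. ennreal (norm (?h z)) \<partial>disc_area) < \<infinity>" by (rule le_less_trans[OF n]) simp
  then show i: "integrable disc_area ?h"
    using pairing_integrand_measurable[OF fg] by (simp only: integrable_iff_bounded)
  have "ennreal (norm (weighted_pairing v f g)) \<le> ennreal c"
    unfolding weighted_pairing_def by (rule order_trans[OF integral_norm_bound_ennreal[OF i] n])
  then show "norm (weighted_pairing v f g) \<le> c" using c by (simp add: ennreal_le_iff)
qed

lemma pairing_Ap:
  fixes p q :: real
  assumes p: "p > 1" and pq: "1 / p + 1 / q = 1" and f: "f \<in> Ap p" and g: "g \<in> Ap q"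
  shows "integrable disc_area (\<lambda>z. f z * cnj (g z) * of_real (v z))"
    "norm (weighted_pairing v f g) \<le> Np p f * Np q g"
proof -
  note q = conjugate_exponent(1)[OF p pq]
  have fg: "f \<in> disc_analytic" "g \<in> disc_analytic" using f g by (auto simp: Ap_iff)
  have hm: "(\<lambda>z. norm (h z) * s z) \<in> borel_measurable disc_area" if "h \<in> disc_analytic" for h
    using disc_analytic_measurable[OF that] s_disc_measurable by measurable
  \<comment> \<open>Adding \<open>\<epsilon>\<close> makes the bounds strictly positive, as
    \<open>holder_nn\<close> asks; it tends to \<open>0\<close> at the end.\<close>
  have Ie: "(\<integral>\<^sup>+z. ennreal ((norm (h z) * s z) powr r) \<partial>disc_area) \<le> ennreal ((Np r h + \<epsilon>) powr r)"
    if "h \<in> Ap r" "r > 1" "\<epsilon> > 0" for h r \<epsilon>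
    using wlp_eq[OF that(1)] that Np_nonneg[of r h] by (auto simp: wlp_def intro!: ennreal_leI powr_mono2)
  have *: "(\<integral>\<^sup>+z. ennreal ((norm (f z) * s z) * (norm (g z) * s z)) \<partial>disc_area) \<le> ennreal ((Np p f + \<epsilon>) * (Np q g + \<epsilon>))"
    if e: "\<epsilon> > 0" for \<epsilon>
    by (rule holder_nn[OF hm[OF fg(1)] hm[OF fg(2)] _ _ p q pq _ _ Ie[OF f p e] Ie[OF g q e]])
       (use e Np_nonneg[of p f] Np_nonneg[of q g] in \<open>auto simp: less_imp_le intro: add_nonneg_pos\<close>)
  have nn: "0 \<le> (Np p f + \<epsilon>) * (Np q g + \<epsilon>)" if "\<epsilon> > 0" for \<epsilon>
    using that Np_nonneg[of p f] Np_nonneg[of q g] by (intro mult_nonneg_nonneg) auto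
  show "integrable disc_area (\<lambda>z. f z * cnj (g z) * of_real (v z))"
    by (rule pairing_boundI(1)[OF fg *[OF zero_less_one] nn[OF zero_less_one]])
  have "((\<lambda>\<epsilon>. (Np p f + \<epsilon>) * (Np q g + \<epsilon>)) \<longlongrightarrow> (Np p f + 0) * (Np q g + 0)) (at_right 0)"
    by (intro tendsto_intros)
  moreover have "eventually (\<lambda>\<epsilon>. norm (weighted_pairing v f g) \<le> (Np p f + \<epsilon>) * (Np q g + \<epsilon>)) (at_right 0)"
    using eventually_at_right_less[of 0] by eventually_elim (rule pairing_boundI(2)[OF fg * nn])
  ultimately have "norm (weighted_pairing v f g) \<le> (Np p f + 0) * (Np q g + 0)"
    by (rule tendsto_lowerbound) simp
  then show "norm (weighted_pairing v f g) \<le> Np p f * Np q g" by simp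
qed

section \<open>The space \<open>Ainf\<close> and its pairing with \<open>Ap 1\<close>\<close>

abbreviation Ainf :: "(complex \<Rightarrow> complex) set" where "Ainf \<equiv> bergman_inf (\<lambda>z. v z powr (1 / 2))"
abbreviation Ninf :: "(complex \<Rightarrow> complex) \<Rightarrow> real" where "Ninf \<equiv> bergman_inf_norm (\<lambda>z. v z powr (1 / 2))"

lemma v_powr_half: "v z powr (1 / 2) = s z"
  by (simp add: powr_half_sqrt s_square[symmetric] less_imp_le)

lemma Ainf_le: "g \<in> Ainf \<Longrightarrow> norm z < 1 \<Longrightarrow> norm (g z) * s z \<le> Ninf g"
  unfolding bergman_inf_def bergman_inf_norm_def v_powr_half by (auto intro: cSUP_upper)

lemma Ainf_leI:
  assumes "g \<in> disc_analytic" "\<And>z. norm z < 1 \<Longrightarrow> norm (g z) * s z \<le> c"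
  shows "g \<in> Ainf" "Ninf g \<le> c"
  using assms unfolding bergman_inf_def bergman_inf_norm_def v_powr_half
  by (auto intro!: bdd_aboveI2 cSUP_least)

lemma Ainf_analytic: "g \<in> Ainf \<Longrightarrow> g \<in> disc_analytic"
  by (simp add: bergman_inf_def)

lemma Ninf_nonneg: "g \<in> Ainf \<Longrightarrow> Ninf g \<ge> 0"
  by (rule order_trans[OF _ Ainf_le[of g 0]]) (auto simp: less_imp_le)

lemma Ainf_integrable_s:
  assumes "g \<in> Ainf" shows "integrable disc_area (\<lambda>z. norm (g z) * s z)"
proof (rule disc_area.integrable_const_bound[where B="Ninf g"])
  show "AE z in disc_area. norm (norm (g z) * s z) \<le> Ninf g"
    using Ainf_le[OF assms] by (auto intro!: AE_I2 simp: abs_mult less_imp_le)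
  show "(\<lambda>z. norm (g z) * s z) \<in> borel_measurable disc_area"
    using disc_analytic_measurable[OF Ainf_analytic[OF assms]] s_disc_measurable by measurable
qed

lemma pairing_A1:
  assumes f: "f \<in> Ap 1" and g: "g \<in> Ainf"
  shows "integrable disc_area (\<lambda>z. f z * cnj (g z) * of_real (v z))"
    "norm (weighted_pairing v f g) \<le> Np 1 f * Ninf g"
proof -
  have fg: "f \<in> disc_analytic" "g \<in> disc_analytic" using f g Ainf_analytic by (auto simp: Ap_iff)
  have "(\<integral>\<^sup>+z. ennreal ((norm (f z) * s z) * (norm (g z) * s z)) \<partial>disc_area)
      \<le> (\<integral>\<^sup>+z. ennreal (Ninf g) * ennreal ((norm (f z) * s z) powr 1) \<partial>disc_area)"
  proof (rule nn_integral_mono)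
    fix z assume "z \<in> space disc_area"
    then have "(norm (f z) * s z) * (norm (g z) * s z) \<le> (norm (f z) * s z) * Ninf g"
      using Ainf_le[OF g, of z] by (intro mult_left_mono) (auto simp: less_imp_le)
    then show "ennreal ((norm (f z) * s z) * (norm (g z) * s z)) \<le> ennreal (Ninf g) * ennreal ((norm (f z) * s z) powr 1)"
      using Ninf_nonneg[OF g] by (simp add: ennreal_mult[symmetric] less_imp_le mult.commute ennreal_leI)
  qed
  also have "\<dots> = ennreal (Ninf g) * wlp 1 f"
    unfolding wlp_def by (rule nn_integral_cmult) (use powr_s_measurable[OF fg(1), of 1] in measurable)
  also have "\<dots> = ennreal (Np 1 f * Ninf g)"
    using wlp_eq[OF f] Np_nonneg[of 1 f] Ninf_nonneg[OF g] by (simp add: ennreal_mult[symmetric] mult.commute)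
  finally have *: "(\<integral>\<^sup>+z. ennreal ((norm (f z) * s z) * (norm (g z) * s z)) \<partial>disc_area) \<le> ennreal (Np 1 f * Ninf g)" .
  have nn: "0 \<le> Np 1 f * Ninf g" using Np_nonneg Ninf_nonneg[OF g] by simp
  show "integrable disc_area (\<lambda>z. f z * cnj (g z) * of_real (v z))"
    "norm (weighted_pairing v f g) \<le> Np 1 f * Ninf g"
    using pairing_boundI[OF fg * nn] by auto
qed

text \<open>The part common to both dualities, with \<open>Y\<close> either \<open>Ap q\<close> or
  \<open>Ainf\<close>; the bound of the pairing and the norm estimate for the representative are
  left as assumptions.\<close>

lemma Ap_dualI:
  assumes p: "p \<ge> 1"
    and Y: "\<And>g. g \<in> Y \<Longrightarrow> g \<in> disc_analytic" "\<And>g. g \<in> Y \<Longrightarrow> integrable disc_area (\<lambda>z. norm (g z) * s z)"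
    and NY: "\<And>g. g \<in> Y \<Longrightarrow> NY g \<ge> 0"
    and int: "\<And>f g. f \<in> Ap p \<Longrightarrow> g \<in> Y \<Longrightarrow> integrable disc_area (\<lambda>z. f z * cnj (g z) * of_real (v z))"
    and bound: "\<And>f g. f \<in> Ap p \<Longrightarrow> g \<in> Y \<Longrightarrow> norm (weighted_pairing v f g) \<le> Np p f * NY g"
    and rep: "\<And>\<phi> K. bergman_functional \<alpha> p \<phi> \<Longrightarrow> K \<ge> 0 \<Longrightarrow> (\<And>f. f \<in> Ap p \<Longrightarrow> norm (\<phi> f) \<le> K * Np p f) \<Longrightarrow>
      bergman_functional.rep \<alpha> \<phi> \<in> Y \<and> NY (bergman_functional.rep \<alpha> \<phi>) \<le> Cker * K"
  shows "pairing_defined v (Ap p) Y \<and> is_dual_under (Ap p) (Np p) Y NY (weighted_pairing v)"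
proof
  show "pairing_defined v (Ap p) Y" unfolding pairing_defined_def using int by blast
  show "is_dual_under (Ap p) (Np p) Y NY (weighted_pairing v)"
  proof (rule is_dual_underI[where M=Cker])
    show "(\<lambda>_. 0) \<in> Ap p" by (rule Ap_0[OF p])
    show "(\<lambda>z. f z + g z) \<in> Ap p" if "f \<in> Ap p" "g \<in> Ap p" for f g by (rule Ap_add[OF that p])
    show "(\<lambda>z. c * f z) \<in> Ap p" if "f \<in> Ap p" for c f by (rule Ap_scale[OF that])
    show "Np p (\<lambda>z. c * f z) = norm c * Np p f" if "f \<in> Ap p" for c f by (rule Np_scale[OF that p])
    show "Np p f \<ge> 0" for f by (rule Np_nonneg)
    show "NY g \<ge> 0" if "g \<in> Y" for g by (rule NY[OF that])
    show "weighted_pairing v f (\<lambda>z. g z + h z) = weighted_pairing v f g + weighted_pairing v f h"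
      if "f \<in> Ap p" "g \<in> Y" "h \<in> Y" for f g h
    proof -
      have "weighted_pairing v f (\<lambda>z. g z + h z) = (\<integral>z. f z * cnj (g z) * of_real (v z) + f z * cnj (h z) * of_real (v z) \<partial>disc_area)"
        unfolding weighted_pairing_def by (rule Bochner_Integration.integral_cong) (simp_all add: algebra_simps)
      then show ?thesis using int[OF that(1,2)] int[OF that(1,3)] by (simp add: weighted_pairing_def)
    qed
    show "weighted_pairing v f (\<lambda>z. c * g z) = cnj c * weighted_pairing v f g" for c f g
    proof -
      have "weighted_pairing v f (\<lambda>z. c * g z) = (\<integral>z. cnj c * (f z * cnj (g z) * of_real (v z)) \<partial>disc_area)"
        unfolding weighted_pairing_def by (rule Bochner_Integration.integral_cong) (simp_all add: mult_ac)
      then show ?thesis by (simp only: weighted_pairing_def integral_mult_right_zero)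
    qed
    show "weighted_pairing v (\<lambda>z. f z + g z) h = weighted_pairing v f h + weighted_pairing v g h"
      if "f \<in> Ap p" "g \<in> Ap p" "h \<in> Y" for f g h
    proof -
      have "weighted_pairing v (\<lambda>z. f z + g z) h = (\<integral>z. f z * cnj (h z) * of_real (v z) + g z * cnj (h z) * of_real (v z) \<partial>disc_area)"
        unfolding weighted_pairing_def by (rule Bochner_Integration.integral_cong) (simp_all add: algebra_simps)
      then show ?thesis using int[OF that(1,3)] int[OF that(2,3)] by (simp add: weighted_pairing_def)
    qed
    show "weighted_pairing v (\<lambda>z. c * f z) g = c * weighted_pairing v f g" for c f g
    proof -
      have "weighted_pairing v (\<lambda>z. c * f z) g = (\<integral>z. c * (f z * cnj (g z) * of_real (v z)) \<partial>disc_area)"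
        unfolding weighted_pairing_def by (rule Bochner_Integration.integral_cong) (simp_all add: mult_ac)
      then show ?thesis by (simp only: weighted_pairing_def integral_mult_right_zero)
    qed
    show "norm (weighted_pairing v f g) \<le> Np p f * NY g" if "f \<in> Ap p" "g \<in> Y" for f g
      by (rule bound[OF that])
    \<comment> \<open>Testing on kernel functions recovers the values of \<open>g\<close> and
      \<open>h\<close> at every point.\<close>
    show "g = h" if gh: "g \<in> Y" "h \<in> Y" "\<And>f. f \<in> Ap p \<Longrightarrow> weighted_pairing v f g = weighted_pairing v f h" for g h
    proof (rule disc_analytic_cong)
      fix w :: complex assume w: "norm w < 1"
      have "cnj (g w) = cnj (h w)"
        using gh(3)[OF disc_kernel_Ap[OF w p]] by (simp only: pairing_disc_kernel[OF Y(1,2)[OF gh(1)] w] pairing_disc_kernel[OF Y(1,2)[OF gh(2)] w])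
      then show "g w = h w" by simp
    qed (use Y gh in auto)
    show "Cker > 0" by (rule Cker)
    fix \<phi> assume \<phi>: "\<phi> \<in> dual_space (Ap p) (Np p)"
    interpret bergman_functional \<alpha> p \<phi> by standard (use p \<phi> in auto)
    obtain C where C: "C \<ge> 0" "\<And>f. f \<in> Ap p \<Longrightarrow> norm (\<phi> f) \<le> C * Np p f" by (rule \<phi>_bounded) (rule that)
    have repY: "rep \<in> Y" using assms(7)[OF bergman_functional_axioms C] by blast
    show "\<exists>g\<in>Y. (\<forall>f\<in>Ap p. \<phi> f = weighted_pairing v f g) \<and>
      (\<forall>K\<ge>0. (\<forall>f\<in>Ap p. norm (\<phi> f) \<le> K * Np p f) \<longrightarrow> NY g \<le> Cker * K)"
    proof (intro bexI[OF _ repY] conjI ballI allI impI)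
      show "\<phi> f = weighted_pairing v f rep" if "f \<in> Ap p" for f
        by (rule \<phi>_eq_pairing[OF that int[OF that repY]])
      show "NY rep \<le> Cker * K" if "0 \<le> K" "\<forall>f\<in>Ap p. norm (\<phi> f) \<le> K * Np p f" for K
        using assms(7)[OF bergman_functional_axioms that(1)] that(2) by blast
    qed
  qed
qed

lemma dual_Ap:
  fixes p q :: real
  assumes p: "p > 1" and pq: "1 / p + 1 / q = 1"
  shows "pairing_defined v (Ap p) (Ap q) \<and> is_dual_under (Ap p) (Np p) (Ap q) (Np q) (weighted_pairing v)"
proof (rule Ap_dualI)
  note q = conjugate_exponent(1)[OF p pq]
  show "p \<ge> 1" using p by simp
  show "integrable disc_area (\<lambda>z. norm (g z) * s z)" if "g \<in> Ap q" for g
    by (rule Ap_integrable_s[OF that less_imp_le[OF q]])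
  show "bergman_functional.rep \<alpha> \<phi> \<in> Ap q \<and> Np q (bergman_functional.rep \<alpha> \<phi>) \<le> Cker * K"
    if "bergman_functional \<alpha> p \<phi>" "K \<ge> 0" "\<And>f. f \<in> Ap p \<Longrightarrow> norm (\<phi> f) \<le> K * Np p f" for \<phi> K
    using bergman_functional.rep_Ap[OF that(1) p pq that(2,3)] by blast
qed (auto simp: Ap_iff Np_nonneg intro: pairing_Ap[OF p pq, unfolded Ap_iff])

text \<open>The kernel estimate says that \<open>disc_kernel w\<close> has norm at most
  \<open>Cker / s w\<close> in \<open>Ap 1\<close>; as \<open>\<phi>\<close> takes the value
  \<open>cnj (rep w)\<close> there, the weighted supremum of \<open>rep\<close> is bounded
  directly.\<close>

lemma dual_A1:
  "pairing_defined v (Ap 1) Ainf \<and> is_dual_under (Ap 1) (Np 1) Ainf Ninf (weighted_pairing v)"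
proof (rule Ap_dualI)
  show "bergman_functional.rep \<alpha> \<phi> \<in> Ainf \<and> Ninf (bergman_functional.rep \<alpha> \<phi>) \<le> Cker * K"
    if F: "bergman_functional \<alpha> 1 \<phi>" and K: "K \<ge> 0" "\<And>f. f \<in> Ap 1 \<Longrightarrow> norm (\<phi> f) \<le> K * Np 1 f" for \<phi> K
  proof -
    interpret bergman_functional \<alpha> 1 \<phi> by (rule F)
    have "norm (rep w) * s w \<le> Cker * K" if w: "norm w < 1" for w
    proof -
      have k: "disc_kernel w \<in> Ap 1" by (rule disc_kernel_Ap[OF w]) simp
      have "Np 1 (disc_kernel w) \<le> Cker / s w"
      proof (rule Ap_leI(2))
        have "wlp 1 (disc_kernel w) = (\<integral>\<^sup>+z. ennreal (norm (ker z w) * s z) \<partial>disc_area)"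
          unfolding wlp_def by (rule nn_integral_cong) (simp add: disc_kernel_def less_imp_le)
        also have "\<dots> \<le> ennreal (Cker / s w)" by (rule Cker(2)[OF w])
        finally show "wlp 1 (disc_kernel w) \<le> ennreal ((Cker / s w) powr 1)" using Cker(1) by (simp add: less_imp_le)
      qed (use k Cker(1) in \<open>auto simp: Ap_iff less_imp_le\<close>)
      then have "norm (\<phi> (disc_kernel w)) \<le> K * (Cker / s w)"
        by (rule order_trans[OF K(2)[OF k] mult_left_mono[OF _ K(1)]])
      then have "norm (rep w) \<le> K * Cker / s w" by (simp add: \<phi>_disc_kernel[OF w])
      then show ?thesis by (simp add: pos_le_divide_eq mult.commute)
    qed
    then show ?thesis using Ainf_leI[OF rep_analytic] by blast
  qed
qed (auto simp: Ainf_analytic Ainf_integrable_s Ninf_nonneg intro: pairing_A1)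

end

theorem corollary8:
  fixes \<alpha> :: real and v :: "complex \<Rightarrow> real"
  assumes "\<alpha> > 0"
  defines "v \<equiv> exp_weight \<alpha>"
  shows "(\<forall>p q :: real. 1 < p \<and> 1 / p + 1 / q = 1 \<longrightarrow>
            pairing_defined v (bergman p (\<lambda>z. v z powr (p / 2))) (bergman q (\<lambda>z. v z powr (q / 2))) \<and>
            is_dual_under
              (bergman p (\<lambda>z. v z powr (p / 2))) (bergman_norm p (\<lambda>z. v z powr (p / 2)))
              (bergman q (\<lambda>z. v z powr (q / 2))) (bergman_norm q (\<lambda>z. v z powr (q / 2)))
              (weighted_pairing v)) \<and>
         pairing_defined v (bergman 1 (\<lambda>z. v z powr (1 / 2))) (bergman_inf (\<lambda>z. v z powr (1 / 2))) \<and>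
         is_dual_under
           (bergman 1 (\<lambda>z. v z powr (1 / 2))) (bergman_norm 1 (\<lambda>z. v z powr (1 / 2)))
           (bergman_inf (\<lambda>z. v z powr (1 / 2))) (bergman_inf_norm (\<lambda>z. v z powr (1 / 2)))
           (weighted_pairing v)"
proof -
  interpret exp_disc \<alpha> by standard fact
  show ?thesis unfolding v_def using dual_Ap dual_A1 by blast
qed

end
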